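(* Let $X$ be an Asplund space, let $\varphi:X\to(-\infty,\infty]$, let $\{\Omega_i\}_{i\in T}$ be a system of subsets of $X$ (closed around the points under consideration) indexed by an arbitrary, possibly infinite, set $T$, and let $\bar{x}$ be a local optimal solution to the problem $$\text{minimize}\ \varphi(x)\quad\text{subject to}\quad x\in\Omega_i,\ i\in T.$$ Assume that any basic normal to $\Omega:=\bigcap_{i\in T}\Omega_i$ at $\bar{x}$ is a limiting $R$-normal, and that the approximate qualification condition (AQC) is satisfied for $\{\Omega_i\}_{i\in T}$ at $\bar{x}$. Then the following conditions, involving finite index subsets $I\subset T$, hold: (i) For general cost functions $\varphi$ finite at $\bar{x}$ we have $$-\widehat{\partial}^+\varphi(\bar{x})\subset\bigcap_{\varepsilon>0}\operatorname{cl}^*\Big\{\sum_{i\in I}x_i^*+\varepsilon\mathbb{B}^*\ \Big|\ x_i^*\in\widehat{N}(x_i;\Omega_i),\ \|x_i-\bar{x}\|<\varepsilon,\ I\subset T\Big\}.$$ (ii) If in addition $\varphi$ is locally Lipschitzian around $\bar{x}$, then $$0\in\partial\varphi(\bar{x})+\bigcap_{\varepsilon>0}\operatorname{cl}^*\Big\{\sum_{i\in I}x_i^*+\varepsilon\mathbb{B}^*\ \Big|\ x_i^*\in\widehat{N}(x_i;\Omega_i),\ \|x_i-\bar{x}\|<\varepsilon,\ I\subset T\Big\}.$$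
   Context: A Banach space is Asplund if each of its separable subspaces has a separable dual. $\mathbb{B}^*$ is the closed unit ball of $X^*$; $B(\bar{x},\rho)$ is the closed ball centered at $\bar{x}$ with radius $\rho$; $|I|$ is the number of elements of a finite set $I$; $\operatorname{cl}^*$ is the closure in the weak$^*$ topology of $X^*$. The set in braces is the union, over all finite $I\subset T$ and all choices of $x_i$, $x_i^*$ ($i\in I$) as indicated, of the sets $\sum_{i\in I}x_i^*+\varepsilon\mathbb{B}^*$. Subdifferentials: for $\varphi$ finite at $\bar{x}$, the Fréchet subdifferential is $\widehat{\partial}\varphi(\bar{x}):=\{x^*\in X^*\mid\liminf_{x\to\bar{x}}\frac{\varphi(x)-\varphi(\bar{x})-\langle x^*,x-\bar{x}\rangle}{\|x-\bar{x}\|}\ge0\}$; the Fréchet upper subdifferential is $\widehat{\partial}^+\varphi(\bar{x}):=-\widehat{\partial}(-\varphi)(\bar{x})$. For $\varphi$ locally Lipschitzian around $\bar{x}$, the basic (limiting) subdifferential $\partial\varphi(\bar{x})$ is the set of all $x^*\in X^*$ for which there are sequences $x_k\to\bar{x}$ and $x_k^*\to x^*$ weak$^*$ with $x_k^*\in\widehat{\partial}\varphi(x_k)$ for all $k\in\mathbb{N}$. Normals: for $\Omega\subset X$ and $\varepsilon\ge0$ put $\widehat{N}_\varepsilon(x;\Omega):=\{x^*\in X^*\mid\limsup_{u\to x,\,u\in\Omega}\frac{\langle x^*,u-x\rangle}{\|u-x\|}\le\varepsilon\}$ if $x\in\Omega$ and $\widehat{N}_\varepsilon(x;\Omega):=\emptyset$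 if $x\notin\Omega$; $\widehat{N}(x;\Omega):=\widehat{N}_0(x;\Omega)$ is the Fréchet normal cone. A basic (limiting) normal to $\Omega$ at $\bar{x}$ is an $x^*\in X^*$ for which there are sequences $\varepsilon_k\downarrow0$, $x_k\to\bar{x}$ and $x_k^*\to x^*$ weak$^*$ with $x_k^*\in\widehat{N}_{\varepsilon_k}(x_k;\Omega)$ for all $k\in\mathbb{N}$. A function $R(\cdot):\mathbb{R}_+\to\mathbb{R}_+$ is a rate function if there is a real number $M$ such that $rR(r)\le M$ for all $r$ and $\lim_{r\downarrow0}R(r)=\infty$; rate functions are assumed to be continuous (on $(0,\infty)$). Write $R_r:=R(r)$. Rated normals: $x^*\in X^*$ is an $R$-normal to $\Omega=\bigcap_{i\in T}\Omega_i$ at $\bar{x}\in\Omega$ if for any $r\downarrow0$ (i.e., for all sufficiently small $r>0$) there is a finite set $I=I(r)\subset T$, of cardinality $|I(r)|^{3/2}=o(R_r)$ as $r\downarrow0$, such that $\langle x^*,x-\bar{x}\rangle-r\|x-\bar{x}\|<r$ for all $x\in\bigcap_{i\in I}\Omega_i\cap B(\bar{x},rR_r)$. Limiting rated normals: $x^*$ is a limiting $R$-normal to $\Omega=\bigcap_{i\in T}\Omega_i$ at $\bar{x}\in\Omega$ if there is a sequence $\{(x_k,x_k^* )\}_{k\in\mathbb{N}}\subset X\times X^*$ such that $x_k\to\bar{x}$ with $x_k\in\Omega$, $x_k^*\to x^*$ weak$^*$ as $k\to\infty$, and each $x_k^*$ is an $R_k$-normal to $\Omega$ at $x_k$, where $R_k$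 is a rate function for $x_k^*$ (these rate functions may be different from each other). AQC: $\{\Omega_i\}_{i\in T}$ satisfies the approximate qualification condition at $\bar{x}\in\bigcap_{i\in T}\Omega_i$ if for any $\varepsilon\downarrow0$ (i.e., along any sequence of positive numbers $\varepsilon$ decreasing to $0$), any finite index subsets $I_\varepsilon\subset T$, and any Fréchet normals $x_{i\varepsilon}^*\in\widehat{N}(x_{i\varepsilon};\Omega_i)\cap\mathbb{B}^*$ with $\|x_{i\varepsilon}-\bar{x}\|\le\varepsilon$, $i\in I_\varepsilon$, the following implication holds: if $\big\|\sum_{i\in I_\varepsilon}x_{i\varepsilon}^*\big\|\to0$ as $\varepsilon\downarrow0$, then $\sum_{i\in I_\varepsilon}\|x_{i\varepsilon}^*\|^2\to0$ as $\varepsilon\downarrow0$.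
   Formalization: "Closed around the points under consideration" is taken uniformly: one ball around x̄ in which all Ω_i are closed. With radii depending on i the claim fails: X=ℝ, x̄=0, Ω_i=(-1/i,1/i), φ(x)=-x. *)

theory Defs
  imports
    "HOL-Analysis.Analysis"
    "HOL-Library.Landau_Symbols"
    "HOL-Library.Set_Algebras"
begin

section \<open>Asplund spaces and the weak-star topology\<close>

text \<open>
  The dual of the subspace \<open>Y\<close>: bounded linear functionals on \<open>Y\<close>, taken in
  \<^term>\<open>extensional Y\<close> so that each functional has a unique representative.
\<close>
definition dual_on :: "'a::real_normed_vector set \<Rightarrow> ('a \<Rightarrow> real) set" where
  "dual_on Y = {f \<in> extensional Y.
     (\<forall>x\<in>Y. \<forall>y\<in>Y. f (x + y) = f x + f y) \<and>
     (\<forall>c. \<forall>x\<in>Y. f (c *\<^sub>R x) = c * f x) \<and>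
     (\<exists>K. \<forall>x\<in>Y. \<bar>f x\<bar> \<le> K * norm x)}"

definition dual_norm_on :: "'a::real_normed_vector set \<Rightarrow> ('a \<Rightarrow> real) \<Rightarrow> real" where
  "dual_norm_on Y f = (SUP x\<in>Y \<inter> cball 0 1. \<bar>f x\<bar>)"

definition separable_dual_on :: "'a::real_normed_vector set \<Rightarrow> bool" where
  "separable_dual_on Y \<longleftrightarrow>
     (\<exists>D \<subseteq> dual_on Y. countable D \<and>
        (\<forall>f\<in>dual_on Y. \<forall>e>0. \<exists>g\<in>D. dual_norm_on Y (\<lambda>x. f x - g x) < e))"

text \<open>
  Subspaces are not required to be closed here; this makes no difference, because a
  subspace and its closure have the same dual and are separable simultaneously.
\<close>
definition asplund_space :: "'a::banach itself \<Rightarrow> bool" where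
  "asplund_space _ \<longleftrightarrow>
     (\<forall>Y :: 'a set. subspace Y \<and> separable_space (top_of_set Y) \<longrightarrow> separable_dual_on Y)"

text \<open>
  For real-valued operators the topology of pointwise convergence on \<open>X \<Rightarrow>\<^sub>L \<real>\<close>
  is the weak-star topology of the dual of \<open>X\<close>; the norm of \<open>X \<Rightarrow>\<^sub>L \<real>\<close> is the dual norm.
\<close>
abbreviation weak_star_topology :: "('a::real_normed_vector \<Rightarrow>\<^sub>L real) topology" where
  "weak_star_topology \<equiv> strong_operator_topology"

definition decreases_to_zero :: "(nat \<Rightarrow> real) \<Rightarrow> bool" where
  "decreases_to_zero e \<longleftrightarrow> (\<forall>k. e k > 0) \<and> decseq e \<and> e \<longlonglongrightarrow> 0"


section \<open>Subdifferentials\<close>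

text \<open>Empty, by convention, at points where \<open>\<phi>\<close> is not finite.\<close>
definition frechet_subdifferential ::
    "('a::real_normed_vector \<Rightarrow> ereal) \<Rightarrow> 'a \<Rightarrow> ('a \<Rightarrow>\<^sub>L real) set" where
  "frechet_subdifferential \<phi> xb =
     (if \<bar>\<phi> xb\<bar> \<noteq> \<infinity>
      then {xs. Liminf (at xb)
                  (\<lambda>x. (\<phi> x - \<phi> xb - ereal (blinfun_apply xs (x - xb))) / ereal (norm (x - xb))) \<ge> 0}
      else {})"

definition frechet_upper_subdifferential ::
    "('a::real_normed_vector \<Rightarrow> ereal) \<Rightarrow> 'a \<Rightarrow> ('a \<Rightarrow>\<^sub>L real) set" where
  "frechet_upper_subdifferential \<phi> xb =
     (\<lambda>xs. - xs) ` frechet_subdifferential (\<lambda>x. - \<phi> x) xb"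

definition locally_lipschitz_around ::
    "('a::real_normed_vector \<Rightarrow> ereal) \<Rightarrow> 'a \<Rightarrow> bool" where
  "locally_lipschitz_around \<phi> xb \<longleftrightarrow>
     (\<exists>\<rho>>0. \<exists>L. (\<forall>x\<in>ball xb \<rho>. \<bar>\<phi> x\<bar> \<noteq> \<infinity>) \<and>
        L-lipschitz_on (ball xb \<rho>) (\<lambda>x. real_of_ereal (\<phi> x)))"

definition basic_subdifferential ::
    "('a::real_normed_vector \<Rightarrow> ereal) \<Rightarrow> 'a \<Rightarrow> ('a \<Rightarrow>\<^sub>L real) set" where
  "basic_subdifferential \<phi> xb =
     {xs. \<exists>x xsk. x \<longlonglongrightarrow> xb \<and> limitin weak_star_topology xsk xs sequentially \<and>
        (\<forall>k. xsk k \<in> frechet_subdifferential \<phi> (x k))}"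


section \<open>Normals\<close>

definition eps_normals ::
    "real \<Rightarrow> 'a::real_normed_vector \<Rightarrow> 'a set \<Rightarrow> ('a \<Rightarrow>\<^sub>L real) set" where
  "eps_normals e x S =
     (if x \<in> S
      then {xs. Limsup (at x within S)
                  (\<lambda>u. ereal (blinfun_apply xs (u - x) / norm (u - x))) \<le> ereal e}
      else {})"

definition frechet_normals :: "'a::real_normed_vector \<Rightarrow> 'a set \<Rightarrow> ('a \<Rightarrow>\<^sub>L real) set" where
  "frechet_normals x S = eps_normals 0 x S"

definition basic_normals :: "'a::real_normed_vector \<Rightarrow> 'a set \<Rightarrow> ('a \<Rightarrow>\<^sub>L real) set" where
  "basic_normals xb S =
     {xs. \<exists>e x xsk. decreases_to_zero e \<and> x \<longlonglongrightarrow> xb \<and>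
        limitin weak_star_topology xsk xs sequentially \<and>
        (\<forall>k. xsk k \<in> eps_normals (e k) (x k) S)}"

definition rate_function :: "(real \<Rightarrow> real) \<Rightarrow> bool" where
  "rate_function R \<longleftrightarrow>
     (\<forall>r\<ge>0. R r \<ge> 0) \<and> (\<exists>M. \<forall>r\<ge>0. r * R r \<le> M) \<and>
     filterlim R at_top (at_right 0) \<and> continuous_on {0<..} R"

text \<open>
  An \<open>R\<close>-normal to \<open>\<Inter>i\<in>T. \<Omega> i\<close> depends on the system \<open>\<Omega>\<close> itself,
  not only on the intersection.
\<close>
definition rated_normal ::
    "(real \<Rightarrow> real) \<Rightarrow> 'i set \<Rightarrow> ('i \<Rightarrow> 'a::real_normed_vector set) \<Rightarrow> 'a \<Rightarrow> ('a \<Rightarrow>\<^sub>L real) \<Rightarrow> bool" where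
  "rated_normal R T \<Omega> xb xs \<longleftrightarrow>
     xb \<in> (\<Inter>i\<in>T. \<Omega> i) \<and>
     (\<exists>I :: real \<Rightarrow> 'i set.
        (\<lambda>r. real (card (I r)) powr (3/2)) \<in> o[at_right 0](R) \<and>
        (\<forall>\<^sub>F r in at_right 0. finite (I r) \<and> I r \<subseteq> T \<and>
           (\<forall>x \<in> (\<Inter>i\<in>I r. \<Omega> i) \<inter> cball xb (r * R r).
              blinfun_apply xs (x - xb) - r * norm (x - xb) < r)))"

definition limiting_rated_normal ::
    "'i set \<Rightarrow> ('i \<Rightarrow> 'a::real_normed_vector set) \<Rightarrow> 'a \<Rightarrow> ('a \<Rightarrow>\<^sub>L real) \<Rightarrow> bool" where
  "limiting_rated_normal T \<Omega> xb xs \<longleftrightarrow>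
     xb \<in> (\<Inter>i\<in>T. \<Omega> i) \<and>
     (\<exists>x xsk. x \<longlonglongrightarrow> xb \<and> (\<forall>k. x k \<in> (\<Inter>i\<in>T. \<Omega> i)) \<and>
        limitin weak_star_topology xsk xs sequentially \<and>
        (\<forall>k. \<exists>R. rate_function R \<and> rated_normal R T \<Omega> (x k) (xsk k)))"


section \<open>Set systems\<close>

text \<open>
  The sets are closed around \<open>xb\<close>, hence also around all nearby points, on a common
  neighborhood.  For infinite \<open>T\<close> the radius must not depend on the index.
\<close>
definition system_closed_around :: "'i set \<Rightarrow> ('i \<Rightarrow> 'a::real_normed_vector set) \<Rightarrow> 'a \<Rightarrow> bool" where
  "system_closed_around T \<Omega> xb \<longleftrightarrow> (\<exists>\<rho>>0. \<forall>i\<in>T. closed (\<Omega> i \<inter> cball xb \<rho>))"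

definition approximate_qualification ::
    "'i set \<Rightarrow> ('i \<Rightarrow> 'a::real_normed_vector set) \<Rightarrow> 'a \<Rightarrow> bool" where
  "approximate_qualification T \<Omega> xb \<longleftrightarrow>
     (\<forall>(e :: nat \<Rightarrow> real) (I :: nat \<Rightarrow> 'i set) (x :: nat \<Rightarrow> 'i \<Rightarrow> 'a) (xs :: nat \<Rightarrow> 'i \<Rightarrow> 'a \<Rightarrow>\<^sub>L real).
        decreases_to_zero e \<and>
        (\<forall>k. finite (I k) \<and> I k \<subseteq> T) \<and>
        (\<forall>k. \<forall>i\<in>I k. xs k i \<in> frechet_normals (x k i) (\<Omega> i) \<inter> cball 0 1 \<and>
                        norm (x k i - xb) \<le> e k) \<and>
        (\<lambda>k. norm (\<Sum>i\<in>I k. xs k i)) \<longlonglongrightarrow> 0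
        \<longrightarrow> (\<lambda>k. \<Sum>i\<in>I k. (norm (xs k i))\<^sup>2) \<longlonglongrightarrow> 0)"

definition approximate_normal_sums ::
    "'i set \<Rightarrow> ('i \<Rightarrow> 'a::real_normed_vector set) \<Rightarrow> 'a \<Rightarrow> real \<Rightarrow> ('a \<Rightarrow>\<^sub>L real) set" where
  "approximate_normal_sums T \<Omega> xb \<epsilon> =
     {(\<Sum>i\<in>I. xs i) + \<epsilon> *\<^sub>R b | (I :: 'i set) x xs b.
        finite I \<and> I \<subseteq> T \<and>
        (\<forall>i\<in>I. xs i \<in> frechet_normals (x i) (\<Omega> i) \<and> norm (x i - xb) < \<epsilon>) \<and>
        b \<in> cball 0 1}"

definition local_optimal_solution ::
    "('a::real_normed_vector \<Rightarrow> ereal) \<Rightarrow> 'a set \<Rightarrow> 'a \<Rightarrow> bool" where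
  "local_optimal_solution \<phi> S xb \<longleftrightarrow>
     xb \<in> S \<and> (\<exists>\<delta>>0. \<forall>x\<in>S \<inter> ball xb \<delta>. \<phi> xb \<le> \<phi> x)"

end

(*
  An R-normal f at a point p satisfies f (x - p) - r * norm (x - p) < r for all x in finitely many sets
  near p.  Hence the Euclidean combination of r - f (x - p) + r * norm (x - p) and of the distances from
  x to points z_i of these sets stays positive near p, although it is small at p itself.  The variational
  principle and the fuzzy sum rule produce approximate minimisers, and the optimality conditions read
  l * f = sum of Frechet normals at the z_i up to a small error, with l^2 plus the sum of the squared norms
  bounded below.  If the multipliers l tend to 0, this contradicts the approximate qualification
  condition; otherwise one divides by l.  In (i) an upper subgradient is a Frechet normal to the
  intersection.  In (ii) the fuzzy sum rule, applied to phi(x) + L * norm (x - y) with y in the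
  intersection, yields subgradients and normals with small sum, and a weak-star convergent subsequence
  exists because the space is Asplund.

  The fuzzy sum rule holds in a separable subspace because its dual is separable: there is a smooth
  gauge, with which the two variables can be decoupled and the perturbation of the variational
  principle is smooth.  By the Hahn-Banach theorem the existence of the functional in the fuzzy sum
  rule amounts to inequalities that involve finitely many points each; this allows to pass from a
  suitable separable subspace to the whole space.
*)
theory Submission
  imports Defs "HOL-Complex_Analysis.Great_Picard"
begin

section \<open>The Hahn-Banach theorem\<close>

text \<open>The multipliers have to be normalised as in the approximate qualification condition,
  that is, by a sum of squares, and with a lower bound that does not depend on the number of sets.
  This is why the penalty is a Euclidean norm of its terms and why all points vary jointly, in one
  application of the fuzzy sum rule to a power of \<open>'a\<close>, instead of the sets being added
  one by one. The index set changes with \<open>r\<close> while types are fixed, so these powers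
  live inside one space of bounded sequences. That space is in general not Asplund; hence the sum
  rule is stated relative to a subspace \<open>V\<close>. The growth of \<open>R\<close> enters
  through the perturbation: its slope \<open>s\<close> must be at least of order
  \<open>1 / R r\<close> to keep the minimiser in the ball of radius \<open>r * R r\<close>, yet
  below the tolerance, which is possible since \<open>R r\<close> tends to infinity. For the
  separable reduction, the unspecified smallness in a Frechet subgradient is an obstacle; explicit
  moduli with integer parameters turn it into countably many conditions.\<close>

definition sublinear :: "('a::real_vector \<Rightarrow> real) \<Rightarrow> bool" where
  "sublinear q \<longleftrightarrow> (\<forall>x y. q (x + y) \<le> q x + q y) \<and> (\<forall>c>0. \<forall>x. q (c *\<^sub>R x) = c * q x)"

lemma sublinear_zero: assumes "sublinear q" shows "q 0 = 0"
proof -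
  have "q (2 *\<^sub>R 0) = 2 * q 0" using assms unfolding sublinear_def by (meson zero_less_numeral)
  then show ?thesis by simp
qed

lemma sublinear_neg: assumes "sublinear q" shows "- q (- x) \<le> q x"
proof -
  have "q (x + - x) \<le> q x + q (- x)" using assms unfolding sublinear_def by blast
  then show ?thesis using sublinear_zero[OF assms] by simp
qed

text \<open>Subadditivity rests on the chain property: the smaller of two members \<open>p\<close>
  and \<open>r\<close> bounds the infimum at \<open>x + y\<close>, and it is at most
  \<open>p\<close> at \<open>x\<close> and at most \<open>r\<close> at \<open>y\<close>. The common
  majorant keeps the infimum finite, as \<open>- N (- x) \<le> - q (- x) \<le> q x\<close>.\<close>

lemma sublinear_INF_chain:
  assumes C: "C \<noteq> {}" and sub: "\<And>q. q \<in> C \<Longrightarrow> sublinear q" and le: "\<And>q. q \<in> C \<Longrightarrow> q \<le> N"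
    and chain: "\<And>p q. p \<in> C \<Longrightarrow> q \<in> C \<Longrightarrow> p \<le> q \<or> q \<le> p"
  shows "sublinear (\<lambda>x. INF q\<in>C. q x)" and "\<And>q x. q \<in> C \<Longrightarrow> (INF q\<in>C. q x) \<le> q x"
proof -
  have bd: "bdd_below ((\<lambda>q. q x) ` C)" for x
  proof (rule bdd_belowI2)
    fix q assume q: "q \<in> C"
    have "q (- x) \<le> N (- x)" using le[OF q] by (simp add: le_fun_def)
    then show "- N (- x) \<le> q x" using sublinear_neg[OF sub[OF q], of x] by linarith
  qed
  show low: "(INF q\<in>C. q x) \<le> q x" if "q \<in> C" for q x
    using cINF_lower[OF bd that] by simp
  show "sublinear (\<lambda>x. INF q\<in>C. q x)"
    unfolding sublinear_def
  proof (intro conjI allI impI)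
    fix x y
    have "(INF q\<in>C. q (x + y)) - p x \<le> r y" if p: "p \<in> C" and r: "r \<in> C" for p r
    proof -
      have "(INF q\<in>C. q (x + y)) \<le> p x + r y"
      proof (cases "p \<le> r")
        case True
        have "(INF q\<in>C. q (x + y)) \<le> p (x + y)" using low p .
        also have "\<dots> \<le> p x + p y" using sub[OF p] by (simp add: sublinear_def)
        finally show ?thesis using True by (auto simp: le_fun_def intro: order_trans)
      next
        case False
        then have "r \<le> p" using chain p r by blast
        have "(INF q\<in>C. q (x + y)) \<le> r (x + y)" using low r .
        also have "\<dots> \<le> r x + r y" using sub[OF r] by (simp add: sublinear_def)
        finally show ?thesis using \<open>r \<le> p\<close> by (auto simp: le_fun_def intro: order_trans)
      qed
      then show ?thesis by simp
    qed
    then have "(INF q\<in>C. q (x + y)) - p x \<le> (INF q\<in>C. q y)" if "p \<in> C" for p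
      using that by (intro cINF_greatest[OF C]) auto
    then have "(INF q\<in>C. q (x + y)) - (INF q\<in>C. q y) \<le> p x" if "p \<in> C" for p
      using that by (simp add: algebra_simps)
    then have "(INF q\<in>C. q (x + y)) - (INF q\<in>C. q y) \<le> (INF q\<in>C. q x)"
      by (intro cINF_greatest[OF C]) auto
    then show "(INF q\<in>C. q (x + y)) \<le> (INF q\<in>C. q x) + (INF q\<in>C. q y)" by simp
  next
    fix c :: real and x assume c: "c > 0"
    have hom: "q (c *\<^sub>R x) = c * q x" if "q \<in> C" for q
      using sub[OF that] c by (simp add: sublinear_def)
    have "c * (INF q\<in>C. q x) \<le> (INF q\<in>C. q (c *\<^sub>R x))"
    proof (rule cINF_greatest[OF C])
      fix p assume p: "p \<in> C"
      show "c * (INF q\<in>C. q x) \<le> p (c *\<^sub>R x)"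
        unfolding hom[OF p] using low[OF p] c by (intro mult_left_mono) auto
    qed
    moreover have "(INF q\<in>C. q (c *\<^sub>R x)) / c \<le> (INF q\<in>C. q x)"
      using c low[of _ "c *\<^sub>R x"] hom
      by (intro cINF_greatest[OF C]) (auto simp: field_simps)
    ultimately show "(INF q\<in>C. q (c *\<^sub>R x)) = c * (INF q\<in>C. q x)"
      using c by (simp add: field_simps)
  qed
qed

text \<open>A minimal sublinear functional below \<open>N\<close> is linear. Zorn's lemma is applied
  to the reversed order, so that the infimum of a chain is the required upper bound.\<close>

lemma hahn_banach_sublinear:
  fixes N :: "'a::real_vector \<Rightarrow> real"
  assumes N: "sublinear N"
  obtains f where "linear f" "\<And>x. f x \<le> N x"
proof -
  define A where "A = {q. sublinear q \<and> q \<le> N}"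
  have "\<exists>m\<in>A. \<forall>a\<in>A. a \<le> m \<longrightarrow> a = m"
  proof (rule predicate_Zorn[of A "\<lambda>p q. q \<le> p"])
    show "partial_order_on A (relation_of (\<lambda>p q. q \<le> p) A)"
      by (auto simp: partial_order_on_def preorder_on_def refl_on_def trans_def antisym_def relation_of_def
          intro: order_trans order_antisym)
    fix C assume "C \<in> Chains (relation_of (\<lambda>p q. q \<le> p) A)"
    then have CA: "C \<subseteq> A" and ch: "\<And>p q. p \<in> C \<Longrightarrow> q \<in> C \<Longrightarrow> p \<le> q \<or> q \<le> p"
      by (auto simp: Chains_def relation_of_def)
    show "\<exists>u\<in>A. \<forall>a\<in>C. u \<le> a"
    proof (cases "C = {}")
      case True then show ?thesis using N by (auto simp: A_def)
    next
      case False
      have *: "\<And>q. q \<in> C \<Longrightarrow> sublinear q" "\<And>q. q \<in> C \<Longrightarrow> q \<le> N" using CA by (auto simp: A_def)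
      have I: "sublinear (\<lambda>x. INF q\<in>C. q x)" "\<And>q x. q \<in> C \<Longrightarrow> (INF q\<in>C. q x) \<le> q x"
        using sublinear_INF_chain[OF False *(1) *(2) ch] by blast+
      obtain q where q: "q \<in> C" using False by blast
      have "(\<lambda>x. INF q\<in>C. q x) \<le> N"
        using I(2)[OF q] *(2)[OF q] by (auto simp: le_fun_def intro: order_trans)
      then show ?thesis using I by (intro bexI[of _ "\<lambda>x. INF q\<in>C. q x"]) (auto simp: A_def le_fun_def)
    qed
  qed
  then obtain m where m: "sublinear m" "m \<le> N" and min: "\<And>q. sublinear q \<Longrightarrow> q \<le> m \<Longrightarrow> q = m"
    unfolding A_def by (auto intro: order_trans)
  have madd: "m (x + y) \<le> m x + m y" for x y using m(1) by (simp add: sublinear_def)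
  have mhom: "c > 0 \<Longrightarrow> m (c *\<^sub>R x) = c * m x" for c x using m(1) by (simp add: sublinear_def)
  have mhom0: "c \<ge> 0 \<Longrightarrow> m (c *\<^sub>R x) = c * m x" for c x
    using mhom[of c x] sublinear_zero[OF m(1)] by (cases "c = 0") auto
  have super: "m v + m u \<le> m (v + u)" for u v
  proof -
    \<comment> \<open>Lowering \<open>m\<close> along the direction \<open>u\<close> gives a
      sublinear functional below \<open>m\<close>. By minimality nothing is lowered, and the term
      with \<open>t = 1\<close> is then superadditivity.\<close>
    define q where "q v = (INF t\<in>{0..}. m (v + t *\<^sub>R u) - t * m u)" for v
    have bd: "bdd_below ((\<lambda>t. m (v + t *\<^sub>R u) - t * m u) ` {0..})" for v
    proof (rule bdd_belowI2)
      fix t :: real assume "t \<in> {0..}"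
      then have "t * m u = m (t *\<^sub>R u)" using mhom0 by simp
      also have "\<dots> \<le> m (v + t *\<^sub>R u) + m (- v)" using madd[of "v + t *\<^sub>R u" "- v"] by simp
      finally show "- m (- v) \<le> m (v + t *\<^sub>R u) - t * m u" by simp
    qed
    have ql: "t \<ge> 0 \<Longrightarrow> q v \<le> m (v + t *\<^sub>R u) - t * m u" for t v
      unfolding q_def using cINF_lower[OF bd, of t v] by simp
    have qg: "(\<And>t. t \<ge> 0 \<Longrightarrow> z \<le> m (v + t *\<^sub>R u) - t * m u) \<Longrightarrow> z \<le> q v" for z v
      unfolding q_def by (rule cINF_greatest) auto
    have "sublinear q"
      unfolding sublinear_def
    proof (intro conjI allI impI)
      fix x y
      have 1: "q (x + y) - (m (y + t *\<^sub>R u) - t * m u) \<le> m (x + s *\<^sub>R u) - s * m u"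
        if "t \<ge> 0" "s \<ge> 0" for s t
      proof -
        have "q (x + y) \<le> m ((x + y) + (s + t) *\<^sub>R u) - (s + t) * m u" using ql that by simp
        also have "(x + y) + (s + t) *\<^sub>R u = (x + s *\<^sub>R u) + (y + t *\<^sub>R u)" by (simp add: algebra_simps)
        finally show ?thesis using madd[of "x + s *\<^sub>R u" "y + t *\<^sub>R u"] by (simp add: algebra_simps)
      qed
      have "q (x + y) - (m (y + t *\<^sub>R u) - t * m u) \<le> q x" if "t \<ge> 0" for t
        using 1 that by (intro qg) auto
      then have "q (x + y) - q x \<le> m (y + t *\<^sub>R u) - t * m u" if "t \<ge> 0" for t
        using that by (simp add: algebra_simps)
      then have "q (x + y) - q x \<le> q y" by (intro qg) auto
      then show "q (x + y) \<le> q x + q y" by simp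
    next
      fix c :: real and x assume c: "c > 0"
      have a: "q (c *\<^sub>R x) \<le> c * q x" if c: "c > 0" for c x
      proof -
        have "q (c *\<^sub>R x) / c \<le> q x"
        proof (rule qg)
          fix t :: real assume t: "t \<ge> 0"
          have "q (c *\<^sub>R x) \<le> m (c *\<^sub>R x + (c * t) *\<^sub>R u) - (c * t) * m u" using ql t c by simp
          also have "c *\<^sub>R x + (c * t) *\<^sub>R u = c *\<^sub>R (x + t *\<^sub>R u)" by (simp add: algebra_simps)
          also have "m \<dots> = c * m (x + t *\<^sub>R u)" using mhom c .
          finally show "q (c *\<^sub>R x) / c \<le> m (x + t *\<^sub>R u) - t * m u"
            using c by (simp add: field_simps)
        qed
        then show ?thesis using c by (simp add: field_simps)
      qed
      have "q x \<le> inverse c * q (c *\<^sub>R x)" using a[of "inverse c" "c *\<^sub>R x"] c by simp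
      then have "c * q x \<le> q (c *\<^sub>R x)" using c by (simp add: field_simps)
      then show "q (c *\<^sub>R x) = c * q x" using a[OF c, of x] by linarith
    qed
    moreover have "q \<le> m" using ql[of 0] by (auto simp: le_fun_def)
    ultimately have "q = m" by (rule min)
    then show ?thesis using ql[of 1 v] by simp
  qed
  have add: "m (x + y) = m x + m y" for x y using super madd by (meson antisym)
  have neg: "m (- x) = - m x" for x using add[of x "- x"] sublinear_zero[OF m(1)] by simp
  have "m (c *\<^sub>R x) = c * m x" for c x
  proof (cases "c \<ge> 0")
    case False
    then have "m ((- c) *\<^sub>R x) = (- c) * m x" using mhom0[of "- c"] by simp
    then show ?thesis using neg[of "c *\<^sub>R x"] by simp
  qed (rule mhom0)
  then have "linear m" using add by (intro linearI) auto
  then show ?thesis using that m(2) by (auto simp: le_fun_def)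
qed

text \<open>The infimum \<open>N\<close> of the slopes of \<open>E\<close> along rays is sublinear:
  slopes at the parameters \<open>t\<close> and \<open>s\<close> are compared with the slope at
  \<open>s * t / (s + t)\<close>, for which the point is a convex combination of the other two.
  Applied to \<open>v\<close> and \<open>- v\<close>, the same comparison and
  \<open>0 \<le> E 0\<close> bound the slopes from below.\<close>

lemma hahn_banach_convex:
  fixes E :: "'a::real_vector \<Rightarrow> real"
  assumes E: "convex_on UNIV E" and E0: "0 \<le> E 0"
  obtains f where "linear f" "\<And>x. f x \<le> E x"
proof -
  define N where "N v = (INF t\<in>{0<..}. E (t *\<^sub>R v) / t)" for v
  have cv: "E (a *\<^sub>R x + b *\<^sub>R y) \<le> a * E x + b * E y" if "a \<ge> 0" "b \<ge> 0" "a + b = 1" for a b x y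
    using E that unfolding convex_on_def by blast
  have key: "E ((s * t / (s + t)) *\<^sub>R (v + w)) / (s * t / (s + t)) \<le> E (t *\<^sub>R v) / t + E (s *\<^sub>R w) / s"
    if "s > 0" "t > 0" for s t v w
  proof -
    have "(s * t / (s + t)) *\<^sub>R (v + w) = (s / (s + t)) *\<^sub>R (t *\<^sub>R v) + (t / (s + t)) *\<^sub>R (s *\<^sub>R w)"
      using that by (simp add: algebra_simps)
    then have "E ((s * t / (s + t)) *\<^sub>R (v + w)) \<le> (s / (s + t)) * E (t *\<^sub>R v) + (t / (s + t)) * E (s *\<^sub>R w)"
      using that cv[of "s / (s + t)" "t / (s + t)" "t *\<^sub>R v" "s *\<^sub>R w"]
      by (simp add: add_divide_distrib[symmetric])
    then have "E ((s * t / (s + t)) *\<^sub>R (v + w)) / (s * t / (s + t)) \<le>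
        ((s / (s + t)) * E (t *\<^sub>R v) + (t / (s + t)) * E (s *\<^sub>R w)) / (s * t / (s + t))"
      using that by (intro divide_right_mono) auto
    also have "\<dots> = E (t *\<^sub>R v) / t + E (s *\<^sub>R w) / s"
      using that by (simp add: field_simps add_pos_pos less_imp_neq[symmetric])
    finally show ?thesis .
  qed
  have bd: "bdd_below ((\<lambda>t. E (t *\<^sub>R v) / t) ` {0<..})" for v
  proof (rule bdd_belowI2)
    fix t :: real assume t: "t \<in> {0<..}"
    have "0 \<le> E 0 / (1 * t / (1 + t))" using t E0 by simp
    also have "\<dots> \<le> E (t *\<^sub>R v) / t + E (- v)" using key[of 1 t v "- v"] t by simp
    finally show "- E (- v) \<le> E (t *\<^sub>R v) / t" by simp
  qed
  have Nl: "t > 0 \<Longrightarrow> N v \<le> E (t *\<^sub>R v) / t" for t v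
    unfolding N_def using cINF_lower[OF bd, of t v] by simp
  have Ng: "(\<And>t. t > 0 \<Longrightarrow> z \<le> E (t *\<^sub>R v) / t) \<Longrightarrow> z \<le> N v" for z v
    unfolding N_def by (rule cINF_greatest) auto
  have "sublinear N"
    unfolding sublinear_def
  proof (intro conjI allI impI)
    fix x y
    have "N (x + y) - E (s *\<^sub>R y) / s \<le> E (t *\<^sub>R x) / t" if "s > 0" "t > 0" for s t
      using order_trans[OF Nl key[of s t x y]] that by (simp add: algebra_simps)
    then have "N (x + y) - E (s *\<^sub>R y) / s \<le> N x" if "s > 0" for s
      using that by (intro Ng) auto
    then have "N (x + y) - N x \<le> E (s *\<^sub>R y) / s" if "s > 0" for s
      using that by (simp add: algebra_simps)
    then have "N (x + y) - N x \<le> N y" by (intro Ng) auto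
    then show "N (x + y) \<le> N x + N y" by simp
  next
    fix c :: real and x assume c: "c > 0"
    have a: "N (c *\<^sub>R x) \<le> c * N x" if c: "c > 0" for c x
    proof -
      have "N (c *\<^sub>R x) / c \<le> N x"
      proof (rule Ng)
        fix t :: real assume t: "t > 0"
        have "N (c *\<^sub>R x) \<le> E ((t / c) *\<^sub>R (c *\<^sub>R x)) / (t / c)" by (rule Nl) (use t c in simp)
        then show "N (c *\<^sub>R x) / c \<le> E (t *\<^sub>R x) / t" using c t by (simp add: field_simps)
      qed
      then show ?thesis using c by (simp add: field_simps)
    qed
    have "N x \<le> inverse c * N (c *\<^sub>R x)" using a[of "inverse c" "c *\<^sub>R x"] c by simp
    then have "c * N x \<le> N (c *\<^sub>R x)" using c by (simp add: field_simps)
    then show "N (c *\<^sub>R x) = c * N x" using a[OF c, of x] by linarith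
  qed
  then obtain f where "linear f" "\<And>x. f x \<le> N x" using hahn_banach_sublinear by blast
  moreover have "N x \<le> E x" for x using Nl[of 1 x] by simp
  ultimately show ?thesis using that by (meson order_trans)
qed

lemma linear_bounded_above_norm:
  fixes f :: "'a::real_normed_vector \<Rightarrow> real"
  assumes "linear f" "\<And>x. f x \<le> K * norm x"
  shows "bounded_linear f" "\<And>x. \<bar>f x\<bar> \<le> K * norm x"
proof -
  show b: "\<bar>f x\<bar> \<le> K * norm x" for x
    using assms(2)[of x] assms(2)[of "- x"] linear_neg[OF assms(1), of x] by auto
  show "bounded_linear f"
    using assms(1) b by (auto simp: bounded_linear_def bounded_linear_axioms_def algebra_simps intro!: exI[of _ K])
qed

text \<open>The functional is a subgradient of the norm at \<open>x\<close>, that is, a linear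
  minorant of \<open>norm (v + x) - norm x\<close>. Testing it at \<open>- x\<close> gives
  \<open>norm x \<le> f x\<close>; the triangle inequality gives the rest.\<close>

lemma norming_functional:
  fixes x :: "'a::real_normed_vector"
  obtains f where "bounded_linear f" "f x = norm x" "\<And>v. \<bar>f v\<bar> \<le> norm v"
proof -
  have "convex_on UNIV (\<lambda>v. norm (v + x) - norm x)"
  proof (rule convex_onI)
    fix t :: real and v w :: 'a assume t: "0 < t" "t < 1"
    have "norm ((1 - t) *\<^sub>R v + t *\<^sub>R w + x) = norm ((1 - t) *\<^sub>R (v + x) + t *\<^sub>R (w + x))"
      by (simp add: algebra_simps)
    also have "\<dots> \<le> (1 - t) * norm (v + x) + t * norm (w + x)"
      using t by (metis abs_of_nonneg diff_ge_0_iff_ge less_eq_real_def norm_scaleR norm_triangle_ineq)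
    finally show "norm ((1 - t) *\<^sub>R v + t *\<^sub>R w + x) - norm x
        \<le> (1 - t) * (norm (v + x) - norm x) + t * (norm (w + x) - norm x)"
      by (simp add: algebra_simps)
  qed simp
  then obtain f where f: "linear f" "\<And>v. f v \<le> norm (v + x) - norm x"
    using hahn_banach_convex[of "\<lambda>v. norm (v + x) - norm x"] by auto
  have le: "f v \<le> 1 * norm v" for v using f(2)[of v] norm_triangle_ineq[of v x] by simp
  have "f (- x) \<le> - norm x" using f(2)[of "- x"] by simp
  then have "f x = norm x" using le[of x] linear_neg[OF f(1), of x] by simp
  then show ?thesis using that linear_bounded_above_norm[OF f(1) le] by simp
qed

text \<open>The infimal convolution in the proof turns the finitely many inequalities that
  the convex combinations express into a single convex majorant.\<close>
lemma sandwich: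
  fixes G :: "'a::real_normed_vector \<Rightarrow> real" and pt :: "'p \<Rightarrow> 'a" and val :: "'p \<Rightarrow> real"
  assumes G: "convex_on UNIV G" and GL: "\<And>v w. \<bar>G v - G w\<bar> \<le> L * norm (v - w)" and G0: "G 0 = 0"
    and p0: "p0 \<in> P" "pt p0 = 0" "val p0 = 0"
    and comb: "\<And>W l. finite W \<Longrightarrow> W \<subseteq> P \<Longrightarrow> (\<And>p. p \<in> W \<Longrightarrow> 0 \<le> l p) \<Longrightarrow> sum l W = 1 \<Longrightarrow>
      0 \<le> (\<Sum>p\<in>W. l p * val p) + G (\<Sum>p\<in>W. l p *\<^sub>R pt p)"
  obtains f :: "'a \<Rightarrow>\<^sub>L real" where "\<And>p. p \<in> P \<Longrightarrow> blinfun_apply f (pt p) \<le> val p"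
    "\<And>v. - blinfun_apply f v \<le> G v"
proof -
  \<comment> \<open>The convex hull of the points \<open>(pt p, val p)\<close>. The assumption on
    convex combinations says that it lies above the graph of \<open>- G\<close>.\<close>
  define \<K> where "\<K> = {(x, r). \<exists>W l. finite W \<and> W \<subseteq> P \<and> (\<forall>p\<in>W. 0 \<le> l p) \<and> sum l W = 1 \<and>
     x = (\<Sum>p\<in>W. l p *\<^sub>R pt p) \<and> r = (\<Sum>p\<in>W. l p * val p)}"
  have Kpos: "0 \<le> r + G x" if "(x, r) \<in> \<K>" for x r
    using that comb unfolding \<K>_def by blast
  have Kpt: "(pt p, val p) \<in> \<K>" if "p \<in> P" for p
    unfolding \<K>_def using that by (auto intro!: exI[of _ "{p}"] exI[of _ "\<lambda>_. 1"])
  have Kconv: "(a *\<^sub>R x + b *\<^sub>R y, a * r + b * s) \<in> \<K>"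
    if K: "(x, r) \<in> \<K>" "(y, s) \<in> \<K>" and ab: "a \<ge> 0" "b \<ge> 0" "a + b = 1" for a b :: real and x y r s
  proof -
    obtain W l where W: "finite W" "W \<subseteq> P" "\<forall>p\<in>W. 0 \<le> l p" "sum l W = 1"
      "x = (\<Sum>p\<in>W. l p *\<^sub>R pt p)" "r = (\<Sum>p\<in>W. l p * val p)" using K(1) unfolding \<K>_def by blast
    obtain W' l' where W': "finite W'" "W' \<subseteq> P" "\<forall>p\<in>W'. 0 \<le> l' p" "sum l' W' = 1"
      "y = (\<Sum>p\<in>W'. l' p *\<^sub>R pt p)" "s = (\<Sum>p\<in>W'. l' p * val p)" using K(2) unfolding \<K>_def by blast
    define k k' where "k p = (if p \<in> W then l p else 0)" and "k' p = (if p \<in> W' then l' p else 0)" for p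
    have e1: "(\<Sum>p\<in>W \<union> W'. k p *\<^sub>R g p) = (\<Sum>p\<in>W. l p *\<^sub>R g p)"
      "(\<Sum>p\<in>W \<union> W'. k' p *\<^sub>R g p) = (\<Sum>p\<in>W'. l' p *\<^sub>R g p)" for g :: "'p \<Rightarrow> 'z::real_vector"
      using W(1) W'(1) by (auto simp: k_def k'_def intro!: sum.mono_neutral_cong_right)
    have "sum k (W \<union> W') = 1" "sum k' (W \<union> W') = 1"
      using e1[of "\<lambda>_. 1::real"] W(4) W'(4) by auto
    then have 1: "(\<Sum>p\<in>W \<union> W'. a * k p + b * k' p) = 1"
      using ab by (simp add: sum.distrib sum_distrib_left[symmetric])
    have 2: "(\<Sum>p\<in>W \<union> W'. (a * k p + b * k' p) *\<^sub>R g p)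
        = a *\<^sub>R (\<Sum>p\<in>W. l p *\<^sub>R g p) + b *\<^sub>R (\<Sum>p\<in>W'. l' p *\<^sub>R g p)" for g :: "'p \<Rightarrow> 'z::real_vector"
      unfolding e1[symmetric] by (simp add: scaleR_add_left sum.distrib scaleR_sum_right)
    have 3: "0 \<le> a * k p + b * k' p" for p using ab W(3) W'(3) by (auto simp: k_def k'_def)
    show ?thesis unfolding \<K>_def
      using W(1,2) W'(1,2) 1 3 2[of pt] 2[of val] W(5,6) W'(5,6)
      by (auto intro!: exI[of _ "W \<union> W'"] exI[of _ "\<lambda>p. a * k p + b * k' p"])
  qed
  \<comment> \<open>A linear minorant of \<open>E\<close> serves both conclusions up to its sign:
    \<open>(0, 0)\<close> in \<open>\<K>\<close> gives \<open>E v \<le> G v\<close>, and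
    \<open>v = - pt p\<close> with \<open>G 0 = 0\<close> gives
    \<open>E (- pt p) \<le> val p\<close>.\<close>
  define E where "E v = (INF xr\<in>\<K>. G (v + fst xr) + snd xr)" for v
  have Kne: "\<K> \<noteq> {}" using Kpt p0(1) by blast
  have low: "- L * norm v \<le> G (v + x) + r" if "(x, r) \<in> \<K>" for v x r
    using GL[of "v + x" x] Kpos[OF that] by simp
  have bd: "bdd_below ((\<lambda>xr. G (v + fst xr) + snd xr) ` \<K>)" for v
    using low by (intro bdd_belowI2[where m = "- L * norm v"]) auto
  have El: "E v \<le> G (v + x) + r" if "(x, r) \<in> \<K>" for v x r
    unfolding E_def using cINF_lower[OF bd that, of v] by simp
  have Eg: "(\<And>x r. (x, r) \<in> \<K> \<Longrightarrow> z \<le> G (v + x) + r) \<Longrightarrow> z \<le> E v" for z v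
    unfolding E_def by (rule cINF_greatest[OF Kne]) auto
  have cG: "G (a *\<^sub>R x + b *\<^sub>R y) \<le> a * G x + b * G y" if "a \<ge> 0" "b \<ge> 0" "a + b = 1" for a b x y
    using G that unfolding convex_on_def by blast
  have "convex_on UNIV E"
  proof (rule convex_onI)
    fix t :: real and v w assume t: "0 < t" "t < 1"
    have 1: "E ((1 - t) *\<^sub>R v + t *\<^sub>R w) \<le> (1 - t) * (G (v + x) + r) + t * (G (w + y) + s)"
      if K: "(x, r) \<in> \<K>" "(y, s) \<in> \<K>" for x y r s
    proof -
      have "E ((1 - t) *\<^sub>R v + t *\<^sub>R w) \<le> G (((1 - t) *\<^sub>R v + t *\<^sub>R w) + ((1 - t) *\<^sub>R x + t *\<^sub>R y)) + ((1 - t) * r + t * s)"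
        using El Kconv[OF K, of "1 - t" t] t by simp
      also have "((1 - t) *\<^sub>R v + t *\<^sub>R w) + ((1 - t) *\<^sub>R x + t *\<^sub>R y) = (1 - t) *\<^sub>R (v + x) + t *\<^sub>R (w + y)"
        by (simp add: algebra_simps)
      finally show ?thesis using cG[of "1 - t" t "v + x" "w + y"] t by (simp add: algebra_simps)
    qed
    have 2: "E ((1 - t) *\<^sub>R v + t *\<^sub>R w) - t * (G (w + y) + s) \<le> (1 - t) * E v" if ys: "(y, s) \<in> \<K>" for y s
    proof -
      have "(E ((1 - t) *\<^sub>R v + t *\<^sub>R w) - t * (G (w + y) + s)) / (1 - t) \<le> E v"
      proof (rule Eg)
        fix x r assume "(x, r) \<in> \<K>"
        from 1[OF this ys] show "(E ((1 - t) *\<^sub>R v + t *\<^sub>R w) - t * (G (w + y) + s)) / (1 - t) \<le> G (v + x) + r"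
          using t by (simp add: pos_divide_le_eq mult.commute)
      qed
      then show ?thesis using t by (simp add: pos_divide_le_eq mult.commute)
    qed
    have "(E ((1 - t) *\<^sub>R v + t *\<^sub>R w) - (1 - t) * E v) / t \<le> E w"
    proof (rule Eg)
      fix y s assume "(y, s) \<in> \<K>"
      from 2[OF this] show "(E ((1 - t) *\<^sub>R v + t *\<^sub>R w) - (1 - t) * E v) / t \<le> G (w + y) + s"
        using t by (simp add: pos_divide_le_eq mult.commute)
    qed
    then show "E ((1 - t) *\<^sub>R v + t *\<^sub>R w) \<le> (1 - t) * E v + t * E w"
      using t by (simp add: pos_divide_le_eq mult.commute)
  qed simp
  moreover have "0 \<le> E 0" using Kpos by (intro Eg) (simp add: add.commute)
  ultimately obtain f where f: "linear f" "\<And>x. f x \<le> E x" using hahn_banach_convex by blast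
  have fG: "f v \<le> G v" for v using f(2)[of v] El[of 0 0 v] Kpt[OF p0(1)] p0 by simp
  have "f v \<le> L * norm v" for v using fG[of v] GL[of v 0] G0 by simp
  then have bl: "bounded_linear f" using linear_bounded_above_norm[OF f(1)] by blast
  have app: "blinfun_apply (Blinfun (\<lambda>v. - f v)) = (\<lambda>v. - f v)"
    using bl by (intro bounded_linear_Blinfun_apply bounded_linear_minus)
  show ?thesis
  proof (rule that[of "Blinfun (\<lambda>v. - f v)"])
    fix p assume "p \<in> P"
    then have "f (- pt p) \<le> val p" using f(2)[of "- pt p"] El[OF Kpt, of p "- pt p"] G0 by simp
    then show "blinfun_apply (Blinfun (\<lambda>v. - f v)) (pt p) \<le> val p"
      using linear_neg[OF f(1)] by (simp add: app)
  qed (use fG in \<open>simp add: app\<close>)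
qed

section \<open>A gauge-type variational principle\<close>

text \<open>A principle of Borwein-Preiss type. Since \<open>q\<close> is not assumed to satisfy a
  triangle inequality, a single translate as in Ekeland's principle is replaced by a series of
  translates centred at successive approximate minimisers \<open>w k\<close>. The series inherits
  convexity or differentiability from the gauge.\<close>

lemma variational_principle:
  fixes S :: "'a::banach set" and F q :: "'a \<Rightarrow> real"
  assumes S: "closed S" and F: "continuous_on S F" and x0: "x0 \<in> S" and m: "\<And>x. x \<in> S \<Longrightarrow> m \<le> F x"
    and s: "s > 0" and q0: "q 0 = 0" and qpos: "\<And>x y. x \<in> S \<Longrightarrow> y \<in> S \<Longrightarrow> 0 \<le> q (x - y)"
    and qL: "\<And>x y w. x \<in> S \<Longrightarrow> y \<in> S \<Longrightarrow> w \<in> S \<Longrightarrow> \<bar>q (x - w) - q (y - w)\<bar> \<le> K * norm (x - y)"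
    and qsmall: "\<And>e. e > 0 \<Longrightarrow> \<exists>d>0. \<forall>x\<in>S. \<forall>y\<in>S. q (x - y) < d \<longrightarrow> norm (x - y) < e"
  obtains z w where "z \<in> S" "\<And>k. w k \<in> S" "F z + s * q (z - x0) \<le> F x0"
    "\<And>x. x \<in> S \<Longrightarrow> summable (\<lambda>k. (1/2)^k * q (x - w k))"
    "\<And>x. x \<in> S \<Longrightarrow> F z + s * (\<Sum>k. (1/2)^k * q (z - w k)) \<le> F x + s * (\<Sum>k. (1/2)^k * q (x - w k))"
proof -
  define nxt where "nxt j Fw = (\<lambda>x. fst Fw x + s * (1/2)^j * q (x - snd Fw))" for j :: nat and Fw :: "('a \<Rightarrow> real) \<times> 'a"
  define S' where "S' j Fw = {x\<in>S. nxt j Fw x \<le> fst Fw (snd Fw)}" for j Fw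
  \<comment> \<open>The clause for \<open>j = 0\<close> fixes the start of the recursion; the
    inequality \<open>F z + s * q (z - x0) \<le> F x0\<close> comes from it.\<close>
  define P where "P j Fw \<longleftrightarrow> snd Fw \<in> S \<and> continuous_on S (fst Fw) \<and> (\<forall>x\<in>S. m \<le> fst Fw x) \<and> (j = 0 \<longrightarrow> Fw = (F, x0))"
    for j :: nat and Fw
  \<comment> \<open>Up to the factor \<open>s\<close>, the tolerance \<open>(1/4)^(Suc j)\<close> is
    the square of the weight \<open>(1/2)^(Suc j)\<close> in the next step, so that
    \<open>q (x - w (Suc n)) \<le> (1/2)^(Suc n)\<close> on the next sublevel set.\<close>
  define Q where "Q j Fw Fw' \<longleftrightarrow> fst Fw' = nxt j Fw \<and> snd Fw' \<in> S' j Fw \<and>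
      (\<forall>x\<in>S' j Fw. fst Fw' (snd Fw') \<le> fst Fw' x + s * (1/4)^(Suc j))" for j Fw Fw'
  have "\<exists>f. \<forall>n. P n (f n) \<and> Q n (f n) (f (Suc n))"
  proof (rule dependent_nat_choice)
    show "\<exists>x. P 0 x" using x0 F m by (auto simp: P_def)
  next
    fix Fw j assume PP: "P j Fw"
    then have wS: "snd Fw \<in> S" and mF: "\<And>x. x \<in> S \<Longrightarrow> m \<le> fst Fw x" and c: "continuous_on S (fst Fw)"
      by (auto simp: P_def)
    have mn: "m \<le> nxt j Fw x" if "x \<in> S" for x
      using mF[OF that] qpos[OF that wS] s by (simp add: nxt_def add_increasing2)
    have cq: "continuous_on S (\<lambda>x. q (x - snd Fw))"
    proof (rule continuous_on_iff[THEN iffD2], intro ballI allI impI)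
      fix x :: 'a and e :: real assume xe: "x \<in> S" "e > 0"
      have K: "\<bar>q (y - snd Fw) - q (x - snd Fw)\<bar> \<le> (\<bar>K\<bar> + 1) * norm (y - x)" if "y \<in> S" for y
        using order_trans[OF qL[OF that xe(1) wS] mult_right_mono[of K "\<bar>K\<bar> + 1" "norm (y - x)"]] by auto
      show "\<exists>d>0. \<forall>x'\<in>S. dist x' x < d \<longrightarrow> dist (q (x' - snd Fw)) (q (x - snd Fw)) < e"
      proof (intro exI[of _ "e / (\<bar>K\<bar> + 1)"] conjI ballI impI)
        show "e / (\<bar>K\<bar> + 1) > 0" using xe(2) by (simp add: add_nonneg_pos)
        fix y assume y: "y \<in> S" "dist y x < e / (\<bar>K\<bar> + 1)"
        then have "(\<bar>K\<bar> + 1) * norm (y - x) < e" by (simp add: dist_norm field_simps)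
        then show "dist (q (y - snd Fw)) (q (x - snd Fw)) < e"
          using K[OF y(1)] by (simp add: dist_real_def)
      qed
    qed
    have cn: "continuous_on S (nxt j Fw)"
      unfolding nxt_def by (intro continuous_intros c cq)
    have ne: "snd Fw \<in> S' j Fw" using wS q0 by (simp add: S'_def nxt_def)
    have bd: "bdd_below (nxt j Fw ` S' j Fw)"
      using mn by (intro bdd_belowI2[of _ m]) (auto simp: S'_def)
    have "Inf (nxt j Fw ` S' j Fw) < Inf (nxt j Fw ` S' j Fw) + s * (1/4)^(Suc j)" using s by simp
    then obtain w where w: "w \<in> S' j Fw" "nxt j Fw w < Inf (nxt j Fw ` S' j Fw) + s * (1/4)^(Suc j)"
      using cInf_lessD[of "nxt j Fw ` S' j Fw"] ne by blast
    have "nxt j Fw w \<le> nxt j Fw x + s * (1/4)^(Suc j)" if "x \<in> S' j Fw" for x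
      using w(2) cINF_lower[OF bd that] by linarith
    then have "P (Suc j) (nxt j Fw, w) \<and> Q j Fw (nxt j Fw, w)"
      using w cn mn by (auto simp: P_def Q_def S'_def)
    then show "\<exists>y. P (Suc j) y \<and> Q j Fw y" by blast
  qed
  then obtain f where f: "\<And>n. P n (f n)" "\<And>n. Q n (f n) (f (Suc n))" by blast
  define w where "w n = snd (f n)" for n
  define \<Phi> where "\<Phi> n = fst (f n)" for n
  have wS: "w n \<in> S" and c\<Phi>: "continuous_on S (\<Phi> n)" for n using f(1)[of n] by (auto simp: P_def w_def \<Phi>_def)
  have 0: "\<Phi> 0 = F" "w 0 = x0" using f(1)[of 0] by (auto simp: P_def w_def \<Phi>_def)
  have step: "\<Phi> (Suc n) x = \<Phi> n x + s * (1/2)^n * q (x - w n)" for n x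
    using f(2)[of n] by (simp add: Q_def nxt_def w_def \<Phi>_def)
  define R where "R n = {x\<in>S. \<Phi> (Suc n) x \<le> \<Phi> n (w n)}" for n
  have R: "S' n (f n) = R n" for n
    using step by (auto simp: S'_def R_def nxt_def w_def \<Phi>_def)
  have wR: "w (Suc n) \<in> R n" and near: "\<And>x. x \<in> R n \<Longrightarrow> \<Phi> (Suc n) (w (Suc n)) \<le> \<Phi> (Suc n) x + s * (1/4)^(Suc n)" for n
    using f(2)[of n] by (auto simp: Q_def R w_def \<Phi>_def)
  have mono: "\<Phi> n x \<le> \<Phi> (Suc n) x" if "x \<in> S" for n x
    using step qpos[OF that wS] s by simp
  have "R (Suc n) \<subseteq> R n" for n
  proof
    fix x assume x: "x \<in> R (Suc n)"
    then have "\<Phi> (Suc n) x \<le> \<Phi> (Suc n) (w (Suc n))" using mono[of x "Suc n"] by (auto simp: R_def)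
    also have "\<dots> \<le> \<Phi> n (w n)" using wR[of n] by (auto simp: R_def)
    finally show "x \<in> R n" using x by (simp add: R_def)
  qed
  then have Rdec: "n \<le> k \<Longrightarrow> R k \<subseteq> R n" for n k by (rule lift_Suc_antimono_le)
  have wRk: "w k \<in> R n" if "n < k" for n k
  proof (cases k)
    case (Suc j)
    then show ?thesis using wR[of j] Rdec[of n j] that by auto
  qed (use that in simp)
  have qR: "q (x - w (Suc n)) \<le> (1/2)^(Suc n)" if x: "x \<in> R (Suc n)" for x n
  proof -
    have "\<Phi> (Suc n) x + s * (1/2)^(Suc n) * q (x - w (Suc n)) \<le> \<Phi> (Suc n) x + s * (1/4)^(Suc n)"
    proof -
      have "\<Phi> (Suc (Suc n)) x \<le> \<Phi> (Suc n) (w (Suc n))" using x by (simp add: R_def)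
      also have "\<dots> \<le> \<Phi> (Suc n) x + s * (1/4)^(Suc n)" using x near[of x n] Rdec[of n "Suc n"] by auto
      finally show ?thesis using step[of "Suc n" x] by simp
    qed
    then have "s * ((1/2)^(Suc n) * q (x - w (Suc n))) \<le> s * ((1/2)^(Suc n) * (1/2)^(Suc n))"
      by (simp add: power_mult_distrib[symmetric])
    then show ?thesis using s by simp
  qed
  have cauchy: "Cauchy w"
  proof (rule metric_CauchyI)
    fix e :: real assume "e > 0"
    then obtain d where d: "d > 0" "\<And>x y. x \<in> S \<Longrightarrow> y \<in> S \<Longrightarrow> q (x - y) < d \<Longrightarrow> norm (x - y) < e / 2"
      using qsmall[of "e / 2"] by auto
    obtain n where n: "(1/2::real)^n < d" using real_arch_pow_inv[OF d(1), of "1/2"] by auto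
    have b: "norm (w k - w (Suc n)) < e / 2" if "k > Suc n" for k
    proof (rule d(2)[OF wS wS])
      have "q (w k - w (Suc n)) \<le> (1/2)^(Suc n)" using qR wRk that by blast
      also have "\<dots> \<le> (1/2)^n" by simp
      finally show "q (w k - w (Suc n)) < d" using n by linarith
    qed
    have "dist (w k) (w l) < e" if "k \<ge> Suc (Suc n)" "l \<ge> Suc (Suc n)" for k l
      using dist_triangle_half_l[of "w k" "w (Suc n)" e "w l"] b[of k] b[of l] that by (simp add: dist_norm)
    then show "\<exists>M. \<forall>m\<ge>M. \<forall>n\<ge>M. dist (w m) (w n) < e" by blast
  qed
  then obtain z where z: "w \<longlonglongrightarrow> z" using Cauchy_convergent convergent_def by blast
  have zR: "z \<in> R n" for n
  proof -
    have "R n = {x \<in> S. \<Phi> (Suc n) x \<in> {..\<Phi> n (w n)}}" by (auto simp: R_def)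
    also have "closed \<dots>" using continuous_closed_preimage[OF c\<Phi>[of "Suc n"] S, of "{.. \<Phi> n (w n)}"]
      by (simp add: vimage_def Int_def)
    finally have "closed (R n)" .
    then show ?thesis
      by (rule Lim_in_closed_set[OF _ _ _ z]) (use wRk in \<open>auto simp: eventually_sequentially intro!: exI[of _ "Suc n"]\<close>)
  qed
  have zS: "z \<in> S" using zR[of 0] by (simp add: R_def)
  have sm: "summable (\<lambda>k. (1/2)^k * q (x - w k))" if x: "x \<in> S" for x
  proof -
    have "Bseq w" using z by (simp add: convergentI convergent_imp_Bseq)
    then obtain B where B: "\<And>n. norm (w n) \<le> B" using BseqE by blast
    show ?thesis
    proof (rule summable_comparison_test')
      show "summable (\<lambda>k. (\<bar>K\<bar> * (norm x + B)) * (1/2)^k)" by (intro summable_mult summable_geometric) simp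
      fix n :: nat assume "n \<ge> 0"
      have "q (x - w n) \<le> K * norm (x - w n)" using qL[OF x wS wS, of n n] q0 by simp
      also have "\<dots> \<le> \<bar>K\<bar> * (norm x + B)"
        using norm_triangle_ineq4[of x "w n"] B[of n] by (intro mult_mono) auto
      finally show "norm ((1/2)^n * q (x - w n)) \<le> (\<bar>K\<bar> * (norm x + B)) * (1/2)^n"
        using qpos[OF x wS, of n] by (simp add: abs_mult divide_right_mono power_divide)
    qed
  qed
  have sumF: "\<Phi> n x = F x + s * (\<Sum>k<n. (1/2)^k * q (x - w k))" for n x
    by (induction n) (simp_all add: 0 step algebra_simps)
  have lim: "(\<lambda>n. \<Phi> n x) \<longlonglongrightarrow> F x + s * (\<Sum>k. (1/2)^k * q (x - w k))" if "x \<in> S" for x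
    unfolding sumF using summable_LIMSEQ[OF sm[OF that]] by (intro tendsto_intros)
  show ?thesis
  proof (rule that[of z w])
    show "F z + s * q (z - x0) \<le> F x0" using zR[of 0] step[of 0 z] by (simp add: R_def 0)
    fix x assume x: "x \<in> S"
    show "F z + s * (\<Sum>k. (1/2)^k * q (z - w k)) \<le> F x + s * (\<Sum>k. (1/2)^k * q (x - w k))"
    \<comment> \<open>A point outside some \<open>R n\<close> stays outside and is worse than
      \<open>z\<close> for all later \<open>\<Phi> (Suc k)\<close>. A point in all
      \<open>R n\<close> coincides with \<open>z\<close>, because the diameters of these sets tend
      to 0.\<close>
    proof (cases "\<exists>n. x \<notin> R n")
      case True
      then obtain n where n: "x \<notin> R n" by blast
      have ev: "\<Phi> (Suc k) z \<le> \<Phi> (Suc k) x" if "k \<ge> n" for k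
      proof -
        have "x \<notin> R k" using n Rdec[OF that] by blast
        then show ?thesis using x zR[of k] by (auto simp: R_def)
      qed
      show ?thesis
        by (rule LIMSEQ_le[OF LIMSEQ_Suc[OF lim[OF zS]] LIMSEQ_Suc[OF lim[OF x]]]) (use ev in blast)
    next
      case False
      have "x = z"
      proof (rule ccontr)
        assume "x \<noteq> z"
        then obtain d where d: "d > 0" "\<And>x' y. x' \<in> S \<Longrightarrow> y \<in> S \<Longrightarrow> q (x' - y) < d \<Longrightarrow> norm (x' - y) < norm (x - z) / 2"
          using qsmall[of "norm (x - z) / 2"] by auto
        obtain n where n: "(1/2::real)^n < d" using real_arch_pow_inv[OF d(1), of "1/2"] by auto
        have "norm (v - w (Suc n)) < norm (x - z) / 2" if v: "v \<in> R (Suc n)" for v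
        proof (rule d(2)[OF _ wS])
          have "(1/2::real)^(Suc n) \<le> (1/2)^n" by simp
          then show "q (v - w (Suc n)) < d" using n qR[OF v] by linarith
        qed (use v in \<open>simp add: R_def\<close>)
        then have "norm (x - w (Suc n)) < norm (x - z) / 2" "norm (z - w (Suc n)) < norm (x - z) / 2"
          using False zR by blast+
        then show False using norm_triangle_ineq4[of "x - w (Suc n)" "z - w (Suc n)"] by simp
      qed
      then show ?thesis by simp
    qed
  qed (use zS wS sm in auto)
qed

section \<open>Smooth gauges on separable subspaces\<close>

text \<open>Values outside \<open>Y\<close> are unrestricted, unlike in \<open>dual_on\<close>:
  pointwise combinations, and functionals on the whole space, belong to the set without being cut
  off.\<close>

definition dual_ball :: "'a::real_normed_vector set \<Rightarrow> ('a \<Rightarrow> real) set" where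
  "dual_ball Y = {f. (\<forall>x\<in>Y. \<forall>y\<in>Y. f (x + y) = f x + f y) \<and>
     (\<forall>c. \<forall>x\<in>Y. f (c *\<^sub>R x) = c * f x) \<and> (\<forall>x\<in>Y. \<bar>f x\<bar> \<le> norm x)}"

text \<open>A substitute for an equivalent Frechet smooth norm on \<open>Y\<close>. Linear growth
  outside every ball around 0 takes the place of homogeneity. Unlike a norm, \<open>p\<close> is
  differentiable at 0 as well, so that \<open>p (x - x')\<close> is a smooth penalty even where
  \<open>x = x'\<close>.\<close>

definition smooth_gauge :: "'a::real_normed_vector set \<Rightarrow> ('a \<Rightarrow> real) \<Rightarrow> bool" where
  "smooth_gauge Y p \<longleftrightarrow> p 0 = 0 \<and> (\<forall>x\<in>Y. 0 \<le> p x) \<and> (\<forall>x\<in>Y. \<forall>y\<in>Y. \<bar>p x - p y\<bar> \<le> norm (x - y)) \<and>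
     (\<forall>e>0. \<exists>c>0. \<forall>y\<in>Y. e \<le> norm y \<longrightarrow> c * norm y \<le> p y) \<and>
     (\<forall>y\<in>Y. \<exists>f\<in>dual_ball Y. \<forall>e>0. \<exists>d>0. \<forall>v\<in>Y. norm v < d \<longrightarrow> \<bar>p (y + v) - p y - f v\<bar> \<le> e * norm v)"

lemma dual_ball_sum:
  assumes "f \<in> dual_ball Y" "g \<in> dual_ball Y" "0 \<le> a" "0 \<le> b" "a + b \<le> 1"
  shows "(\<lambda>x. a * f x + b * g x) \<in> dual_ball Y"
proof -
  have "\<bar>a * f x + b * g x\<bar> \<le> norm x" if "x \<in> Y" for x
  proof -
    have "\<bar>a * f x + b * g x\<bar> \<le> a * \<bar>f x\<bar> + b * \<bar>g x\<bar>"
      using assms(3,4) abs_triangle_ineq[of "a * f x" "b * g x"] by (simp add: abs_mult)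
    also have "\<dots> \<le> a * norm x + b * norm x"
      using assms that by (intro add_mono mult_left_mono) (auto simp: dual_ball_def)
    also have "\<dots> = (a + b) * norm x" by (simp add: algebra_simps)
    also have "\<dots> \<le> 1 * norm x" using assms by (intro mult_right_mono) auto
    finally show ?thesis by simp
  qed
  then show ?thesis using assms by (auto simp: dual_ball_def algebra_simps)
qed

text \<open>The functions \<open>d k\<close> are dense among the functionals on \<open>Y\<close> and the vectors \<open>e k\<close> are
  dense in the unit ball of \<open>Y\<close>.  The seminorm \<open>kn k\<close> is the norm on the kernel of
  \<open>d k\<close>, that is, the distance to the line spanned by \<open>d k\<close>.  The conjugate of the strictly
  convex, weak-star lower semicontinuous function \<open>G\<close> is smooth because its maximising
  sequences converge in norm (as in Kadec's renorming theorem).\<close>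
locale kadec =
  fixes Y :: "'a::real_normed_vector set" and d :: "nat \<Rightarrow> 'a \<Rightarrow> real" and e :: "nat \<Rightarrow> 'a"
  assumes Y: "subspace Y"
    and d_add: "\<And>k x y. x \<in> Y \<Longrightarrow> y \<in> Y \<Longrightarrow> d k (x + y) = d k x + d k y"
    and d_scale: "\<And>k c x. x \<in> Y \<Longrightarrow> d k (c *\<^sub>R x) = c * d k x"
    and d_bounded: "\<And>k. \<exists>K. \<forall>x\<in>Y. \<bar>d k x\<bar> \<le> K * norm x"
    and d_dense: "\<And>f \<epsilon>. f \<in> dual_ball Y \<Longrightarrow> \<epsilon> > 0 \<Longrightarrow>
      \<exists>k. \<forall>y\<in>Y. norm y \<le> 1 \<longrightarrow> d k y = 0 \<longrightarrow> \<bar>f y\<bar> \<le> \<epsilon>"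
    and e_Y: "\<And>k. e k \<in> Y" and e_norm: "\<And>k. norm (e k) \<le> 1"
    and e_dense: "\<And>y \<epsilon>. y \<in> Y \<Longrightarrow> norm y \<le> 1 \<Longrightarrow> \<epsilon> > 0 \<Longrightarrow> \<exists>k. norm (y - e k) < \<epsilon>"
begin

definition "ker k = {y\<in>Y. norm y \<le> 1 \<and> d k y = 0}"
definition kn :: "nat \<Rightarrow> ('a \<Rightarrow> real) \<Rightarrow> real" where "kn k f = (SUP y\<in>ker k. \<bar>f y\<bar>)"
definition "G f = (\<Sum>k. (1/2)^k * ((kn k f)\<^sup>2 + (f (e k))\<^sup>2))"
definition "p x = (SUP f\<in>dual_ball Y. f x - G f)"

lemma d_zero: "d k 0 = 0"
  using d_scale[of 0 k 0] subspace_0[OF Y] by simp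

lemma zero_ker: "0 \<in> ker k"
  using d_zero subspace_0[OF Y] by (simp add: ker_def)

lemma kn_upper:
  assumes "f \<in> dual_ball Y" "y \<in> ker k" shows "\<bar>f y\<bar> \<le> kn k f"
  unfolding kn_def
proof (rule cSUP_upper[OF assms(2)])
  show "bdd_above ((\<lambda>y. \<bar>f y\<bar>) ` ker k)"
    using assms(1) by (intro bdd_aboveI2[of _ _ 1]) (auto simp: dual_ball_def ker_def intro: order_trans)
qed

lemma kn_least: "(\<And>y. y \<in> ker k \<Longrightarrow> \<bar>f y\<bar> \<le> c) \<Longrightarrow> kn k f \<le> c"
  unfolding kn_def using zero_ker by (intro cSUP_least) auto

lemma kn_nonneg: "f \<in> dual_ball Y \<Longrightarrow> 0 \<le> kn k f"
  using kn_upper[OF _ zero_ker, of f k] by (meson abs_ge_zero order_trans)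

lemma kn_le_1: "f \<in> dual_ball Y \<Longrightarrow> kn k f \<le> 1"
  by (rule kn_least) (auto simp: dual_ball_def ker_def intro: order_trans)

lemma kn_scale: "f \<in> dual_ball Y \<Longrightarrow> 0 \<le> t \<Longrightarrow> kn k (\<lambda>x. t * f x) \<le> t"
  by (rule kn_least) (auto simp: dual_ball_def ker_def abs_mult intro!: mult_left_le intro: order_trans)

lemma e_le_1: "f \<in> dual_ball Y \<Longrightarrow> \<bar>f (e k)\<bar> \<le> 1"
  using e_Y[of k] e_norm[of k] unfolding dual_ball_def by (blast intro: order_trans)

lemma kn_mid:
  assumes "f \<in> dual_ball Y" "g \<in> dual_ball Y"
  shows "kn k (\<lambda>x. (1/2) * f x + (1/2) * g x) \<le> (kn k f + kn k g) / 2"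
proof (rule kn_least)
  fix y assume "y \<in> ker k"
  then have "\<bar>f y\<bar> \<le> kn k f" "\<bar>g y\<bar> \<le> kn k g" using kn_upper assms by auto
  then show "\<bar>1 / 2 * f y + 1 / 2 * g y\<bar> \<le> (kn k f + kn k g) / 2"
    by (simp only: abs_le_iff) argo
qed

lemma term_bounds:
  assumes "f \<in> dual_ball Y"
  shows "0 \<le> (kn k f)\<^sup>2 + (f (e k))\<^sup>2" "(kn k f)\<^sup>2 + (f (e k))\<^sup>2 \<le> 2"
  using kn_nonneg[OF assms, of k] kn_le_1[OF assms, of k] e_le_1[OF assms, of k]
    power_le_one[of "kn k f" 2] abs_square_le_1[of "f (e k)"] by auto

lemma G_summable:
  assumes "f \<in> dual_ball Y" shows "summable (\<lambda>k. (1/2)^k * ((kn k f)\<^sup>2 + (f (e k))\<^sup>2))"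
proof (rule summable_comparison_test')
  show "summable (\<lambda>k. 2 * (1/2::real)^k)" by (intro summable_mult summable_geometric) simp
  show "norm ((1/2)^k * ((kn k f)\<^sup>2 + (f (e k))\<^sup>2)) \<le> 2 * (1/2)^k" for k
    using term_bounds[OF assms, of k] by (simp add: abs_mult power_divide divide_right_mono)
qed

lemma G_nonneg: "f \<in> dual_ball Y \<Longrightarrow> 0 \<le> G f"
  unfolding G_def using G_summable term_bounds by (intro suminf_nonneg) auto

text \<open>Quadratic smallness of \<open>G\<close> near 0 is what makes its conjugate grow linearly
  away from 0. The factor 4 comes from two squares of size at most \<open>t\<^sup>2\<close> and a
  geometric series with sum 2.\<close>

lemma G_scale:
  assumes f: "f \<in> dual_ball Y" and t: "0 \<le> t" "t \<le> 1"
  shows "G (\<lambda>x. t * f x) \<le> 4 * t\<^sup>2"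
proof -
  have tf: "(\<lambda>x. t * f x) \<in> dual_ball Y" using dual_ball_sum[OF f f, of t 0] t by simp
  have s: "summable (\<lambda>k. (2 * t\<^sup>2) * (1/2::real)^k)" by (intro summable_mult summable_geometric) simp
  have "(1/2)^k * ((kn k (\<lambda>x. t * f x))\<^sup>2 + (t * f (e k))\<^sup>2) \<le> (2 * t\<^sup>2) * (1/2::real)^k" for k
  proof -
    have 1: "(kn k (\<lambda>x. t * f x))\<^sup>2 \<le> t\<^sup>2" using kn_scale[OF f t(1)] kn_nonneg[OF tf] by (intro power_mono)
    have 2: "(f (e k))\<^sup>2 \<le> 1" using e_le_1[OF f, of k] abs_square_le_1 by blast
    have "(t * f (e k))\<^sup>2 \<le> t\<^sup>2" using mult_left_mono[OF 2, of "t\<^sup>2"] by (simp add: power_mult_distrib)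
    then have "(1/2)^k * ((kn k (\<lambda>x. t * f x))\<^sup>2 + (t * f (e k))\<^sup>2) \<le> (1/2)^k * (2 * t\<^sup>2)"
      using 1 by (intro mult_left_mono) auto
    then show ?thesis by (simp add: mult.commute)
  qed
  then have "G (\<lambda>x. t * f x) \<le> (\<Sum>k. (2 * t\<^sup>2) * (1/2::real)^k)"
    unfolding G_def using G_summable[OF tf] s by (intro suminf_le)
  also have "\<dots> = 4 * t\<^sup>2" by (subst suminf_mult) (auto simp: suminf_geometric intro: summable_geometric)
  finally show ?thesis .
qed

section \<open>The conjugate function and its maximisers\<close>

lemma p_upper:
  assumes x: "x \<in> Y" and f: "f \<in> dual_ball Y" shows "f x - G f \<le> p x"
  unfolding p_def
proof (rule cSUP_upper[OF f])
  have "f x - G f \<le> norm x" if "f \<in> dual_ball Y" for f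
    using G_nonneg[OF that] that x by (force simp: dual_ball_def)
  then show "bdd_above ((\<lambda>f. f x - G f) ` dual_ball Y)"
    by (intro bdd_aboveI2[of _ _ "norm x"]) auto
qed

lemma zero_dual_ball: "(\<lambda>x. 0) \<in> dual_ball Y"
  by (simp add: dual_ball_def)

lemma p_least: "(\<And>f. f \<in> dual_ball Y \<Longrightarrow> f x - G f \<le> c) \<Longrightarrow> p x \<le> c"
  unfolding p_def using zero_dual_ball by (intro cSUP_least) auto

lemma p_attained_approx:
  assumes "c < p x" obtains f where "f \<in> dual_ball Y" "c < f x - G f"
  using p_least[of x c] assms by (meson not_le)

text \<open>The parallelogram law for the squares, used in every term of the series after
  \<open>kn_mid\<close>. Of the resulting gains only the one in term \<open>k\<close> is
  kept.\<close>

lemma G_mid: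
  assumes f: "f \<in> dual_ball Y" and g: "g \<in> dual_ball Y"
  shows "G (\<lambda>x. (1/2) * f x + (1/2) * g x)
    \<le> (G f + G g) / 2 - (1/2)^k * ((kn k f - kn k g)\<^sup>2 + (f (e k) - g (e k))\<^sup>2) / 4"
proof -
  let ?h = "\<lambda>x. (1/2) * f x + (1/2) * g x"
  have h: "?h \<in> dual_ball Y" by (rule dual_ball_sum[OF f g]) auto
  define T where "T f k = (1/2::real)^k * ((kn k f)\<^sup>2 + (f (e k))\<^sup>2)" for f k
  define D where "D k = (1/2::real)^k * ((kn k f - kn k g)\<^sup>2 + (f (e k) - g (e k))\<^sup>2) / 4" for k
  have le: "T ?h k + D k \<le> (T f k + T g k) / 2" for k
  proof -
    have "(kn k ?h)\<^sup>2 \<le> ((kn k f + kn k g) / 2)\<^sup>2"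
      using kn_mid[OF f g] kn_nonneg[OF h] by (intro power_mono)
    then have "(kn k ?h)\<^sup>2 + (?h (e k))\<^sup>2 + ((kn k f - kn k g)\<^sup>2 + (f (e k) - g (e k))\<^sup>2) / 4
      \<le> (((kn k f)\<^sup>2 + (f (e k))\<^sup>2) + ((kn k g)\<^sup>2 + (g (e k))\<^sup>2)) / 2"
      by (simp add: power2_eq_square field_simps)
    then have "(1/2)^k * ((kn k ?h)\<^sup>2 + (?h (e k))\<^sup>2 + ((kn k f - kn k g)\<^sup>2 + (f (e k) - g (e k))\<^sup>2) / 4)
      \<le> (1/2)^k * ((((kn k f)\<^sup>2 + (f (e k))\<^sup>2) + ((kn k g)\<^sup>2 + (g (e k))\<^sup>2)) / 2)"
      by (rule mult_left_mono) simp
    then show ?thesis unfolding T_def D_def by (simp add: distrib_left add_divide_distrib)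
  qed
  have Dpos: "0 \<le> D k" for k by (simp add: D_def)
  have sT: "summable (T f)" "summable (T g)" "summable (T ?h)"
    unfolding T_def using G_summable f g h by auto
  have sR: "summable (\<lambda>k. (T f k + T g k) / 2)" using sT by (intro summable_divide summable_add)
  define D' where "D' j = (if j = k then D k else 0)" for j
  have sD': "D' sums D k" unfolding D'_def using sums_single[of k D] by (simp cong: if_cong)
  have "(\<Sum>k. T ?h k + D' k) \<le> (\<Sum>k. (T f k + T g k) / 2)"
    using le Dpos sT sR sums_summable[OF sD']
    by (intro suminf_le summable_add) (auto simp: D'_def intro: order_trans[OF _ le] simp del: le_divide_eq_numeral1)
  also have "(\<Sum>k. T ?h k + D' k) = G ?h + D k"
    
    unfolding suminf_add[OF sT(3) sums_summable[OF sD'], symmetric] sums_unique[OF sD', symmetric] by (simp add: G_def T_def[abs_def])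
  also have "(\<Sum>k. (T f k + T g k) / 2) = (G f + G g) / 2"
    using suminf_divide[OF summable_add[OF sT(1,2)], of 2] suminf_add[OF sT(1,2)] by (simp add: G_def T_def[abs_def])
  finally show ?thesis unfolding D_def by argo
qed

text \<open>The midpoint of two near-maximisers competes in the supremum defining
  \<open>p x\<close>, so the gain in \<open>G_mid\<close> cannot exceed
  \<open>\<eta>\<close>.\<close>

lemma near_maximisers:
  assumes x: "x \<in> Y" and f: "f \<in> dual_ball Y" "p x - \<eta> \<le> f x - G f"
    and g: "g \<in> dual_ball Y" "p x - \<eta> \<le> g x - G g"
  shows "\<bar>kn k f - kn k g\<bar> \<le> sqrt (4 * 2^k * \<eta>)" "\<bar>f (e k) - g (e k)\<bar> \<le> sqrt (4 * 2^k * \<eta>)"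
proof -
  let ?h = "\<lambda>x. (1/2) * f x + (1/2) * g x"
  have h: "?h \<in> dual_ball Y" by (rule dual_ball_sum[OF f(1) g(1)]) auto
  have "?h x - G ?h \<le> p x" by (rule p_upper[OF x h])
  then have "(1/2)^k * ((kn k f - kn k g)\<^sup>2 + (f (e k) - g (e k))\<^sup>2) \<le> 4 * \<eta>"
    using G_mid[OF f(1) g(1), of k] f(2) g(2) by argo
  then have "(kn k f - kn k g)\<^sup>2 + (f (e k) - g (e k))\<^sup>2 \<le> 4 * 2^k * \<eta>"
    by (simp add: power_divide field_simps)
  then show "\<bar>kn k f - kn k g\<bar> \<le> sqrt (4 * 2^k * \<eta>)" "\<bar>f (e k) - g (e k)\<bar> \<le> sqrt (4 * 2^k * \<eta>)"
    by (auto intro!: real_le_rsqrt intro: order_trans[rotated])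
qed

text \<open>By \<open>near_maximisers\<close> a maximising sequence is Cauchy at every
  \<open>e k\<close>, hence converges pointwise on \<open>Y\<close>. Each \<open>kn k\<close> is a
  supremum of absolute values at points and thus lower semicontinuous along the sequence; so are the
  partial sums of \<open>G\<close>, and the limit attains the supremum.\<close>

lemma p_attained:
  assumes x: "x \<in> Y" obtains f where "f \<in> dual_ball Y" "f x - G f = p x"
proof -
  have "\<exists>f. f \<in> dual_ball Y \<and> p x - inverse (real (Suc n)) < f x - G f" for n
    using p_attained_approx[of "p x - inverse (real (Suc n))" x] by (auto simp: field_simps)
  then have "\<exists>F. \<forall>n. F n \<in> dual_ball Y \<and> p x - inverse (real (Suc n)) < F n x - G (F n)"
    by (intro choice allI)
  then obtain F where F: "\<And>n. F n \<in> dual_ball Y" "\<And>n. p x - inverse (real (Suc n)) < F n x - G (F n)"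
    by blast
  have near: "\<bar>kn k (F m) - kn k (F n)\<bar> \<le> sqrt (4 * 2^k * inverse (real (Suc N)))"
    "\<bar>F m (e k) - F n (e k)\<bar> \<le> sqrt (4 * 2^k * inverse (real (Suc N)))" if "m \<ge> N" "n \<ge> N" for m n N k
  proof -
    have "inverse (real (Suc m)) \<le> inverse (real (Suc N))" "inverse (real (Suc n)) \<le> inverse (real (Suc N))"
      using that by auto
    then have "p x - inverse (real (Suc N)) \<le> F m x - G (F m)" "p x - inverse (real (Suc N)) \<le> F n x - G (F n)"
      using F(2)[of m] F(2)[of n] by linarith+
    then show "\<bar>kn k (F m) - kn k (F n)\<bar> \<le> sqrt (4 * 2^k * inverse (real (Suc N)))"
      "\<bar>F m (e k) - F n (e k)\<bar> \<le> sqrt (4 * 2^k * inverse (real (Suc N)))"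
      using near_maximisers[OF x F(1) _ F(1)] by blast+
  qed
  have lim0: "(\<lambda>N. sqrt (4 * 2^k * inverse (real (Suc N)))) \<longlonglongrightarrow> 0" for k :: nat
    using tendsto_real_sqrt[OF tendsto_mult_left[OF LIMSEQ_inverse_real_of_nat, of "4 * 2^k"]] by simp
  have cauchyI: "Cauchy (a :: nat \<Rightarrow> real)"
    if "\<And>m n N. m \<ge> N \<Longrightarrow> n \<ge> N \<Longrightarrow> \<bar>a m - a n\<bar> \<le> sqrt (4 * 2^k * inverse (real (Suc N)))" for a and k :: nat
  proof (rule metric_CauchyI)
    fix \<epsilon> :: real assume "\<epsilon> > 0"
    then have "eventually (\<lambda>N. sqrt (4 * 2^k * inverse (real (Suc N))) < \<epsilon>) sequentially"
      using order_tendstoD(2)[OF lim0] by blast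
    then obtain N where "sqrt (4 * 2^k * inverse (real (Suc N))) < \<epsilon>" using eventually_sequentially by auto
    then show "\<exists>M. \<forall>m\<ge>M. \<forall>n\<ge>M. dist (a m) (a n) < \<epsilon>"
      using that[of N] by (fastforce simp: dist_real_def)
  qed
  have knc: "convergent (\<lambda>n. kn k (F n))" and ec: "Cauchy (\<lambda>n. F n (e k))" for k
    by (rule real_Cauchy_convergent, rule cauchyI[where k = k], erule (1) near(1))
      (rule cauchyI[where k = k], erule (1) near(2))
  have conv1: "convergent (\<lambda>n. F n y)" if y: "y \<in> Y" "norm y \<le> 1" for y
  proof -
    have "Cauchy (\<lambda>n. F n y)"
    proof (rule metric_CauchyI)
      fix \<epsilon> :: real assume \<epsilon>: "\<epsilon> > 0"
      then obtain k where k: "norm (y - e k) < \<epsilon> / 3" using e_dense[OF y, of "\<epsilon> / 3"] by auto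
      obtain M where M: "\<And>m n. m \<ge> M \<Longrightarrow> n \<ge> M \<Longrightarrow> \<bar>F m (e k) - F n (e k)\<bar> < \<epsilon> / 3"
        using metric_CauchyD[OF ec, of "\<epsilon> / 3" k] \<epsilon> by (auto simp: dist_real_def)
      have *: "\<bar>F n y - F n (e k)\<bar> < \<epsilon> / 3" for n
      proof -
        have "F n ((y - e k) + e k) = F n (y - e k) + F n (e k)"
          using F(1)[of n] e_Y[of k] subspace_diff[OF Y y(1) e_Y[of k]] unfolding dual_ball_def by blast
        moreover have "\<bar>F n (y - e k)\<bar> \<le> norm (y - e k)"
          using F(1)[of n] y e_Y subspace_diff[OF Y] by (simp add: dual_ball_def)
        ultimately show ?thesis using k by simp
      qed
      have "dist (F m y) (F n y) < \<epsilon>" if "m \<ge> M" "n \<ge> M" for m n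
        using M[OF that] *[of m] *[of n] unfolding dist_real_def abs_less_iff by argo
      then show "\<exists>M. \<forall>m\<ge>M. \<forall>n\<ge>M. dist (F m y) (F n y) < \<epsilon>" by blast
    qed
    then show ?thesis by (rule real_Cauchy_convergent)
  qed
  define f where "f y = lim (\<lambda>n. F n y)" for y
  have conv: "(\<lambda>n. F n y) \<longlonglongrightarrow> f y" if y: "y \<in> Y" for y
  proof -
    let ?u = "inverse (norm y + 1) *\<^sub>R y"
    have n0: "norm y + 1 > 0" by (simp add: add_nonneg_pos)
    then have n1: "norm y + 1 \<noteq> 0" by linarith
    have "norm ?u = norm y / (norm y + 1)" using n0 by (simp add: divide_inverse_commute)
    also have "\<dots> \<le> 1" using n0 by simp
    finally have u: "?u \<in> Y" "norm ?u \<le> 1" using y subspace_scale[OF Y] by auto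
    have "F n y = (norm y + 1) * F n ?u" for n
      using F(1)[of n] y n1 by (simp add: dual_ball_def)
    moreover have "convergent (\<lambda>n. (norm y + 1) * F n ?u)"
      using conv1[OF u] by (intro convergent_mult convergent_const)
    ultimately show ?thesis unfolding f_def convergent_LIMSEQ_iff[symmetric] by simp
  qed
  have fB: "f \<in> dual_ball Y"
    unfolding dual_ball_def
  proof (intro CollectI conjI ballI allI)
    fix y z assume yz: "y \<in> Y" "z \<in> Y"
    have "F n (y + z) = F n y + F n z" for n using F(1)[of n] yz by (simp add: dual_ball_def)
    then have "(\<lambda>n. F n (y + z)) \<longlonglongrightarrow> f y + f z" using tendsto_add[OF conv[OF yz(1)] conv[OF yz(2)]] by simp
    then show "f (y + z) = f y + f z" using conv[of "y + z"] yz subspace_add[OF Y] LIMSEQ_unique by blast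
  next
    fix c y assume y: "y \<in> Y"
    have "F n (c *\<^sub>R y) = c * F n y" for n using F(1)[of n] y by (simp add: dual_ball_def)
    then have "(\<lambda>n. F n (c *\<^sub>R y)) \<longlonglongrightarrow> c * f y" using tendsto_mult_left[OF conv[OF y]] by simp
    then show "f (c *\<^sub>R y) = c * f y" using conv[of "c *\<^sub>R y"] y subspace_scale[OF Y] LIMSEQ_unique by blast
  next
    fix y assume y: "y \<in> Y"
    show "\<bar>f y\<bar> \<le> norm y"
      by (rule LIMSEQ_le_const2[OF tendsto_rabs[OF conv[OF y]]]) (use F(1) y in \<open>auto simp: dual_ball_def\<close>)
  qed
  have "G f \<le> f x - p x"
    unfolding G_def
  proof (rule suminf_le_const[OF G_summable[OF fB]])
    fix N
    define l where "l k = lim (\<lambda>n. kn k (F n))" for k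
    have l: "(\<lambda>n. kn k (F n)) \<longlonglongrightarrow> l k" for k
      using knc unfolding l_def convergent_LIMSEQ_iff by simp
    have fl: "kn k f \<le> l k" for k
    proof (rule kn_least)
      fix y assume y: "y \<in> ker k"
      then have "y \<in> Y" by (simp add: ker_def)
      show "\<bar>f y\<bar> \<le> l k"
        by (rule LIMSEQ_le[OF tendsto_rabs[OF conv[OF \<open>y \<in> Y\<close>]] l]) (use kn_upper F(1) y in blast)
    qed
    have "(\<Sum>k<N. (1/2)^k * ((kn k f)\<^sup>2 + (f (e k))\<^sup>2)) \<le> (\<Sum>k<N. (1/2)^k * ((l k)\<^sup>2 + (f (e k))\<^sup>2))"
      using fl kn_nonneg[OF fB] by (intro sum_mono mult_left_mono add_right_mono power_mono) auto
    also have "\<dots> \<le> f x - p x"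
    proof (rule LIMSEQ_le)
      show "(\<lambda>n. \<Sum>k<N. (1/2)^k * ((kn k (F n))\<^sup>2 + (F n (e k))\<^sup>2)) \<longlonglongrightarrow> (\<Sum>k<N. (1/2)^k * ((l k)\<^sup>2 + (f (e k))\<^sup>2))"
        by (intro tendsto_intros l conv[OF e_Y])
      show "(\<lambda>n. F n x - p x + inverse (real (Suc n))) \<longlonglongrightarrow> f x - p x"
        using tendsto_add[OF tendsto_diff[OF conv[OF x] tendsto_const] LIMSEQ_inverse_real_of_nat] by simp
      have "(\<Sum>k<N. (1/2)^k * ((kn k (F n))\<^sup>2 + (F n (e k))\<^sup>2)) \<le> G (F n)" for n
        unfolding G_def using term_bounds[OF F(1)]
        by (intro sum_le_suminf G_summable F(1)) (auto intro!: mult_nonneg_nonneg)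
      moreover have "G (F n) \<le> F n x - p x + inverse (real (Suc n))" for n using F(2)[of n] by linarith
      ultimately show "\<exists>N'. \<forall>n\<ge>N'. (\<Sum>k<N. (1/2)^k * ((kn k (F n))\<^sup>2 + (F n (e k))\<^sup>2)) \<le> F n x - p x + inverse (real (Suc n))"
        by (intro exI[of _ 0] allI impI) (rule order_trans)
    qed
    finally show "(\<Sum>k<N. (1/2)^k * ((kn k f)\<^sup>2 + (f (e k))\<^sup>2)) \<le> f x - p x" .
  qed
  then show ?thesis using that[OF fB] p_upper[OF x fB] by simp
qed

text \<open>This upgrades convergence of seminorms and of values at points to convergence in norm.
  If \<open>d k\<close> is close to \<open>f\<close>, then \<open>kn k f\<close> is small;
  functionals are measured on the kernel of \<open>d k\<close>, where \<open>kn k\<close> controls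
  them, and in one complementary direction \<open>e j\<close>.\<close>

lemma kn_controls:
  assumes f: "f \<in> dual_ball Y" and \<epsilon>: "\<epsilon> > 0"
  obtains k j where "kn k f \<le> \<epsilon>"
    "\<And>g v. g \<in> dual_ball Y \<Longrightarrow> v \<in> Y \<Longrightarrow>
      \<bar>g v - f v\<bar> \<le> (3 * kn k g + 3 * kn k f + 2 * \<bar>g (e j) - f (e j)\<bar>) * norm v"
proof -
  obtain k where k: "\<forall>y\<in>Y. norm y \<le> 1 \<longrightarrow> d k y = 0 \<longrightarrow> \<bar>f y\<bar> \<le> \<epsilon>" using d_dense[OF f \<epsilon>] by blast
  then have kn: "kn k f \<le> \<epsilon>" by (intro kn_least) (auto simp: ker_def)
  obtain K where K: "\<And>x. x \<in> Y \<Longrightarrow> \<bar>d k x\<bar> \<le> K * norm x" using d_bounded by blast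
  define M where "M = (SUP y\<in>Y \<inter> cball 0 1. \<bar>d k y\<bar>)"
  have K1: "\<bar>d k y\<bar> \<le> \<bar>K\<bar>" if "y \<in> Y" "norm y \<le> 1" for y
    using K[OF that(1)] that(2) mult_mono[of K "\<bar>K\<bar>" "norm y" 1] abs_ge_self[of K] by simp
  have Mu: "\<bar>d k y\<bar> \<le> M" if "y \<in> Y" "norm y \<le> 1" for y
    unfolding M_def
    by (rule cSUP_upper) (use that K1 in \<open>auto intro!: bdd_aboveI2[of _ _ "\<bar>K\<bar>"]\<close>)
  \<comment> \<open>A vector \<open>e j\<close> attains the norm \<open>M\<close> of
    \<open>d k\<close> up to the factor 2. If \<open>M \<le> 0\<close>, then \<open>d k\<close>
    vanishes on \<open>Y\<close> and every \<open>j\<close> will do.\<close>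
  have "\<exists>j. M \<le> 2 * \<bar>d k (e j)\<bar>"
  proof (cases "M \<le> 0")
    case True then show ?thesis by (meson abs_ge_zero mult_nonneg_nonneg order_trans zero_le_numeral)
  next
    case False
    have "\<exists>y\<in>Y \<inter> cball 0 1. M * 3 / 4 < \<bar>d k y\<bar>"
    proof (rule ccontr)
      assume "\<not> ?thesis"
      then have "M \<le> M * 3 / 4"
        unfolding M_def using subspace_0[OF Y]
        by (intro cSUP_least) (auto simp: not_less M_def)
      then show False using False by simp
    qed
    then obtain y where y: "y \<in> Y" "norm y \<le> 1" "M * 3 / 4 < \<bar>d k y\<bar>" by auto
    have "M / (4 * (\<bar>K\<bar> + 1)) > 0" using False by (simp add: add_nonneg_pos)
    then obtain j where j: "norm (y - e j) < M / (4 * (\<bar>K\<bar> + 1))" using e_dense[OF y(1,2)] by blast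
    have "d k ((y - e j) + e j) = d k (y - e j) + d k (e j)"
      by (rule d_add) (use y e_Y subspace_diff[OF Y] in auto)
    moreover have "\<bar>d k (y - e j)\<bar> \<le> M / 4"
    proof -
      have "\<bar>d k (y - e j)\<bar> \<le> K * norm (y - e j)" using K y e_Y subspace_diff[OF Y] by auto
      also have "\<dots> \<le> (\<bar>K\<bar> + 1) * norm (y - e j)" by (intro mult_right_mono) auto
      also have "\<dots> \<le> M / 4" using j by (simp add: field_simps)
      finally show ?thesis .
    qed
    ultimately have "M \<le> 2 * \<bar>d k (e j)\<bar>" using y(3) by (simp add: abs_if split: if_splits)
    then show ?thesis by blast
  qed
  then obtain j where j: "M \<le> 2 * \<bar>d k (e j)\<bar>" by blast
  show ?thesis
  proof (rule that[OF kn])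
    fix g v assume g: "g \<in> dual_ball Y" and v: "v \<in> Y"
    let ?C = "3 * kn k g + 3 * kn k f + 2 * \<bar>g (e j) - f (e j)\<bar>"
    have unit: "\<bar>g v - f v\<bar> \<le> ?C" if v: "v \<in> Y" "norm v \<le> 1" for v
    proof -
      \<comment> \<open>The coefficient of \<open>e j\<close> when \<open>v\<close> is split along
        the kernel of \<open>d k\<close>. If \<open>d k (e j) = 0\<close>, then also
        \<open>d k v = 0\<close> by the choice of \<open>j\<close>, and the default value 0 of the
        division is the right one. The kernel part has norm at most \<open>1 + 2\<close>, whence the
        factors 3 in the conclusion.\<close>
      define c where "c = d k v / d k (e j)"
      define u where "u = v - c *\<^sub>R e j"
      have dv: "\<bar>d k v\<bar> \<le> 2 * \<bar>d k (e j)\<bar>" using Mu[OF v] j by linarith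
      then have c2: "\<bar>c\<bar> \<le> 2" by (cases "d k (e j) = 0") (auto simp: c_def field_simps)
      have uY: "u \<in> Y" unfolding u_def using v e_Y subspace_diff[OF Y] subspace_scale[OF Y] by auto
      have veq: "v = u + c *\<^sub>R e j" by (simp add: u_def)
      have "d k v = d k u + c * d k (e j)"
        by (subst veq, subst d_add) (use uY e_Y subspace_scale[OF Y] d_scale in auto)
      moreover have "c * d k (e j) = d k v" using dv by (cases "d k (e j) = 0") (auto simp: c_def)
      ultimately have du: "d k u = 0" by simp
      have "norm u \<le> norm v + \<bar>c\<bar> * norm (e j)" unfolding u_def using norm_triangle_ineq4[of v "c *\<^sub>R e j"] by simp
      also have "\<dots> \<le> 1 + 2 * 1" using v c2 e_norm[of j] by (intro add_mono mult_mono) auto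
      finally have "(1/3) *\<^sub>R u \<in> ker k" using uY du d_scale[OF uY, of k "1/3"] subspace_scale[OF Y]
        by (simp add: ker_def)
      then have *: "\<bar>h u\<bar> \<le> 3 * kn k h" if "h \<in> dual_ball Y" for h
      proof -
        have "h ((1/3) *\<^sub>R u) = (1/3) * h u" using that uY by (simp add: dual_ball_def)
        then show ?thesis using kn_upper[OF that \<open>(1/3) *\<^sub>R u \<in> ker k\<close>] by simp
      qed
      have hv: "h v = h u + c * h (e j)" if "h \<in> dual_ball Y" for h
      proof -
        have "h (u + c *\<^sub>R e j) = h u + h (c *\<^sub>R e j)"
          using that uY subspace_scale[OF Y e_Y] unfolding dual_ball_def by blast
        then show ?thesis using that e_Y[of j] veq by (simp add: dual_ball_def)
      qed
      have "g v - f v = g u - f u + c * (g (e j) - f (e j))" using hv[OF f] hv[OF g] by (simp add: algebra_simps)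
      moreover have "\<bar>c * (g (e j) - f (e j))\<bar> \<le> 2 * \<bar>g (e j) - f (e j)\<bar>"
        using c2 by (simp add: abs_mult mult_right_mono)
      ultimately show ?thesis using *[OF f] *[OF g] by linarith
    qed
    show "\<bar>g v - f v\<bar> \<le> ?C * norm v"
    proof (cases "v = 0")
      case True
      have "h 0 = 0" if "h \<in> dual_ball Y" for h
      proof -
        have "\<bar>h 0\<bar> \<le> norm (0::'a)" using that subspace_0[OF Y] unfolding dual_ball_def by blast
        then show ?thesis by simp
      qed
      from this[OF f] this[OF g] show ?thesis using True by simp
    next
      case False
      let ?u = "inverse (norm v) *\<^sub>R v"
      have "\<bar>g ?u - f ?u\<bar> \<le> ?C" using unit[of ?u] v subspace_scale[OF Y] False by simp
      moreover have "h ?u = inverse (norm v) * h v" if "h \<in> dual_ball Y" for h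
        using that v by (simp add: dual_ball_def)
      ultimately have "\<bar>inverse (norm v) * (g v - f v)\<bar> \<le> ?C" using f g by (simp add: algebra_simps)
      then show ?thesis using False by (simp add: abs_mult field_simps)
    qed
  qed
qed

lemma near_maximiser_close:
  assumes x: "x \<in> Y" and f: "f \<in> dual_ball Y" "f x - G f = p x" and \<epsilon>: "\<epsilon> > 0"
  obtains \<eta> where "\<eta> > 0" "\<And>g v. g \<in> dual_ball Y \<Longrightarrow> p x - \<eta> \<le> g x - G g \<Longrightarrow> v \<in> Y \<Longrightarrow> \<bar>g v - f v\<bar> \<le> \<epsilon> * norm v"
proof -
  \<comment> \<open>Eleven parts are needed: \<open>kn k g\<close> will be at most two of them,
    \<open>kn k f\<close> and the difference at \<open>e j\<close> one each, and
    \<open>3 * 2 + 3 * 1 + 2 * 1 = 11\<close>.\<close>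
  obtain k j where kj: "kn k f \<le> \<epsilon> / 11" "\<And>g v. g \<in> dual_ball Y \<Longrightarrow> v \<in> Y \<Longrightarrow>
      \<bar>g v - f v\<bar> \<le> (3 * kn k g + 3 * kn k f + 2 * \<bar>g (e j) - f (e j)\<bar>) * norm v"
    using kn_controls[OF f(1), of "\<epsilon> / 11"] \<epsilon> by auto
  \<comment> \<open>Makes both bounds \<open>sqrt (4 * 2^k * \<eta>)\<close> and
    \<open>sqrt (4 * 2^j * \<eta>)\<close> of \<open>near_maximisers\<close> at most
    \<open>\<epsilon> / 11\<close>.\<close>
  define \<eta> where "\<eta> = (\<epsilon> / 11)\<^sup>2 / (4 * 2 ^ (k + j))"
  have \<eta>: "\<eta> > 0" using \<epsilon> by (simp add: \<eta>_def)
  have "sqrt (4 * 2^k * \<eta>) \<le> \<epsilon> / 11" "sqrt (4 * 2^j * \<eta>) \<le> \<epsilon> / 11"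
  proof -
    have "4 * 2^k * \<eta> = (\<epsilon> / 11)\<^sup>2 / 2^j" "4 * 2^j * \<eta> = (\<epsilon> / 11)\<^sup>2 / 2^k"
      by (simp_all add: \<eta>_def power_add)
    moreover have "(\<epsilon> / 11)\<^sup>2 / 2^i \<le> (\<epsilon> / 11)\<^sup>2" for i :: nat
      using divide_left_mono[of 1 "2^i" "(\<epsilon> / 11)\<^sup>2"] by simp
    ultimately have "4 * 2^k * \<eta> \<le> (\<epsilon> / 11)\<^sup>2" "4 * 2^j * \<eta> \<le> (\<epsilon> / 11)\<^sup>2" by metis+
    then show "sqrt (4 * 2^k * \<eta>) \<le> \<epsilon> / 11" "sqrt (4 * 2^j * \<eta>) \<le> \<epsilon> / 11"
      using \<epsilon> by (intro real_le_lsqrt; simp)+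
  qed
  note sq = this
  show ?thesis
  proof (rule that[OF \<eta>])
    fix g v assume g: "g \<in> dual_ball Y" "p x - \<eta> \<le> g x - G g" and v: "v \<in> Y"
    have "\<bar>kn k f - kn k g\<bar> \<le> \<epsilon> / 11" "\<bar>f (e j) - g (e j)\<bar> \<le> \<epsilon> / 11"
      using near_maximisers[OF x f(1) _ g, of k] near_maximisers[OF x f(1) _ g, of j] f(2) \<eta> sq by auto
    then have "3 * kn k g + 3 * kn k f + 2 * \<bar>g (e j) - f (e j)\<bar> \<le> \<epsilon>" using kj(1) abs_minus_commute[of "f (e j)" "g (e j)"] by argo
    then show "\<bar>g v - f v\<bar> \<le> \<epsilon> * norm v"
      using kj(2)[OF g(1) v] by (meson mult_right_mono norm_ge_zero order_trans)
  qed
qed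

section \<open>The conjugate as a smooth gauge\<close>

lemma p_nonneg: "x \<in> Y \<Longrightarrow> 0 \<le> p x"
  using p_upper[OF _ zero_dual_ball, of x] G_scale[OF zero_dual_ball, of 0] by simp

lemma p_lipschitz:
  assumes "x \<in> Y" "y \<in> Y" shows "\<bar>p x - p y\<bar> \<le> norm (x - y)"
proof -
  have "p x \<le> p y + norm (x - y)" if xy: "x \<in> Y" "y \<in> Y" for x y
  proof (rule p_least)
    fix f assume f: "f \<in> dual_ball Y"
    have "f ((x - y) + y) = f (x - y) + f y" "\<bar>f (x - y)\<bar> \<le> norm (x - y)"
      using f xy(2) subspace_diff[OF Y xy] unfolding dual_ball_def by blast+
    then show "f x - G f \<le> p y + norm (x - y)" using p_upper[OF xy(2) f] by auto
  qed
  from this[OF assms] this[OF assms(2,1)] show ?thesis by (simp add: norm_minus_commute abs_le_iff)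
qed

lemma p_lower:
  assumes \<epsilon>: "\<epsilon> > 0" and y: "y \<in> Y" "\<epsilon> \<le> norm y"
  shows "min 1 (\<epsilon> / 8) / 2 * norm y \<le> p y"
proof -
  obtain f where f: "bounded_linear f" "f y = norm y" "\<And>v. \<bar>f v\<bar> \<le> norm v" using norming_functional by blast
  then have "linear f" using bounded_linear.linear by blast
  then have fB: "f \<in> dual_ball Y"
    using f(3) by (auto simp: dual_ball_def linear_add linear_scale)
  \<comment> \<open>The number in \<open>{0..1}\<close> that maximises the lower bound
    \<open>t * norm y - 4 * t\<^sup>2\<close>.\<close>
  define t where "t = min 1 (norm y / 8)"
  have t: "0 \<le> t" "t \<le> 1" "t \<le> norm y / 8" by (auto simp: t_def)
  have tf: "(\<lambda>x. t * f x) \<in> dual_ball Y" using dual_ball_sum[OF fB fB, of t 0] t by simp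
  have "min 1 (\<epsilon> / 8) / 2 * norm y \<le> t / 2 * norm y"
    using y by (intro mult_right_mono divide_right_mono) (auto simp: t_def)
  also have "\<dots> = t * norm y - 4 * (t * (norm y / 8))" by simp
  also have "\<dots> \<le> t * norm y - 4 * (t * t)" using mult_left_mono[OF t(3,1)] by linarith
  also have "\<dots> \<le> t * f y - G (\<lambda>x. t * f x)" using G_scale[OF fB t(1,2)] f(2) by (simp add: power2_eq_square)
  also have "\<dots> \<le> p y" using p_upper[OF y(1) tf] .
  finally show ?thesis .
qed

text \<open>Differentiability is Smulyan's argument. The maximiser \<open>f\<close> at
  \<open>x\<close> is a subgradient of \<open>p\<close> there; near-maximisers at
  \<open>x + v\<close> are near-maximisers at \<open>x\<close>, hence close to \<open>f\<close> in
  norm, and this gives the estimate from above.\<close>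

lemma p_smooth_gauge: "smooth_gauge Y p"
  unfolding smooth_gauge_def
proof (intro conjI ballI allI impI)
  show "p 0 = 0"
  proof (rule antisym)
    show "p 0 \<le> 0"
    proof (rule p_least)
      fix f assume f: "f \<in> dual_ball Y"
      then have "\<bar>f 0\<bar> \<le> norm (0::'a)" using subspace_0[OF Y] unfolding dual_ball_def by blast
      then show "f 0 - G f \<le> 0" using G_nonneg[OF f] by simp
    qed
  qed (use p_nonneg subspace_0[OF Y] in blast)
next
  fix \<epsilon> :: real assume "\<epsilon> > 0"
  then show "\<exists>c>0. \<forall>y\<in>Y. \<epsilon> \<le> norm y \<longrightarrow> c * norm y \<le> p y"
    using p_lower by (intro exI[of _ "min 1 (\<epsilon> / 8) / 2"]) auto
next
  fix x assume x: "x \<in> Y"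
  obtain f where f: "f \<in> dual_ball Y" "f x - G f = p x" using p_attained[OF x] .
  show "\<exists>f\<in>dual_ball Y. \<forall>\<epsilon>>0. \<exists>d>0. \<forall>v\<in>Y. norm v < d \<longrightarrow> \<bar>p (x + v) - p x - f v\<bar> \<le> \<epsilon> * norm v"
  proof (intro bexI[of _ f] f(1) allI impI)
    fix \<epsilon> :: real assume \<epsilon>: "\<epsilon> > 0"
    obtain \<eta> where \<eta>: "\<eta> > 0"
      "\<And>g v. g \<in> dual_ball Y \<Longrightarrow> p x - \<eta> \<le> g x - G g \<Longrightarrow> v \<in> Y \<Longrightarrow> \<bar>g v - f v\<bar> \<le> \<epsilon> / 2 * norm v"
      using near_maximiser_close[OF x f half_gt_zero[OF \<epsilon>]] by blast
    show "\<exists>d>0. \<forall>v\<in>Y. norm v < d \<longrightarrow> \<bar>p (x + v) - p x - f v\<bar> \<le> \<epsilon> * norm v"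
    \<comment> \<open>Returning from \<open>x + v\<close> to \<open>x\<close> costs at most
      \<open>norm v\<close> for each of \<open>f\<close> and \<open>g\<close>, in addition to the
      error \<open>\<epsilon> / 2 * norm v\<close> in the choice of \<open>g\<close>.\<close>
    proof (intro exI[of _ "\<eta> / (2 + \<epsilon> / 2)"] conjI ballI impI)
      show "\<eta> / (2 + \<epsilon> / 2) > 0" using \<eta> \<epsilon> by simp
      fix v assume v: "v \<in> Y" "norm v < \<eta> / (2 + \<epsilon> / 2)"
      then have vs: "(2 + \<epsilon> / 2) * norm v \<le> \<eta>" using \<epsilon> by (simp add: field_simps)
      have xv: "x + v \<in> Y" using x v subspace_add[OF Y] by blast
      have lin: "h (x + v) = h x + h v" "\<bar>h v\<bar> \<le> norm v" if "h \<in> dual_ball Y" for h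
        using that x v by (auto simp: dual_ball_def)
      have low: "p x + f v \<le> p (x + v)" using p_upper[OF xv f(1)] lin[OF f(1)] f(2) by simp
      have "p (x + v) \<le> p x + f v + \<epsilon> * norm v"
      proof (cases "v = 0")
        case True
        then show ?thesis using lin[OF f(1)] by simp
      next
        case False
        then have pos: "\<epsilon> / 2 * norm v > 0" using \<epsilon> by simp
        then obtain g where g: "g \<in> dual_ball Y" "p (x + v) - \<epsilon> / 2 * norm v < g (x + v) - G g"
          using p_attained_approx[of "p (x + v) - \<epsilon> / 2 * norm v" "x + v"] by auto
        have "p x - (2 + \<epsilon> / 2) * norm v \<le> g x - G g"
          using g(2) low lin[OF g(1)] lin[OF f(1)] by (simp add: algebra_simps)
        then have "\<bar>g v - f v\<bar> \<le> \<epsilon> / 2 * norm v" using \<eta>(2)[OF g(1) _ v(1)] vs by simp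
        then show ?thesis using g(2) lin[OF g(1)] p_upper[OF x g(1)] by (simp add: abs_le_iff) argo
      qed
      then show "\<bar>p (x + v) - p x - f v\<bar> \<le> \<epsilon> * norm v" using low by simp
    qed
  qed
qed (use p_nonneg p_lipschitz in auto)

end

lemma smooth_gauge_exists:
  fixes Y :: "'a::real_normed_vector set"
  assumes Y: "subspace Y" and C: "countable C" "C \<subseteq> Y" "Y \<subseteq> closure C" and dual: "separable_dual_on Y"
  obtains p where "smooth_gauge Y p"
proof -
  obtain D where D: "D \<subseteq> dual_on Y" "countable D"
    "\<And>f \<epsilon>. f \<in> dual_on Y \<Longrightarrow> \<epsilon> > 0 \<Longrightarrow> \<exists>g\<in>D. dual_norm_on Y (\<lambda>x. f x - g x) < \<epsilon>"
    using dual unfolding separable_dual_on_def by blast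
  have rB: "restrict f Y \<in> dual_on Y" if "f \<in> dual_ball Y" for f
    using that subspace_add[OF Y] subspace_scale[OF Y]
    by (auto simp: dual_on_def dual_ball_def intro!: exI[of _ 1])
  have z: "(\<lambda>x. 0) \<in> dual_ball Y" by (simp add: dual_ball_def)
  then have Dne: "D \<noteq> {}" using D(3)[OF rB[OF z], of 1] by auto
  define d where "d = from_nat_into D"
  have dD: "d k \<in> D" for k unfolding d_def using from_nat_into[OF Dne] .
  \<comment> \<open>Radial projection onto the unit ball moves a point by no more than its distance
    from any given point of the ball, so density in the ball is preserved. The added 0 makes the set
    nonempty.\<close>
  define C' where "C' = (\<lambda>c. inverse (max 1 (norm c)) *\<^sub>R c) ` insert 0 C"
  define e where "e = from_nat_into C'"
  have C'ne: "C' \<noteq> {}" "countable C'" using C by (auto simp: C'_def)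
  have eC: "e k \<in> C'" for k unfolding e_def using from_nat_into[OF C'ne(1)] .
  have C'Y: "C' \<subseteq> Y" "\<And>c. c \<in> C' \<Longrightarrow> norm c \<le> 1"
    using C(2) subspace_scale[OF Y] subspace_0[OF Y] by (auto simp: C'_def field_simps)
  interpret kadec Y d e
  proof
    show "subspace Y" by fact
    show "d k (x + y) = d k x + d k y" if "x \<in> Y" "y \<in> Y" for k x y
      using dD[of k] D(1) that by (auto simp: dual_on_def)
    show "d k (c *\<^sub>R x) = c * d k x" if "x \<in> Y" for k c x
      using dD[of k] D(1) that by (auto simp: dual_on_def)
    show dbd: "\<exists>K. \<forall>x\<in>Y. \<bar>d k x\<bar> \<le> K * norm x" for k
      using dD[of k] D(1) by (auto simp: dual_on_def)
    show "e k \<in> Y" "norm (e k) \<le> 1" for k using eC C'Y by auto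
    show "\<exists>k. \<forall>y\<in>Y. norm y \<le> 1 \<longrightarrow> d k y = 0 \<longrightarrow> \<bar>f y\<bar> \<le> \<epsilon>" if f: "f \<in> dual_ball Y" and \<epsilon>: "\<epsilon> > 0" for f \<epsilon>
    proof -
      obtain g where g: "g \<in> D" "dual_norm_on Y (\<lambda>x. restrict f Y x - g x) < \<epsilon>" using D(3)[OF rB[OF f] \<epsilon>] by blast
      obtain k where k: "g = d k" using from_nat_into_surj[OF D(2) g(1)] by (auto simp: d_def)
      obtain K where K: "\<forall>x\<in>Y. \<bar>g x\<bar> \<le> K * norm x" using dbd k by blast
      have "\<bar>restrict f Y y - g y\<bar> \<le> dual_norm_on Y (\<lambda>x. restrict f Y x - g x)" if y: "y \<in> Y" "norm y \<le> 1" for y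
        unfolding dual_norm_on_def
      proof (rule cSUP_upper)
        have "\<bar>restrict f Y y - g y\<bar> \<le> 1 + \<bar>K\<bar>" if y: "y \<in> Y" "norm y \<le> 1" for y
        proof -
          have "\<bar>f y\<bar> \<le> 1" using f y by (auto simp: dual_ball_def intro: order_trans)
          moreover have "\<bar>g y\<bar> \<le> \<bar>K\<bar>" using K y mult_mono[of K "\<bar>K\<bar>" "norm y" 1] by fastforce
          ultimately show ?thesis using y by simp
        qed
        then show "bdd_above ((\<lambda>x. \<bar>restrict f Y x - g x\<bar>) ` (Y \<inter> cball 0 1))"
          by (intro bdd_aboveI2[of _ _ "1 + \<bar>K\<bar>"]) auto
      qed (use y in auto)
      then show ?thesis using g(2) k by (intro exI[of _ k]) fastforce
    qed
    show "\<exists>k. norm (y - e k) < \<epsilon>" if y: "y \<in> Y" "norm y \<le> 1" and \<epsilon>: "\<epsilon> > 0" for y \<epsilon>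
    proof -
      have "y \<in> closure C" using y C(3) by blast
      then obtain c where c: "c \<in> C" "norm (c - y) < \<epsilon> / 2"
        using closure_approachable[of y C] half_gt_zero[OF \<epsilon>] unfolding dist_norm by blast
      let ?c = "inverse (max 1 (norm c)) *\<^sub>R c"
      have "norm (c - ?c) \<le> norm (c - y)"
      proof (cases "norm c \<le> 1")
        case False
        have "norm (c - ?c) = norm ((1 - inverse (norm c)) *\<^sub>R c)" using False by (simp add: scaleR_diff_left max_def)
        also have "\<dots> = (1 - inverse (norm c)) * norm c" using False by (simp add: inverse_le_1_iff)
        also have "\<dots> = norm c - 1" using False by (cases "c = 0") (auto simp: left_diff_distrib)
        also have "\<dots> \<le> norm (c - y)" using norm_triangle_ineq2[of c y] y by simp
        finally show ?thesis .
      qed (simp add: max_def)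
      then have "norm (y - ?c) < \<epsilon>"
        using c(2) norm_triangle_ineq[of "y - c" "c - ?c"] by (simp add: norm_minus_commute)
      moreover have "?c \<in> C'" using c by (simp add: C'_def)
      then obtain k where "e k = ?c" using from_nat_into_surj[OF C'ne(2)] by (auto simp: e_def)
      ultimately show ?thesis by metis
    qed
  qed
  show ?thesis using that p_smooth_gauge .
qed

section \<open>Separable reduction\<close>

text \<open>The slope is \<open>1 / (real m + 1)\<close> up to the distance
  \<open>1 / real C\<close> and of order \<open>(real C)\<^sup>2\<close> beyond. A single integer
  thus encodes both a neighbourhood in which a subgradient inequality holds with this error and a
  linear bound outside it. As the function is Lipschitz in \<open>t\<close>, the base point may be
  perturbed.\<close>

definition modulus :: "nat \<Rightarrow> nat \<Rightarrow> real \<Rightarrow> real" where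
  "modulus C m t = t / (real m + 1) + real C * max 0 (real C * t - 1)"

lemma modulus_lipschitz: "\<bar>modulus C m s - modulus C m t\<bar> \<le> (1 + (real C)\<^sup>2) * \<bar>s - t\<bar>"
proof -
  have 1: "\<bar>s / (real m + 1) - t / (real m + 1)\<bar> \<le> \<bar>s - t\<bar>"
    by (simp add: diff_divide_distrib[symmetric] abs_divide divide_le_eq mult_left_le_one_le
        mult.commute[of "\<bar>s - t\<bar>"]) (simp add: algebra_simps)
  have "\<bar>max 0 (real C * s - 1) - max 0 (real C * t - 1)\<bar> \<le> \<bar>real C * s - real C * t\<bar>" by auto
  also have "\<dots> = real C * \<bar>s - t\<bar>" by (simp add: right_diff_distrib[symmetric] abs_mult)
  finally have "real C * \<bar>max 0 (real C * s - 1) - max 0 (real C * t - 1)\<bar> \<le> real C * (real C * \<bar>s - t\<bar>)"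
    by (rule mult_left_mono) simp
  then have 2: "\<bar>real C * max 0 (real C * s - 1) - real C * max 0 (real C * t - 1)\<bar> \<le> (real C)\<^sup>2 * \<bar>s - t\<bar>"
    by (simp add: right_diff_distrib[symmetric] abs_mult power2_eq_square mult.assoc)
  show ?thesis
    unfolding modulus_def distrib_right mult_1_left by (rule order_trans[OF abs_diff_triangle_ineq add_mono[OF 1 2]])
qed

text \<open>A functional \<open>f\<close> with \<open>f (u - y) \<le> h u - a + modulus (c m) m (norm (u - y))\<close> for all
  \<open>u \<in> S\<close> and \<open>m\<close> is, for \<open>a = h y\<close>, a Frechet subgradient of \<open>h\<close> on \<open>S\<close> at \<open>y\<close>.  By the sandwich
  theorem there is such an \<open>f\<close> for which \<open>- f\<close> is moreover an \<open>\<eta>\<close>-subgradient of \<open>g\<close> at \<open>y'\<close> iff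
  the gap is nonnegative for all convex weights \<open>l\<close> on finite sets \<open>W\<close> of pairs \<open>(u, m)\<close>.
  Since each such condition involves finitely many points only, it is inherited by the whole space
  from a suitable separable subspace.\<close>
definition gap :: "('a::real_normed_vector \<Rightarrow> real) \<Rightarrow> ('a \<Rightarrow> real) \<Rightarrow> real \<Rightarrow> 'a \<Rightarrow> 'a \<Rightarrow> real \<Rightarrow> (nat \<Rightarrow> nat) \<Rightarrow>
    ('a \<times> nat) set \<Rightarrow> ('a \<times> nat \<Rightarrow> real) \<Rightarrow> real" where
  "gap h g \<eta> y y' a c W l =
     (\<Sum>p\<in>W. l p * (h (fst p) - a + modulus (c (snd p)) (snd p) (norm (fst p - y)))) +
     (g (y' + (\<Sum>p\<in>W. l p *\<^sub>R (fst p - y))) - g y' + \<eta> * norm (\<Sum>p\<in>W. l p *\<^sub>R (fst p - y)))"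

definition convex_weights :: "('a \<times> nat) set \<Rightarrow> ('a \<times> nat) set \<Rightarrow> ('a \<times> nat \<Rightarrow> real) \<Rightarrow> bool" where
  "convex_weights P W l \<longleftrightarrow> finite W \<and> W \<subseteq> P \<and> (\<forall>p\<in>W. 0 \<le> l p) \<and> sum l W = 1"

text \<open>The estimate is uniform in \<open>W\<close> and \<open>l\<close> and involves
  \<open>c\<close> only below \<open>M\<close>. As the weights have sum 1, replacing
  \<open>y\<close> by \<open>d\<close> moves the weighted mean of the differences exactly by
  \<open>d - y\<close>. Hence a negative gap stays negative when the base data are replaced by
  nearby data from a countable set.\<close>

lemma gap_continuous:
  assumes gL: "\<And>v w. \<bar>g v - g w\<bar> \<le> L * norm (v - w)" and \<eta>: "0 \<le> \<eta>" and L: "0 \<le> L"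
    and W: "convex_weights (S \<times> {..<M}) W l"
  shows "\<bar>gap h g \<eta> y y' a c W l - gap h g \<eta> d d' r c W l\<bar>
    \<le> (1 + (\<Sum>m<M. 1 + (real (c m))\<^sup>2) + 2 * L + \<eta>) * (norm (y - d) + norm (y' - d') + \<bar>a - r\<bar>)"
proof -
  have fin: "finite W" and pos: "\<And>p. p \<in> W \<Longrightarrow> 0 \<le> l p" and one: "sum l W = 1"
    using W by (auto simp: convex_weights_def)
  define A where "A = (\<Sum>m<M. 1 + (real (c m))\<^sup>2)"
  have A: "1 + (real (c m))\<^sup>2 \<le> A" if "m < M" for m
    unfolding A_def by (rule member_le_sum[where f = "\<lambda>m. 1 + (real (c m))\<^sup>2"]) (use that in auto)
  have A0: "0 \<le> A" unfolding A_def by (intro sum_nonneg) auto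
  have T: "\<bar>(h (fst p) - a + modulus (c (snd p)) (snd p) (norm (fst p - y)))
      - (h (fst p) - r + modulus (c (snd p)) (snd p) (norm (fst p - d)))\<bar> \<le> \<bar>a - r\<bar> + A * norm (y - d)"
    if p: "p \<in> W" for p
  proof -
    have "\<bar>modulus (c (snd p)) (snd p) (norm (fst p - y)) - modulus (c (snd p)) (snd p) (norm (fst p - d))\<bar>
      \<le> (1 + (real (c (snd p)))\<^sup>2) * \<bar>norm (fst p - y) - norm (fst p - d)\<bar>" by (rule modulus_lipschitz)
    also have "\<dots> \<le> A * norm (y - d)"
    proof (rule mult_mono)
      have "snd p < M" using p W by (auto simp: convex_weights_def)
      then show "1 + (real (c (snd p)))\<^sup>2 \<le> A" by (rule A)
      show "\<bar>norm (fst p - y) - norm (fst p - d)\<bar> \<le> norm (y - d)"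
        using norm_triangle_ineq3[of "fst p - y" "fst p - d"] by (simp add: norm_minus_commute)
    qed (use A0 in auto)
    finally show ?thesis by argo
  qed
  have 1: "\<bar>(\<Sum>p\<in>W. l p * (h (fst p) - a + modulus (c (snd p)) (snd p) (norm (fst p - y))))
      - (\<Sum>p\<in>W. l p * (h (fst p) - r + modulus (c (snd p)) (snd p) (norm (fst p - d))))\<bar>
      \<le> \<bar>a - r\<bar> + A * norm (y - d)"
  proof -
    have "\<bar>(\<Sum>p\<in>W. l p * (h (fst p) - a + modulus (c (snd p)) (snd p) (norm (fst p - y))))
      - (\<Sum>p\<in>W. l p * (h (fst p) - r + modulus (c (snd p)) (snd p) (norm (fst p - d))))\<bar>
      \<le> (\<Sum>p\<in>W. l p * (\<bar>a - r\<bar> + A * norm (y - d)))"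
      unfolding sum_subtractf[symmetric] right_diff_distrib[symmetric]
      by (rule order_trans[OF sum_abs]) (use T pos in \<open>auto intro!: sum_mono mult_left_mono simp: abs_mult\<close>)
    also have "\<dots> = \<bar>a - r\<bar> + A * norm (y - d)" using one by (simp add: sum_distrib_right[symmetric])
    finally show ?thesis .
  qed
  define v w where "v = (\<Sum>p\<in>W. l p *\<^sub>R (fst p - y))" and "w = (\<Sum>p\<in>W. l p *\<^sub>R (fst p - d))"
  have "v - w = (\<Sum>p\<in>W. l p *\<^sub>R (d - y))"
    unfolding v_def w_def sum_subtractf[symmetric] scaleR_diff_right[symmetric] by simp
  also have "\<dots> = d - y" using one by (simp add: scaleR_left.sum[symmetric])
  finally have vw: "norm (v - w) = norm (y - d)" by (simp add: norm_minus_commute)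
  have "norm ((y' + v) - (d' + w)) \<le> norm (y' - d') + norm (y - d)"
    using norm_triangle_ineq[of "y' - d'" "v - w"] vw by (simp add: algebra_simps)
  then have 2: "\<bar>g (y' + v) - g (d' + w)\<bar> \<le> L * (norm (y' - d') + norm (y - d))"
    using gL[of "y' + v" "d' + w"] L by (meson mult_left_mono order_trans)
  have 3: "\<bar>g y' - g d'\<bar> \<le> L * norm (y' - d')" by (rule gL)
  have "\<bar>norm v - norm w\<bar> \<le> norm (y - d)" using norm_triangle_ineq3[of v w] vw by simp
  then have "\<eta> * \<bar>norm v - norm w\<bar> \<le> \<eta> * norm (y - d)" using \<eta> by (rule mult_left_mono)
  then have 4: "\<bar>\<eta> * norm v - \<eta> * norm w\<bar> \<le> \<eta> * norm (y - d)"
    using \<eta> by (simp add: right_diff_distrib[symmetric] abs_mult)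
  have "\<bar>gap h g \<eta> y y' a c W l - gap h g \<eta> d d' r c W l\<bar> \<le>
     (\<bar>a - r\<bar> + A * norm (y - d)) + (L * (norm (y' - d') + norm (y - d)) + L * norm (y' - d')) + \<eta> * norm (y - d)"
    using 1 2 3 4 unfolding gap_def v_def[symmetric] w_def[symmetric] by linarith
  also have "\<dots> \<le> (1 + A + 2 * L + \<eta>) * (norm (y - d) + norm (y' - d') + \<bar>a - r\<bar>)"
  proof -
    have "0 \<le> norm (y - d) * (1 + L) + norm (y' - d') * (1 + A + \<eta>) + \<bar>a - r\<bar> * (A + 2 * L + \<eta>)"
      using A0 L \<eta> by (intro add_nonneg_nonneg mult_nonneg_nonneg) auto
    then show ?thesis by (simp add: algebra_simps)
  qed
  finally show ?thesis by (simp add: A_def)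
qed

lemma countable_closure:
  fixes F :: "'a \<Rightarrow> 'a \<Rightarrow> 'n::countable \<Rightarrow> 'a set"
  assumes F: "\<And>x y n. countable (F x y n)" and C0: "countable C0"
    and V: "C0 \<subseteq> V" "\<And>x y n. x \<in> V \<Longrightarrow> y \<in> V \<Longrightarrow> F x y n \<subseteq> V"
  obtains C where "countable C" "C0 \<subseteq> C" "C \<subseteq> V" "\<And>x y n. x \<in> C \<Longrightarrow> y \<in> C \<Longrightarrow> F x y n \<subseteq> C"
proof -
  define step where "step C = C \<union> (\<Union>x\<in>C. \<Union>y\<in>C. \<Union>n. F x y n)" for C
  define K where "K n = (step ^^ n) C0" for n
  have K: "countable (K n) \<and> K n \<subseteq> V" for n
  proof (induction n)
    case (Suc n)
    then show ?case using F V(2) unfolding K_def step_def by simp blast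
  qed (use C0 V in \<open>auto simp: K_def\<close>)
  have mono: "m \<le> n \<Longrightarrow> K m \<subseteq> K n" for m n
    by (rule lift_Suc_mono_le) (auto simp: K_def step_def)
  have "F x y n \<subseteq> (\<Union>k. K k)" if "x \<in> K i" "y \<in> K j" for x y n i j
  proof -
    have "x \<in> K (max i j)" "y \<in> K (max i j)" using that mono[of i "max i j"] mono[of j "max i j"] by auto
    then have "F x y n \<subseteq> K (Suc (max i j))" unfolding K_def step_def by auto
    then show ?thesis by blast
  qed
  note FK = this
  show ?thesis
  proof (rule that[of "\<Union>k. K k"])
    show "C0 \<subseteq> (\<Union>k. K k)" using UN_upper[of 0 UNIV K] by (simp add: K_def)
    show "F x y n \<subseteq> (\<Union>k. K k)" if "x \<in> (\<Union>k. K k)" "y \<in> (\<Union>k. K k)" for x y n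
      using that FK by (elim UN_E) simp
  qed (use K in auto)
qed

lemma rational_near:
  fixes c :: real assumes "\<epsilon> > 0" obtains r where "\<bar>c - real_of_rat r\<bar> < \<epsilon>"
proof -
  have "c - \<epsilon> < c + \<epsilon>" using assms by simp
  then obtain r where "c - \<epsilon> < real_of_rat r" "real_of_rat r < c + \<epsilon>" using of_rat_dense by blast
  then have "\<bar>c - real_of_rat r\<bar> < \<epsilon>" by linarith
  then show ?thesis by (rule that)
qed

lemma subspace_closure_rational:
  fixes C :: "'a::real_normed_vector set"
  assumes ne: "C \<noteq> {}" and comb: "\<And>x y r s. x \<in> C \<Longrightarrow> y \<in> C \<Longrightarrow> real_of_rat r *\<^sub>R x + real_of_rat s *\<^sub>R y \<in> C"
  shows "subspace (closure C)"
proof -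
  have rat: "\<exists>r. (\<lambda>n. real_of_rat (r n)) \<longlonglongrightarrow> c" for c :: real
  proof -
    have "\<exists>r. \<bar>real_of_rat r - c\<bar> < inverse (real (Suc n))" for n
      using rational_near[of "inverse (real (Suc n))" c] abs_minus_commute by (metis inverse_positive_iff_positive of_nat_0_less_iff zero_less_Suc)
    then have "\<exists>r. \<forall>n. \<bar>real_of_rat (r n) - c\<bar> < inverse (real (Suc n))" by (intro choice allI)
    then obtain r where "\<And>n. \<bar>real_of_rat (r n) - c\<bar> < inverse (real (Suc n))" by blast
    then have "(\<lambda>n. real_of_rat (r n) - c) \<longlonglongrightarrow> 0"
      by (intro Lim_null_comparison[OF _ LIMSEQ_inverse_real_of_nat]) (auto intro!: always_eventually less_imp_le)
    then show ?thesis using LIM_zero_iff by blast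
  qed
  have comb': "a *\<^sub>R x + b *\<^sub>R y \<in> closure C" if xy: "x \<in> closure C" "y \<in> closure C" for x y a b
  proof -
    obtain u v where u: "\<And>n. u n \<in> C" "u \<longlonglongrightarrow> x" and v: "\<And>n. v n \<in> C" "v \<longlonglongrightarrow> y"
      using xy unfolding closure_sequential by blast
    obtain r s where "(\<lambda>n. real_of_rat (r n)) \<longlonglongrightarrow> a" "(\<lambda>n. real_of_rat (s n)) \<longlonglongrightarrow> b" using rat by blast
    then have "(\<lambda>n. real_of_rat (r n) *\<^sub>R u n + real_of_rat (s n) *\<^sub>R v n) \<longlonglongrightarrow> a *\<^sub>R x + b *\<^sub>R y"
      using u v by (intro tendsto_intros)
    moreover have "real_of_rat (r n) *\<^sub>R u n + real_of_rat (s n) *\<^sub>R v n \<in> C" for n by (rule comb[OF u(1) v(1)])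
    ultimately show ?thesis unfolding closure_sequential by (intro exI conjI allI)
  qed
  obtain x where x: "x \<in> closure C" using ne closure_subset by blast
  show ?thesis
    unfolding subspace_def using comb'[OF x x, of 0 0] comb'[of _ _ 1 1] comb'[OF _ x, of _ _ 0] by simp
qed

text \<open>A closing-off argument: for each of countably many data, a violating family of weights
  is selected if there is one, and its points are added to \<open>C\<close>. A list
  \<open>cs\<close> represents the finitely many values of \<open>c\<close> that a finite
  \<open>W\<close> can see. A violation by points of \<open>S\<close> then forces one by points of
  \<open>S\<close> in the closure of \<open>C\<close>.\<close>

lemma separable_reduction:
  fixes h g :: "'a::real_normed_vector \<Rightarrow> real"
  assumes gL: "\<And>v w. \<bar>g v - g w\<bar> \<le> L * norm (v - w)" and \<eta>: "0 \<le> \<eta>" and L: "0 \<le> L"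
    and V: "subspace V" "closed V" "S \<subseteq> V" "xb \<in> V"
  obtains C where "countable C" "xb \<in> C" "subspace (closure C)" "closure C \<subseteq> V"
    "\<And>y y' a c W l. y \<in> closure C \<Longrightarrow> y' \<in> closure C \<Longrightarrow>
       (\<And>W l. convex_weights ((S \<inter> closure C) \<times> UNIV) W l \<Longrightarrow> 0 \<le> gap h g \<eta> y y' a c W l) \<Longrightarrow>
       convex_weights (S \<times> UNIV) W l \<Longrightarrow> 0 \<le> gap h g \<eta> y y' a c W l"
proof -
  define bad where "bad d d' r cs k W l \<longleftrightarrow> convex_weights (S \<times> {..<length cs}) W l \<and>
      gap h g \<eta> d d' (real_of_rat r) (\<lambda>m. cs ! m) W l < - inverse (real (Suc k))"
    for d d' :: 'a and r cs and k :: nat and W l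
  \<comment> \<open>The indices \<open>Inl\<close> add rational combinations, which make the closure
    a subspace; the indices \<open>Inr\<close> add the points of a selected violation.\<close>
  define F where "F d d' n = (case n of Inl (r, s) \<Rightarrow> {real_of_rat r *\<^sub>R d + real_of_rat s *\<^sub>R d'}
      | Inr (r, cs, k) \<Rightarrow> (if \<exists>W l. bad d d' r cs k W l then fst ` (SOME W. \<exists>l. bad d d' r cs k W l) else {}))"
    for d d' and n :: "(rat \<times> rat) + (rat \<times> nat list \<times> nat)"
  have some: "\<exists>l. bad d d' r cs k (SOME W. \<exists>l. bad d d' r cs k W l) l" if "bad d d' r cs k W l" for d d' r cs k W l
    by (rule someI[where P = "\<lambda>W. \<exists>l. bad d d' r cs k W l"]) (use that in blast)
  have F: "countable (F d d' n) \<and> (d \<in> V \<longrightarrow> d' \<in> V \<longrightarrow> F d d' n \<subseteq> V)" for d d' n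
  proof (cases n)
    case (Inl rs)
    then show ?thesis using V(1) by (cases rs) (auto simp: F_def subspace_add subspace_scale)
  next
    case (Inr t)
    obtain r cs k where t: "t = (r, cs, k)" by (cases t)
    show ?thesis
    proof (cases "\<exists>W l. bad d d' r cs k W l")
      case True
      then obtain l where "bad d d' r cs k (SOME W. \<exists>l. bad d d' r cs k W l) l" using some by blast
      then have "finite (SOME W. \<exists>l. bad d d' r cs k W l)"
        "(SOME W. \<exists>l. bad d d' r cs k W l) \<subseteq> S \<times> {..<length cs}"
        unfolding bad_def[of _ _ _ _ _ "SOME W. \<exists>l. bad d d' r cs k W l"] convex_weights_def by auto
      moreover have "F d d' n = fst ` (SOME W. \<exists>l. bad d d' r cs k W l)" using True by (simp add: F_def Inr t)
      ultimately show ?thesis using V(3) by (auto intro: countable_finite)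
    qed (use Inr t in \<open>auto simp: F_def\<close>)
  qed
  obtain C where C: "countable C" "{xb} \<subseteq> C" "C \<subseteq> V" "\<And>d d' n. d \<in> C \<Longrightarrow> d' \<in> C \<Longrightarrow> F d d' n \<subseteq> C"
    by (rule countable_closure[of F "{xb}" V]) (use F V(4) in auto)
  have comb: "real_of_rat r *\<^sub>R x + real_of_rat s *\<^sub>R y \<in> C" if "x \<in> C" "y \<in> C" for x y r s
    using C(4)[OF that, of "Inl (r, s)"] by (simp add: F_def)
  show ?thesis
  proof (rule that[OF C(1)])
    show "xb \<in> C" "closure C \<subseteq> V" using C(2,3) V(2) by (auto intro: closure_minimal[THEN subsetD])
    show "subspace (closure C)" using comb C(2) by (intro subspace_closure_rational) auto
    fix y y' a c W l
    assume y: "y \<in> closure C" "y' \<in> closure C"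
      and ge: "\<And>W l. convex_weights ((S \<inter> closure C) \<times> UNIV) W l \<Longrightarrow> 0 \<le> gap h g \<eta> y y' a c W l"
      and W: "convex_weights (S \<times> UNIV) W l"
    show "0 \<le> gap h g \<eta> y y' a c W l"
    proof (rule ccontr)
      assume "\<not> ?thesis"
      then have neg: "- gap h g \<eta> y y' a c W l / 2 > 0" by simp
      \<comment> \<open>The gap is below \<open>- 2 / (k + 1)\<close>. One half is spent in passing
        to the countable data, the other in returning from them with the selected violation.\<close>
      obtain k where k: "inverse (real (Suc k)) < - gap h g \<eta> y y' a c W l / 2"
        using reals_Archimedean[OF neg] by blast
      have "finite (snd ` W)" using W by (simp add: convex_weights_def)
      then obtain M where "\<And>m. m \<in> snd ` W \<Longrightarrow> m < M"
        using finite_nat_set_iff_bounded[of "snd ` W"] by blast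
      then have WM: "convex_weights (S \<times> {..<M}) W l" using W by (force simp: convex_weights_def)
      define cs where "cs = map c [0..<M]"
      have cs: "length cs = M" "\<And>m. m < M \<Longrightarrow> cs ! m = c m" by (auto simp: cs_def)
      have gap_cs: "gap h g \<eta> d d' r (\<lambda>m. cs ! m) W l = gap h g \<eta> d d' r c W l"
        if "convex_weights (S \<times> {..<M}) W l" for d d' r W l
      proof -
        have "snd p < M" if "p \<in> W" for p
          using that \<open>convex_weights (S \<times> {..<M}) W l\<close> by (auto simp: convex_weights_def)
        then show ?thesis unfolding gap_def using cs(2)
          by (intro arg_cong2[where f = "(+)"] sum.cong refl) simp
      qed
      define K where "K = 1 + (\<Sum>m<M. 1 + (real (c m))\<^sup>2) + 2 * L + \<eta>"
      have K: "K > 0" unfolding K_def using L \<eta> sum_nonneg[of "{..<M}" "\<lambda>m. 1 + (real (c m))\<^sup>2"] by (simp add: add_pos_nonneg)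
      \<comment> \<open>\<open>K\<close> is the Lipschitz constant of the gap in its base data; each
        of the three approximations may cost a third of \<open>1 / (k + 1)\<close>.\<close>
      define t where "t = inverse (real (Suc k)) / (3 * K)"
      have t: "t > 0" using K by (simp add: t_def)
      have near: "\<exists>d\<in>C. norm (y - d) < t" if "y \<in> closure C" for y
        using that t unfolding closure_approachable by (auto simp: dist_norm norm_minus_commute)
      obtain d d' where d: "d \<in> C" "norm (y - d) < t" "d' \<in> C" "norm (y' - d') < t"
        using near[OF y(1)] near[OF y(2)] by blast
      obtain r where "\<bar>a - real_of_rat r\<bar> < t"
        using rational_near[OF t] by blast
      then have "norm (y - d) + norm (y' - d') + \<bar>a - real_of_rat r\<bar> < 3 * t" using d by simp
      then have "K * (norm (y - d) + norm (y' - d') + \<bar>a - real_of_rat r\<bar>) < K * (3 * t)"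
        using K by (rule mult_strict_left_mono)
      also have "\<dots> = inverse (real (Suc k))" using K by (simp add: t_def)
      finally have close: "\<bar>gap h g \<eta> y y' a c W l - gap h g \<eta> d d' (real_of_rat r) c W l\<bar> < inverse (real (Suc k))"
        if "convex_weights (S \<times> {..<M}) W l" for W l
        using gap_continuous[OF gL \<eta> L that, of h y y' a c d d' "real_of_rat r"] unfolding K_def by linarith
      have "bad d d' r cs k W l"
        unfolding bad_def cs(1) using WM gap_cs[OF WM] close[OF WM] k by simp
      then obtain l' where l': "bad d d' r cs k (SOME W. \<exists>l. bad d d' r cs k W l) l'" using some by blast
      define W' where "W' = (SOME W. \<exists>l. bad d d' r cs k W l)"
      have W': "convex_weights (S \<times> {..<M}) W' l'"
        "gap h g \<eta> d d' (real_of_rat r) (\<lambda>m. cs ! m) W' l' < - inverse (real (Suc k))"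
        using l' unfolding W'_def bad_def cs(1) by auto
      have "\<exists>W l. bad d d' r cs k W l" using l' by blast
      then have "F d d' (Inr (r, cs, k)) = fst ` W'" by (simp add: F_def W'_def)
      then have "fst ` W' \<subseteq> C" using C(4)[OF d(1,3)] by metis
      then have "convex_weights ((S \<inter> closure C) \<times> UNIV) W' l'"
        using W'(1) closure_subset[of C] unfolding convex_weights_def by fastforce
      then have "0 \<le> gap h g \<eta> y y' a c W' l'" by (rule ge)
      then show False using W'(2) close[OF W'(1)] gap_cs[OF W'(1)] by simp
    qed
  qed
qed

section \<open>The fuzzy sum rule\<close>

definition subgradient_on :: "'a::real_normed_vector set \<Rightarrow> ('a \<Rightarrow> real) \<Rightarrow> 'a \<Rightarrow> ('a \<Rightarrow> real) \<Rightarrow> bool" where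
  "subgradient_on S h y f \<longleftrightarrow>
     (\<forall>e>0. \<exists>d>0. \<forall>v\<in>S. norm (v - y) < d \<longrightarrow> h y + f (v - y) - e * norm (v - y) \<le> h v)"

lemma abs_suminf_geometric_le:
  fixes a :: "nat \<Rightarrow> real"
  assumes "\<And>k. \<bar>a k\<bar> \<le> (1/2)^k * c" shows "\<bar>suminf a\<bar> \<le> 2 * c"
proof -
  have geo: "summable (\<lambda>k. (1/2::real)^k * c)" "(\<Sum>k. (1/2::real)^k * c) = 2 * c"
    by (auto intro!: summable_mult2 summable_geometric simp: suminf_mult2[symmetric] suminf_geometric)
  have "summable (\<lambda>k. norm (a k))" using assms by (intro summable_comparison_test'[OF geo(1)]) simp
  then have "norm (suminf a) \<le> (\<Sum>k. norm (a k))" "(\<Sum>k. norm (a k)) \<le> (\<Sum>k. (1/2)^k * c)"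
    using assms by (auto intro!: summable_rabs suminf_le geo)
  then show ?thesis using geo(2) by simp
qed

text \<open>The remainders of all terms are at most \<open>2 * norm v\<close> by the Lipschitz
  property. So the tail of the series is small relative to \<open>norm v\<close> uniformly in
  \<open>v\<close>, and only finitely many terms have to be differentiated.\<close>

lemma gauge_series_derivative:
  assumes Y: "subspace Y" and p: "smooth_gauge Y p" and w: "\<And>k. w k \<in> Y" and z: "z \<in> Y"
    and sm: "\<And>x. x \<in> Y \<Longrightarrow> summable (\<lambda>k. (1/2)^k * p (x - w k))"
  obtains F where "\<And>u v. u \<in> Y \<Longrightarrow> v \<in> Y \<Longrightarrow> F (u + v) = F u + F v" "\<And>c v. v \<in> Y \<Longrightarrow> F (c *\<^sub>R v) = c * F v"
    "\<And>v. v \<in> Y \<Longrightarrow> \<bar>F v\<bar> \<le> 2 * norm v"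
    "\<And>e. e > 0 \<Longrightarrow> \<exists>d>0. \<forall>v\<in>Y. norm v < d \<longrightarrow>
      \<bar>(\<Sum>k. (1/2)^k * p (z + v - w k)) - (\<Sum>k. (1/2)^k * p (z - w k)) - F v\<bar> \<le> e * norm v"
proof -
  have "\<exists>f\<in>dual_ball Y. \<forall>e>0. \<exists>d>0. \<forall>v\<in>Y. norm v < d \<longrightarrow> \<bar>p (z - w k + v) - p (z - w k) - f v\<bar> \<le> e * norm v" for k
    using p subspace_diff[OF Y z w[of k]] unfolding smooth_gauge_def by blast
  then obtain f where f: "\<And>k. f k \<in> dual_ball Y" and df: "\<And>k e. e > 0 \<Longrightarrow>
      \<exists>d>0. \<forall>v\<in>Y. norm v < d \<longrightarrow> \<bar>p (z - w k + v) - p (z - w k) - f k v\<bar> \<le> e * norm v"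
    by metis
  have pL: "\<bar>p x - p y\<bar> \<le> norm (x - y)" if "x \<in> Y" "y \<in> Y" for x y
    using p that by (simp add: smooth_gauge_def)
  have fb: "\<bar>f k v\<bar> \<le> norm v" if "v \<in> Y" for k v using f[of k] that by (simp add: dual_ball_def)
  have geo: "summable (\<lambda>k. (1/2::real)^k * c)" "(\<Sum>k. (1/2::real)^k * c) = 2 * c" for c
    by (auto intro!: summable_mult2 summable_geometric simp: suminf_mult2[symmetric] suminf_geometric)
  have sf: "summable (\<lambda>k. (1/2)^k * f k v)" if v: "v \<in> Y" for v
  proof (rule summable_comparison_test'[OF geo(1)[of "norm v"]])
    show "norm ((1/2)^k * f k v) \<le> (1/2)^k * norm v" for k
      using fb[OF v, of k] by (simp add: abs_mult mult_left_mono)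
  qed
  define F where "F v = (\<Sum>k. (1/2)^k * f k v)" for v
  show ?thesis
  proof (rule that[of F])
    fix u v assume uv: "u \<in> Y" "v \<in> Y"
    have "f k (u + v) = f k u + f k v" for k using f[of k] uv by (simp add: dual_ball_def)
    then show "F (u + v) = F u + F v" unfolding F_def using suminf_add[OF sf[OF uv(1)] sf[OF uv(2)]]
      by (simp add: distrib_left)
  next
    fix c v assume v: "v \<in> Y"
    have "f k (c *\<^sub>R v) = c * f k v" for k using f[of k] v by (simp add: dual_ball_def)
    then show "F (c *\<^sub>R v) = c * F v" unfolding F_def using suminf_mult[OF sf[OF v], of c]
      by (simp add: mult.left_commute)
  next
    fix v assume v: "v \<in> Y"
    show "\<bar>F v\<bar> \<le> 2 * norm v" unfolding F_def
      by (rule abs_suminf_geometric_le) (use fb[OF v] in \<open>simp add: abs_mult mult_left_mono\<close>)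
  next
    fix e :: real assume e: "e > 0"
    \<comment> \<open>The tail is at most \<open>2 * (1/2)^N * (2 * norm v)\<close>, which leaves
      \<open>e / 2 * norm v\<close> for the first \<open>N\<close> terms.\<close>
    obtain N where N: "(1/2::real)^N < e / 8" using real_arch_pow_inv[of "e / 8" "1/2"] e by auto
    have "\<exists>d>0. \<forall>v\<in>Y. norm v < d \<longrightarrow> (\<forall>k<N. \<bar>p (z - w k + v) - p (z - w k) - f k v\<bar> \<le> e / 4 * norm v)"
    proof (induction N)
      case (Suc N)
      then obtain d where d: "d > 0" "\<forall>v\<in>Y. norm v < d \<longrightarrow> (\<forall>k<N. \<bar>p (z - w k + v) - p (z - w k) - f k v\<bar> \<le> e / 4 * norm v)" by blast
      obtain d' where d': "d' > 0" "\<forall>v\<in>Y. norm v < d' \<longrightarrow> \<bar>p (z - w N + v) - p (z - w N) - f N v\<bar> \<le> e / 4 * norm v"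
        using df[of "e / 4" N] e by auto
      show ?case using d d' by (intro exI[of _ "min d d'"]) (auto simp: less_Suc_eq)
    qed (auto intro: exI[of _ 1])
    then obtain d where d: "d > 0" "\<And>v k. v \<in> Y \<Longrightarrow> norm v < d \<Longrightarrow> k < N \<Longrightarrow>
        \<bar>p (z - w k + v) - p (z - w k) - f k v\<bar> \<le> e / 4 * norm v" by blast
    show "\<exists>d>0. \<forall>v\<in>Y. norm v < d \<longrightarrow>
      \<bar>(\<Sum>k. (1/2)^k * p (z + v - w k)) - (\<Sum>k. (1/2)^k * p (z - w k)) - F v\<bar> \<le> e * norm v"
    proof (intro exI[of _ d] conjI d(1) ballI impI)
      fix v assume v: "v \<in> Y" "norm v < d"
      define r where "r k = p (z - w k + v) - p (z - w k) - f k v" for k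
      have r2: "\<bar>r k\<bar> \<le> 2 * norm v" for k
        using pL[of "z - w k + v" "z - w k"] fb[OF v(1), of k] subspace_add[OF Y] subspace_diff[OF Y z w[of k]] v(1)
        unfolding r_def by simp
      have zv: "z + v \<in> Y" using subspace_add[OF Y z v(1)] .
      have eq: "(1/2)^k * r k = ((1/2)^k * p (z + v - w k) - (1/2)^k * p (z - w k)) - (1/2)^k * f k v" for k
        unfolding r_def by (simp add: algebra_simps)
      have sr: "summable (\<lambda>k. (1/2)^k * r k)"
        unfolding eq by (intro summable_diff sm zv z sf v(1))
      have "(\<Sum>k. (1/2)^k * p (z + v - w k)) - (\<Sum>k. (1/2)^k * p (z - w k)) - F v = (\<Sum>k. (1/2)^k * r k)"
        unfolding eq F_def by (simp add: suminf_diff summable_diff sm zv z sf v(1))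
      also have "\<dots> = (\<Sum>k. (1/2)^(k + N) * r (k + N)) + (\<Sum>k<N. (1/2)^k * r k)"
        by (rule suminf_split_initial_segment[OF sr])
      finally have split: "(\<Sum>k. (1/2)^k * p (z + v - w k)) - (\<Sum>k. (1/2)^k * p (z - w k)) - F v
          = (\<Sum>k. (1/2)^(k + N) * r (k + N)) + (\<Sum>k<N. (1/2)^k * r k)" .
      have "\<bar>\<Sum>k. (1/2)^(k + N) * r (k + N)\<bar> \<le> e / 2 * norm v"
      proof -
        have b: "\<bar>(1/2)^(k + N) * r (k + N)\<bar> \<le> (1/2)^k * (e / 4 * norm v)" for k
        proof -
          have "\<bar>(1/2)^(k + N) * r (k + N)\<bar> = (1/2)^k * ((1/2)^N * \<bar>r (k + N)\<bar>)" by (simp add: abs_mult power_add)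
          also have "\<dots> \<le> (1/2)^k * (e / 8 * (2 * norm v))"
            using N r2 e by (intro mult_left_mono mult_mono) auto
          finally show ?thesis by simp
        qed
        show ?thesis using abs_suminf_geometric_le[of "\<lambda>k. (1/2)^(k + N) * r (k + N)", OF b] by simp
      qed
      moreover have "\<bar>\<Sum>k<N. (1/2)^k * r k\<bar> \<le> e / 2 * norm v"
      proof -
        have "\<bar>\<Sum>k<N. (1/2)^k * r k\<bar> \<le> (\<Sum>k<N. (1/2)^k * (e / 4 * norm v))"
          by (rule order_trans[OF sum_abs sum_mono])
            (use d(2)[OF v] in \<open>auto simp: abs_mult r_def intro!: divide_right_mono\<close>)
        also have "\<dots> \<le> (\<Sum>k. (1/2)^k * (e / 4 * norm v))"
          using e by (intro sum_le_suminf geo) auto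
        finally show ?thesis unfolding geo by simp
      qed
      ultimately have "\<bar>(\<Sum>k. (1/2)^(k + N) * r (k + N)) + (\<Sum>k<N. (1/2)^k * r k)\<bar> \<le> e / 2 * norm v + e / 2 * norm v"
        by (rule order_trans[OF abs_triangle_ineq add_mono])
      then show "\<bar>(\<Sum>k. (1/2)^k * p (z + v - w k)) - (\<Sum>k. (1/2)^k * p (z - w k)) - F v\<bar> \<le> e * norm v"
        unfolding split by (simp add: distrib_right[symmetric])
    qed
  qed
qed

text \<open>Decoupling: minimise \<open>h x + g x' + k * p (x - x')\<close> for large \<open>k\<close>, perturbed by the
  variational principle, in both variables.\<close>
lemma separable_fuzzy_sum_rule:
  fixes S :: "'b::banach set" and h g :: "'b \<Rightarrow> real"
  assumes Y: "subspace Y" "closed Y" and p: "smooth_gauge Y p"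
    and S: "closed S" and h: "continuous_on S h"
    and g: "convex_on UNIV g" and gL: "\<And>v w. \<bar>g v - g w\<bar> \<le> L * norm (v - w)" and L: "0 \<le> L"
    and xb: "xb \<in> S" "xb \<in> Y" and min: "\<And>x. x \<in> S \<Longrightarrow> h xb + g xb \<le> h x + g x" and \<eta>: "\<eta> > 0"
  obtains y y' f where "y \<in> S" "y \<in> Y" "y' \<in> Y" "norm (y - xb) < \<eta>" "norm (y' - xb) < \<eta>"
    "\<And>u v. u \<in> Y \<Longrightarrow> v \<in> Y \<Longrightarrow> f (u + v) = f u + f v" "\<And>c v. v \<in> Y \<Longrightarrow> f (c *\<^sub>R v) = c * f v"
    "\<exists>K. \<forall>v\<in>Y. \<bar>f v\<bar> \<le> K * norm v"
    "subgradient_on (S \<inter> Y) h y f"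
    "\<And>v. v \<in> Y \<Longrightarrow> g y' - f (v - y') - \<eta> * norm (v - y') \<le> g v"
proof -
  have p0: "p 0 = 0" and ppos: "\<And>x. x \<in> Y \<Longrightarrow> 0 \<le> p x"
    and pL: "\<And>x y. x \<in> Y \<Longrightarrow> y \<in> Y \<Longrightarrow> \<bar>p x - p y\<bar> \<le> norm (x - y)"
    and plow: "\<And>e. e > 0 \<Longrightarrow> \<exists>c>0. \<forall>y\<in>Y. e \<le> norm y \<longrightarrow> c * norm y \<le> p y"
    and pd: "\<And>y. y \<in> Y \<Longrightarrow> \<exists>f\<in>dual_ball Y. \<forall>e>0. \<exists>d>0. \<forall>v\<in>Y. norm v < d \<longrightarrow> \<bar>p (y + v) - p y - f v\<bar> \<le> e * norm v"
    using p unfolding smooth_gauge_def by blast+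
  note diffY = subspace_diff[OF Y(1)]
  obtain c\<^sub>1 where c1: "c\<^sub>1 > 0" "\<And>y. y \<in> Y \<Longrightarrow> \<eta> \<le> norm y \<Longrightarrow> c\<^sub>1 * norm y \<le> p y" using plow[OF \<eta>] by blast
  \<comment> \<open>In the second variable the perturbation uses up a slope of \<open>4 * s\<close>:
    \<open>2 * s\<close> as the Lipschitz constant of \<open>s * P'\<close>, and
    \<open>2 * s\<close> for the term \<open>s * F\<close> in the functional.\<close>
  define s where "s = \<eta> / 4"
  have s: "s > 0" using \<eta> by (simp add: s_def)
  \<comment> \<open>Decoupling lowers the infimum by at most \<open>L * \<epsilon>\<close>. As this
    is less than \<open>s * (c\<^sub>1 * \<eta>)\<close>, both variables stay within
    \<open>\<eta>\<close> of \<open>xb\<close>.\<close>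
  define \<epsilon> where "\<epsilon> = s * (c\<^sub>1 * \<eta>) / (L + 1)"
  have \<epsilon>: "\<epsilon> > 0" using s c1 \<eta> L by (simp add: \<epsilon>_def)
  have L\<epsilon>: "L * \<epsilon> < s * (c\<^sub>1 * \<eta>)"
  proof -
    have "(L + 1) * \<epsilon> = s * (c\<^sub>1 * \<eta>)" using L by (simp add: \<epsilon>_def)
    then show ?thesis using \<epsilon> by (simp add: distrib_right)
  qed
  obtain c\<^sub>2 where c2: "c\<^sub>2 > 0" "\<And>y. y \<in> Y \<Longrightarrow> \<epsilon> \<le> norm y \<Longrightarrow> c\<^sub>2 * norm y \<le> p y" using plow[OF \<epsilon>] by blast
  \<comment> \<open>With this weight the penalty outweighs the change of \<open>g\<close> between
    the two variables up to the error \<open>L * \<epsilon>\<close>.\<close>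
  define k where "k = L / c\<^sub>2"
  have k: "k \<ge> 0" using L c2 by (simp add: k_def)
  have kp: "L * norm y \<le> L * \<epsilon> + k * p y" if y: "y \<in> Y" for y
  proof (cases "\<epsilon> \<le> norm y")
    case True
    have "L * norm y = k * (c\<^sub>2 * norm y)" using c2 by (simp add: k_def)
    also have "\<dots> \<le> k * p y" using c2(2)[OF y True] k by (rule mult_left_mono)
    finally show ?thesis using L \<epsilon> by (simp add: add_increasing)
  next
    case False
    then have "L * norm y \<le> L * \<epsilon>" using L by (intro mult_left_mono) auto
    then show ?thesis using k ppos[OF y] by (simp add: add_increasing2)
  qed
  define \<Phi> where "\<Phi> x = h (fst x) + g (snd x) + k * p (fst x - snd x)" for x :: "'b \<times> 'b"
  define q where "q x = p (fst x) + p (snd x)" for x :: "'b \<times> 'b"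
  define S2 where "S2 = (S \<inter> Y) \<times> Y"
  have S2: "closed S2" unfolding S2_def using S Y by (intro closed_Times closed_Int)
  have m: "h xb + g xb - L * \<epsilon> \<le> \<Phi> x" if x: "x \<in> S2" for x
  proof -
    have "fst x \<in> S" "fst x - snd x \<in> Y" using x diffY by (auto simp: S2_def)
    then show ?thesis using min[of "fst x"] kp[of "fst x - snd x"] gL[of "fst x" "snd x"] unfolding \<Phi>_def by argo
  qed
  have cont: "continuous_on S2 \<Phi>"
  proof -
    have lip: "continuous_on A f" if "\<And>x y. x \<in> A \<Longrightarrow> y \<in> A \<Longrightarrow> \<bar>f x - f y\<bar> \<le> M * norm (x - y)" "0 \<le> M"
      for A and f :: "'b \<Rightarrow> real" and M
      using that by (intro lipschitz_on_continuous_on[of M]) (auto simp: lipschitz_on_def dist_norm dist_real_def)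
    have cf: "continuous_on S2 fst" "continuous_on S2 snd" "continuous_on S2 (\<lambda>x. fst x - snd x)"
      by (auto intro!: continuous_intros)
    have "continuous_on Y p" by (rule lip[of _ _ 1]) (use pL in auto)
    then have "continuous_on S2 (\<lambda>x. p (fst x - snd x))"
      by (rule continuous_on_compose2[OF _ cf(3)]) (use diffY in \<open>auto simp: S2_def\<close>)
    moreover have "continuous_on UNIV g" by (rule lip[of _ _ L]) (use gL L in auto)
    then have "continuous_on S2 (\<lambda>x. g (snd x))"
      by (rule continuous_on_compose2[OF _ cf(2)]) auto
    moreover have "continuous_on S2 (\<lambda>x. h (fst x))"
      by (rule continuous_on_compose2[OF h cf(1)]) (auto simp: S2_def)
    ultimately show ?thesis unfolding \<Phi>_def by (intro continuous_intros)
  qed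
  have qL: "\<bar>q (x - w) - q (y - w)\<bar> \<le> 2 * norm (x - y)" if "x \<in> S2" "y \<in> S2" "w \<in> S2" for x y w
  proof -
    have "\<bar>p (fst x - fst w) - p (fst y - fst w)\<bar> \<le> norm (fst x - fst y)"
      "\<bar>p (snd x - snd w) - p (snd y - snd w)\<bar> \<le> norm (snd x - snd y)"
      using pL[of "fst x - fst w" "fst y - fst w"] pL[of "snd x - snd w" "snd y - snd w"] that diffY
      by (auto simp: S2_def)
    moreover have "norm (fst (x - y)) \<le> norm (x - y)" "norm (snd (x - y)) \<le> norm (x - y)"
      using norm_fst_le[of "fst (x - y)" "snd (x - y)"] norm_snd_le[of "snd (x - y)" "fst (x - y)"]
      unfolding prod.collapse by blast+
    ultimately show ?thesis unfolding q_def by simp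
  qed
  have qsmall: "\<exists>d>0. \<forall>x\<in>S2. \<forall>y\<in>S2. q (x - y) < d \<longrightarrow> norm (x - y) < e" if e: "e > 0" for e
  proof -
    obtain c where c: "c > 0" "\<And>y. y \<in> Y \<Longrightarrow> e / 2 \<le> norm y \<Longrightarrow> c * norm y \<le> p y" using plow[of "e / 2"] e by auto
    have small: "norm y < e / 2" if "y \<in> Y" "p y < c * (e / 2)" for y
    proof (rule ccontr)
      assume "\<not> ?thesis"
      then have "c * (e / 2) \<le> c * norm y" "c * norm y \<le> p y" using c that by auto
      then show False using that by simp
    qed
    show ?thesis
    proof (intro exI[of _ "c * (e / 2)"] conjI ballI impI)
      fix x y assume xy: "x \<in> S2" "y \<in> S2" "q (x - y) < c * (e / 2)"
      have Y2: "fst x - fst y \<in> Y" "snd x - snd y \<in> Y" using xy diffY by (auto simp: S2_def)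
      have "p (fst x - fst y) < c * (e / 2)" "p (snd x - snd y) < c * (e / 2)"
        using xy(3) ppos[OF Y2(1)] ppos[OF Y2(2)] by (auto simp: q_def)
      then have "norm (fst x - fst y) < e / 2" "norm (snd x - snd y) < e / 2"
        using small[OF Y2(1)] small[OF Y2(2)] by blast+
      moreover have "norm (x - y) \<le> norm (fst x - fst y) + norm (snd x - snd y)"
        using norm_Pair_le[of "fst (x - y)" "snd (x - y)", unfolded prod.collapse] by simp
      ultimately show "norm (x - y) < e" by simp
    qed (use c e in auto)
  qed
  have x0: "(xb, xb) \<in> S2" using xb by (simp add: S2_def)
  have qpos: "0 \<le> q (x - y)" if "x \<in> S2" "y \<in> S2" for x y
    using that diffY ppos by (auto simp: q_def S2_def)
  have q00: "q 0 = 0" by (simp add: q_def p0)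
  obtain zz ww where zz: "zz \<in> S2" and ww: "\<And>k. ww k \<in> S2" and near: "\<Phi> zz + s * q (zz - (xb, xb)) \<le> \<Phi> (xb, xb)"
    and sm: "\<And>x. x \<in> S2 \<Longrightarrow> summable (\<lambda>k. (1/2)^k * q (x - ww k))"
    and opt: "\<And>x. x \<in> S2 \<Longrightarrow> \<Phi> zz + s * (\<Sum>k. (1/2)^k * q (zz - ww k)) \<le> \<Phi> x + s * (\<Sum>k. (1/2)^k * q (x - ww k))"
    using variational_principle[OF S2 cont x0 m s q00 qpos qL qsmall] by blast
  obtain z z' where z: "zz = (z, z')" by (cases zz)
  define w w' where "w i = fst (ww i)" and "w' i = snd (ww i)" for i
  have zY: "z \<in> S" "z \<in> Y" "z' \<in> Y" and wY: "\<And>i. w i \<in> Y" "\<And>i. w' i \<in> Y"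
    using zz ww by (auto simp: z S2_def w_def w'_def mem_Times_iff)
  have dist: "norm (z - xb) < \<eta> \<and> norm (z' - xb) < \<eta>"
  proof -
    have "s * (p (z - xb) + p (z' - xb)) \<le> L * \<epsilon>"
      using near m[OF zz] by (simp add: z \<Phi>_def q_def p0)
    then have sum: "p (z - xb) + p (z' - xb) < c\<^sub>1 * \<eta>" 
      using mult_less_cancel_left_pos[OF s, of "p (z - xb) + p (z' - xb)" "c\<^sub>1 * \<eta>"] L\<epsilon> by linarith
    have "norm y < \<eta>" if "y \<in> Y" "p y < c\<^sub>1 * \<eta>" for y
    proof (rule ccontr)
      assume "\<not> ?thesis"
      then have "c\<^sub>1 * \<eta> \<le> c\<^sub>1 * norm y" "c\<^sub>1 * norm y \<le> p y" using c1 that by auto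
      then show False using that by simp
    qed
    note small = this
    have zxY: "z - xb \<in> Y" "z' - xb \<in> Y" using zY xb diffY by auto
    have "p (z - xb) < c\<^sub>1 * \<eta>" "p (z' - xb) < c\<^sub>1 * \<eta>" using sum ppos[OF zxY(1)] ppos[OF zxY(2)] by linarith+
    then show ?thesis using small zxY by blast
  qed
  have smp: "summable (\<lambda>i. (1/2)^i * p (x - w i))" "summable (\<lambda>i. (1/2)^i * p (x - w' i))" if x: "x \<in> Y" for x
  proof -
    have b: "summable (\<lambda>i. (1/2)^i * p (v - u i))" if v: "v \<in> Y" and u: "\<And>i. u i \<in> Y" and z: "z \<in> Y"
      and sz: "summable (\<lambda>i. (1/2)^i * p (z - u i))" for u v z
    proof (rule summable_comparison_test')
      show "summable (\<lambda>i. (1/2)^i * p (z - u i) + (1/2)^i * norm (v - z))"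
        by (intro summable_add sz summable_mult2 summable_geometric) simp
      fix i :: nat
      have "p (v - u i) \<le> p (z - u i) + norm (v - z)"
        using pL[of "v - u i" "z - u i"] diffY v u z by simp
      then have "(1/2)^i * p (v - u i) \<le> (1/2)^i * (p (z - u i) + norm (v - z))" by (rule mult_left_mono) simp
      then show "norm ((1/2)^i * p (v - u i)) \<le> (1/2)^i * p (z - u i) + (1/2)^i * norm (v - z)"
        using ppos[OF diffY[OF v u]] by (simp add: distrib_left)
    qed
    have e: "(1/2)^i * q (zz - ww i) = (1/2)^i * p (z - w i) + (1/2)^i * p (z' - w' i)" for i
      by (simp add: q_def z w_def w'_def distrib_left)
    have nn: "0 \<le> p (z - w i)" "0 \<le> p (z' - w' i)" for i using ppos diffY zY wY by auto
    have "summable (\<lambda>i. (1/2)^i * p (z - w i))" "summable (\<lambda>i. (1/2)^i * p (z' - w' i))"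
      by (rule summable_comparison_test'[OF sm[OF zz]], use nn in \<open>simp add: e\<close>)+
    then show "summable (\<lambda>i. (1/2)^i * p (x - w i))" "summable (\<lambda>i. (1/2)^i * p (x - w' i))"
      using b[OF x wY(1) zY(2)] b[OF x wY(2) zY(3)] by auto
  qed
  define P P' where "P x = (\<Sum>i. (1/2)^i * p (x - w i))" and "P' x = (\<Sum>i. (1/2)^i * p (x - w' i))" for x
  have opt2: "h z + g z' + k * p (z - z') + s * (P z + P' z') \<le> h x + g x' + k * p (x - x') + s * (P x + P' x')"
    if x: "x \<in> S" "x \<in> Y" "x' \<in> Y" for x x'
  proof -
    have "(\<Sum>i. (1/2)^i * q ((x, x') - ww i)) = P x + P' x'" if "x \<in> Y" "x' \<in> Y" for x x'
      unfolding P_def P'_def suminf_add[OF smp(1)[OF that(1)] smp(2)[OF that(2)]]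
      by (simp add: q_def w_def w'_def distrib_left)
    then show ?thesis using opt[of "(x, x')"] x zY by (simp add: z \<Phi>_def S2_def)
  qed
  obtain F where F: "\<And>u v. u \<in> Y \<Longrightarrow> v \<in> Y \<Longrightarrow> F (u + v) = F u + F v" "\<And>c v. v \<in> Y \<Longrightarrow> F (c *\<^sub>R v) = c * F v"
    "\<And>v. v \<in> Y \<Longrightarrow> \<bar>F v\<bar> \<le> 2 * norm v"
    "\<And>e. e > 0 \<Longrightarrow> \<exists>d>0. \<forall>v\<in>Y. norm v < d \<longrightarrow> \<bar>P (z + v) - P z - F v\<bar> \<le> e * norm v"
    using gauge_series_derivative[OF Y(1) p wY(1) zY(2) smp(1)] unfolding P_def by blast
  have zz'Y: "z - z' \<in> Y" using diffY zY by blast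
  obtain fp where fp: "fp \<in> dual_ball Y"
    "\<And>e. e > 0 \<Longrightarrow> \<exists>d>0. \<forall>v\<in>Y. norm v < d \<longrightarrow> \<bar>p (z - z' + v) - p (z - z') - fp v\<bar> \<le> e * norm v"
    using pd[OF zz'Y] by blast
  have fpY: "fp (u + v) = fp u + fp v" "fp (c *\<^sub>R v) = c * fp v" "\<bar>fp v\<bar> \<le> norm v" if "u \<in> Y" "v \<in> Y" for u v c
    using fp(1) that by (auto simp: dual_ball_def)
  have P'L: "\<bar>P' x - P' y\<bar> \<le> 2 * norm (x - y)" if x: "x \<in> Y" "y \<in> Y" for x y
  proof -
    have "P' x \<le> P' y + 2 * norm (x - y)" if x: "x \<in> Y" "y \<in> Y" for x y
    proof -
      have geo: "summable (\<lambda>i. (1/2::real)^i * norm (x - y))" "(\<Sum>i. (1/2::real)^i * norm (x - y)) = 2 * norm (x - y)"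
        by (auto intro!: summable_mult2 summable_geometric simp: suminf_mult2[symmetric] suminf_geometric)
      have "(1/2)^i * p (x - w' i) \<le> (1/2)^i * p (y - w' i) + (1/2)^i * norm (x - y)" for i
      proof -
        have "p (x - w' i) \<le> p (y - w' i) + norm (x - y)" using pL[of "x - w' i" "y - w' i"] diffY x wY by simp
        then have "(1/2)^i * p (x - w' i) \<le> (1/2)^i * (p (y - w' i) + norm (x - y))" by (rule mult_left_mono) simp
        then show ?thesis by (simp add: distrib_left)
      qed
      then have "P' x \<le> (\<Sum>i. (1/2)^i * p (y - w' i) + (1/2)^i * norm (x - y))"
        unfolding P'_def by (intro suminf_le smp x summable_add geo)
      also have "\<dots> = P' y + 2 * norm (x - y)"
        unfolding P'_def using suminf_add[OF smp(2)[OF x(2)] geo(1)] geo(2) by simp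
      finally show ?thesis .
    qed
    from this[OF x] this[OF x(2,1)] show ?thesis by (simp add: abs_le_iff norm_minus_commute)
  qed
  \<comment> \<open>The negative derivative at \<open>z\<close> of the penalty and of the
    perturbation in the first variable; minimality in that variable makes it a subgradient of
    \<open>h\<close>.\<close>
  define f where "f v = - k * fp v - s * F v" for v
  show ?thesis
  proof (rule that[of z z' f])
    show "f (u + v) = f u + f v" if "u \<in> Y" "v \<in> Y" for u v
      using fpY(1)[OF that] F(1)[OF that] by (simp add: f_def algebra_simps)
    show "f (c *\<^sub>R v) = c * f v" if "v \<in> Y" for c v
      using fpY(2)[OF that that] F(2)[OF that] by (simp add: f_def algebra_simps)
    show "\<exists>K. \<forall>v\<in>Y. \<bar>f v\<bar> \<le> K * norm v"
    proof (intro exI[of _ "k + s * 2"] ballI)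
      fix v assume v: "v \<in> Y"
      have "\<bar>f v\<bar> \<le> k * \<bar>fp v\<bar> + s * \<bar>F v\<bar>"
        using abs_triangle_ineq4[of "- k * fp v" "s * F v"] k s by (simp add: f_def abs_mult)
      also have "\<dots> \<le> k * norm v + s * (2 * norm v)"
        using fpY(3)[OF v v] F(3)[OF v] k s by (intro add_mono mult_left_mono) auto
      finally show "\<bar>f v\<bar> \<le> (k + s * 2) * norm v" by (simp add: algebra_simps)
    qed
    show "subgradient_on (S \<inter> Y) h z f"
      unfolding subgradient_on_def
    proof (intro allI impI)
      fix e :: real assume e: "e > 0"
      define e' where "e' = e / (k + s)"
      have ks: "k + s > 0" using k s by simp
      have e': "e' > 0" using e ks by (simp add: e'_def)
      obtain d where d: "d > 0" "\<And>v. v \<in> Y \<Longrightarrow> norm v < d \<Longrightarrow> \<bar>P (z + v) - P z - F v\<bar> \<le> e' * norm v" using F(4)[OF e'] by blast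
      obtain d' where d': "d' > 0" "\<And>v. v \<in> Y \<Longrightarrow> norm v < d' \<Longrightarrow> \<bar>p (z - z' + v) - p (z - z') - fp v\<bar> \<le> e' * norm v" using fp(2)[OF e'] by blast
      show "\<exists>d>0. \<forall>v\<in>S \<inter> Y. norm (v - z) < d \<longrightarrow> h z + f (v - z) - e * norm (v - z) \<le> h v"
      proof (intro exI[of _ "min d d'"] conjI ballI impI)
        fix v assume v: "v \<in> S \<inter> Y" "norm (v - z) < min d d'"
        have vz: "v - z \<in> Y" using diffY v zY by blast
        have "P v - P z - F (v - z) \<le> e' * norm (v - z)" using d(2)[OF vz] v by auto
        then have 1: "s * (P v - P z - F (v - z)) \<le> s * (e' * norm (v - z))" using s by (intro mult_left_mono) auto
        have "p (v - z') - p (z - z') - fp (v - z) \<le> e' * norm (v - z)" using d'(2)[OF vz] v by auto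
        then have 2: "k * (p (v - z') - p (z - z') - fp (v - z)) \<le> k * (e' * norm (v - z))" using k by (intro mult_left_mono) auto
        have 3: "h z + g z' + k * p (z - z') + s * (P z + P' z') \<le> h v + g z' + k * p (v - z') + s * (P v + P' z')"
          using opt2 v zY by blast
        have "e * norm (v - z) = k * (e' * norm (v - z)) + s * (e' * norm (v - z))"
        proof -
          have "e = (k + s) * e'" using ks by (simp add: e'_def)
          then show ?thesis by (simp add: distrib_right mult.assoc)
        qed
        then show "h z + f (v - z) - e * norm (v - z) \<le> h v"
          using 1 2 3 unfolding f_def by (simp add: algebra_simps)
      qed (use d d' in auto)
    qed
    fix v assume v: "v \<in> Y"
    define u where "u = v - z'"
    have uY: "u \<in> Y" "- u \<in> Y" unfolding u_def using v zY diffY subspace_neg[OF Y(1)] by auto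
    have key: "k * fp u - 2 * s * norm u - e * norm u \<le> g v - g z'" if e: "e > 0" for e
    proof -
      have e': "e / (k + 1) > 0" using e k by simp
      obtain d where d: "d > 0" "\<And>v. v \<in> Y \<Longrightarrow> norm v < d \<Longrightarrow>
        \<bar>p (z - z' + v) - p (z - z') - fp v\<bar> \<le> e / (k + 1) * norm v" using fp(2)[OF e'] by blast
      \<comment> \<open>A step on the segment from \<open>z'\<close> to \<open>v\<close> short
        enough for the expansion of \<open>p\<close>. Convexity of \<open>g\<close> then turns the
        inequality at this near point into one at \<open>v\<close>.\<close>
      define t where "t = min 1 (d / (2 * (norm u + 1)))"
      have n1: "norm u + 1 > 0" by (simp add: add_nonneg_pos)
      have t: "0 < t" "t \<le> 1" using d(1) n1 by (auto simp: t_def)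
      have "t * norm u \<le> d / (2 * (norm u + 1)) * (norm u + 1)"
        by (intro mult_mono) (use d(1) n1 in \<open>auto simp: t_def\<close>)
      also have "\<dots> = d / 2"
      proof -
        have "d / (2 * N) * N = d / 2" if "N > 0" for N :: real using that by simp
        then show ?thesis using n1 .
      qed
      finally have tu: "norm (t *\<^sub>R (- u)) < d" using d(1) t by simp
      have tuY: "t *\<^sub>R (- u) \<in> Y" "t *\<^sub>R u \<in> Y" 
        using subspace_scale[OF Y(1) uY(2)] subspace_scale[OF Y(1) uY(1)] by blast+
      have eq: "z - z' + t *\<^sub>R (- u) = z - (z' + t *\<^sub>R u)" by simp
      have "p (z - (z' + t *\<^sub>R u)) - p (z - z') \<le> fp (t *\<^sub>R (- u)) + e / (k + 1) * norm (t *\<^sub>R (- u))"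
        using abs_le_D1[OF d(2)[OF tuY(1) tu]] unfolding eq by linarith
      also have "fp (t *\<^sub>R (- u)) = - t * fp u" using fpY(2)[OF uY(1) uY(1), of "- t"] by simp
      finally have 1: "p (z - (z' + t *\<^sub>R u)) - p (z - z') \<le> - t * fp u + e / (k + 1) * (t * norm u)" using t by simp
      have "k * (e / (k + 1)) \<le> (k + 1) * (e / (k + 1))" using e' by (intro mult_right_mono) auto
      also have "\<dots> = e" using k by simp
      finally have "k * (e / (k + 1)) \<le> e" .
      then have "k * (e / (k + 1)) * (t * norm u) \<le> e * (t * norm u)" using t by (intro mult_right_mono) auto
      then have 2: "k * (p (z - (z' + t *\<^sub>R u)) - p (z - z')) \<le> - k * (t * fp u) + e * (t * norm u)"
        using mult_left_mono[OF 1 k] by (simp add: algebra_simps)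
      have z'tY: "z' + t *\<^sub>R u \<in> Y" using zY tuY subspace_add[OF Y(1)] by auto
      have "\<bar>P' (z' + t *\<^sub>R u) - P' z'\<bar> \<le> 2 * (t * norm u)" using P'L[OF z'tY zY(3)] t by simp
      then have 3: "s * (P' (z' + t *\<^sub>R u) - P' z') \<le> s * (2 * (t * norm u))" using s by (intro mult_left_mono) auto
      have 4: "h z + g z' + k * p (z - z') + s * (P z + P' z')
          \<le> h z + g (z' + t *\<^sub>R u) + k * p (z - (z' + t *\<^sub>R u)) + s * (P z + P' (z' + t *\<^sub>R u))"
        using opt2[OF zY(1,2) z'tY] .
      have "z' + t *\<^sub>R u = (1 - t) *\<^sub>R z' + t *\<^sub>R v" by (simp add: u_def algebra_simps)
      then have 5: "g (z' + t *\<^sub>R u) \<le> (1 - t) * g z' + t * g v"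
        using convex_onD[OF g, of t z' v] t by simp
      have "t * (k * fp u - 2 * s * norm u - e * norm u) \<le> t * (g v - g z')"
        using 2 3 4 5 by (simp add: algebra_simps)
      then show ?thesis using t by simp
    qed
    have "k * fp u - 2 * s * norm u \<le> g v - g z'"
    proof (rule field_le_epsilon)
      fix e :: real assume e: "e > 0"
      have n1: "norm u + 1 > 0" by (simp add: add_nonneg_pos)
      have "e / (norm u + 1) * norm u \<le> e" using e n1 by (simp add: field_simps)
      then show "k * fp u - 2 * s * norm u \<le> g v - g z' + e"
        using key[of "e / (norm u + 1)"] e n1 by simp
    qed
    moreover have "s * F u \<le> s * (2 * norm u)"
      using F(3)[OF uY(1)] s by (intro mult_left_mono) auto
    ultimately show "g z' - f (v - z') - \<eta> * norm (v - z') \<le> g v"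
      unfolding f_def u_def[symmetric] s_def by (simp add: algebra_simps)
  qed (use zY dist in auto)
qed

text \<open>Within the radius \<open>d\<close> the linear part of the modulus suffices. Beyond it
  the defect is at most \<open>M * t\<close> by the linear bounds. There the steep part is at least
  \<open>C * (C * t / 2)\<close> because of \<open>C \<ge> 2 / d\<close>, and this dominates
  \<open>M * t\<close> because of \<open>C \<ge> 1\<close> and \<open>C \<ge> 2 * M\<close>.\<close>

lemma subgradient_modulus:
  assumes h: "subgradient_on S h y f" and fK: "\<And>v. v \<in> S \<Longrightarrow> f (v - y) \<le> K * norm (v - y)"
    and low: "\<And>v. v \<in> S \<Longrightarrow> h y - A - B * norm (v - y) \<le> h v"
  obtains C where "\<And>v. v \<in> S \<Longrightarrow> f (v - y) \<le> h v - h y + modulus C m (norm (v - y))"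
proof -
  obtain d where d: "d > 0" "\<And>v. v \<in> S \<Longrightarrow> norm (v - y) < d \<Longrightarrow>
      h y + f (v - y) - 1 / (real m + 1) * norm (v - y) \<le> h v"
    using h[unfolded subgradient_on_def, rule_format, of "1 / (real m + 1)"] by auto
  define M where "M = \<bar>A\<bar> / d + \<bar>B\<bar> + \<bar>K\<bar>"
  have M: "M \<ge> 0" using d(1) by (simp add: M_def)
  obtain C :: nat where C: "real C \<ge> 1 + 2 / d + 2 * M" using real_arch_simple by blast
  have C': "real C \<ge> 1" "real C \<ge> 2 / d" "real C \<ge> 2 * M" 
  proof -
    have "2 / d \<ge> 0" using d(1) by simp
    then show "real C \<ge> 1" "real C \<ge> 2 / d" "real C \<ge> 2 * M" using C M by linarith+
  qed
  show ?thesis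
  proof (rule that[of C])
    fix v assume v: "v \<in> S"
    define t where "t = norm (v - y)"
    show "f (v - y) \<le> h v - h y + modulus C m (norm (v - y))"
    proof (cases "t < d")
      case True
      have "0 \<le> real C * max 0 (real C * t - 1)" by simp
      moreover have "h y + f (v - y) - t / (real m + 1) \<le> h v" using d(2)[OF v] True by (simp add: t_def)
      ultimately show ?thesis unfolding modulus_def t_def[symmetric] by linarith
    next
      case False
      have t: "t \<ge> d" "t > 0" using False d(1) by auto
      have "2 \<le> real C * d" using C'(2) d(1) by (simp add: divide_le_eq)
      also have "\<dots> \<le> real C * t" using t by (intro mult_left_mono) auto
      finally have "real C * t / 2 \<le> real C * t - 1" by argo
      also have "\<dots> \<le> max 0 (real C * t - 1)" by (rule max.cobounded2)
      finally have "real C * t / 2 \<le> max 0 (real C * t - 1)" .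
      then have "real C * (real C * t / 2) \<le> real C * max 0 (real C * t - 1)" by (rule mult_left_mono) simp
      moreover have "M * t \<le> real C * (real C * t / 2)"
      proof -
        have "M * t \<le> real C / 2 * t" using C'(3) t by (intro mult_right_mono) auto
        also have "\<dots> \<le> real C * (real C / 2 * t)" using C'(1) t mult_right_mono[of 1 "real C" "real C / 2 * t"] by simp
        also have "\<dots> = real C * (real C * t / 2)" by simp
        finally show ?thesis .
      qed
      moreover have "A + B * t + K * t \<le> M * t"
      proof -
        have "A \<le> \<bar>A\<bar> / d * t" using t d(1) mult_left_mono[of d t "\<bar>A\<bar> / d"] by simp
        moreover have "B * t \<le> \<bar>B\<bar> * t" "K * t \<le> \<bar>K\<bar> * t" using t by (auto intro!: mult_right_mono)
        ultimately show ?thesis unfolding M_def by (simp add: distrib_right)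
      qed
      moreover have "0 \<le> t / (real m + 1)" using t by simp
      ultimately show ?thesis using fK[OF v] low[OF v] unfolding modulus_def t_def[symmetric] by linarith
    qed
  qed
qed

text \<open>On the ball of radius \<open>1 / (c m + 1)\<close> the steep part of the modulus
  vanishes, and the remaining slope \<open>1 / (m + 1)\<close> is below any given \<open>e\<close>
  for suitable \<open>m\<close>.\<close>

lemma modulus_subgradient:
  assumes "\<And>v m. v \<in> S \<Longrightarrow> f (v - y) \<le> h v - h y + modulus (c m) m (norm (v - y))"
  shows "subgradient_on S h y f"
  unfolding subgradient_on_def
proof (intro allI impI)
  fix e :: real assume "e > 0"
  then obtain m where m: "inverse (real (Suc m)) < e" using reals_Archimedean by blast
  show "\<exists>d>0. \<forall>v\<in>S. norm (v - y) < d \<longrightarrow> h y + f (v - y) - e * norm (v - y) \<le> h v"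
  proof (intro exI[of _ "1 / (real (c m) + 1)"] conjI ballI impI)
    fix v assume v: "v \<in> S" "norm (v - y) < 1 / (real (c m) + 1)"
    have "real (c m) * norm (v - y) \<le> (real (c m) + 1) * norm (v - y)" by (intro mult_right_mono) auto
    also have "\<dots> \<le> 1" using v(2) by (simp add: field_simps)
    finally have "modulus (c m) m (norm (v - y)) = inverse (real (Suc m)) * norm (v - y)"
      by (simp add: modulus_def divide_inverse mult.commute add.commute)
    also have "\<dots> \<le> e * norm (v - y)" using m by (intro mult_right_mono) auto
    finally show "h y + f (v - y) - e * norm (v - y) \<le> h v" using assms[OF v(1), of m] by linarith
  qed simp
qed

lemma linear_on_subspace_sum:
  fixes f :: "'a::real_vector \<Rightarrow> real"
  assumes Y: "subspace Y" and add: "\<And>u v. u \<in> Y \<Longrightarrow> v \<in> Y \<Longrightarrow> f (u + v) = f u + f v"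
    and scale: "\<And>c v. v \<in> Y \<Longrightarrow> f (c *\<^sub>R v) = c * f v" and x: "\<And>p. p \<in> W \<Longrightarrow> x p \<in> Y"
  shows "f (\<Sum>p\<in>W. l p *\<^sub>R x p) = (\<Sum>p\<in>W. l p * f (x p))"
  using x
proof (induction W rule: infinite_finite_induct)
  case (insert p W)
  have "(\<Sum>p\<in>W. l p *\<^sub>R x p) \<in> Y" using insert Y by (intro subspace_sum subspace_scale) auto
  then show ?case using insert add[of "l p *\<^sub>R x p"] scale[of "x p"] subspace_scale[OF Y] by simp
qed (use scale[OF subspace_0[OF Y], of 0] in auto)

text \<open>Gauges are assumed for separable closed subspaces of \<open>V\<close> only, so the
  ambient space may be larger than the one with good duals. The functional found on the separable
  subspace serves merely to show that gaps are nonnegative there; after the transfer to all of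
  \<open>S\<close>, \<open>sandwich\<close> produces a new functional, which need not extend
  it.\<close>

theorem fuzzy_sum_rule:
  fixes S :: "'b::banach set" and h g :: "'b \<Rightarrow> real"
  assumes V: "subspace V" "closed V" "S \<subseteq> V"
    and gauge: "\<And>C. countable C \<Longrightarrow> subspace (closure C) \<Longrightarrow> closure C \<subseteq> V \<Longrightarrow> \<exists>p. smooth_gauge (closure C) p"
    and S: "closed S" and h: "continuous_on S h"
    and g: "convex_on UNIV g" and gL: "\<And>v w. \<bar>g v - g w\<bar> \<le> L * norm (v - w)"
    and xb: "xb \<in> S" and min: "\<And>x. x \<in> S \<Longrightarrow> h xb + g xb \<le> h x + g x" and \<eta>: "\<eta> > 0"
  obtains y y' and f :: "'b \<Rightarrow>\<^sub>L real" where "y \<in> S" "y' \<in> V" "norm (y - xb) < \<eta>" "norm (y' - xb) < \<eta>"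
    "subgradient_on S h y (blinfun_apply f)"
    "\<And>v. g y' - blinfun_apply f (v - y') - \<eta> * norm (v - y') \<le> g v"
proof -
  have gL: "\<bar>g v - g w\<bar> \<le> \<bar>L\<bar> * norm (v - w)" for v w
    using gL[of v w] mult_right_mono[OF abs_ge_self[of L] norm_ge_zero[of "v - w"]] by linarith
  obtain C where C: "countable C" "xb \<in> C" "subspace (closure C)" "closure C \<subseteq> V"
    and red: "\<And>y y' a c W l. y \<in> closure C \<Longrightarrow> y' \<in> closure C \<Longrightarrow>
       (\<And>W l. convex_weights ((S \<inter> closure C) \<times> UNIV) W l \<Longrightarrow> 0 \<le> gap h g \<eta> y y' a c W l) \<Longrightarrow>
       convex_weights (S \<times> UNIV) W l \<Longrightarrow> 0 \<le> gap h g \<eta> y y' a c W l"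
  proof -
    have "0 \<le> \<eta>" "0 \<le> \<bar>L\<bar>" "xb \<in> V" using \<eta> xb V by auto
    from separable_reduction[OF gL this(1,2) V this(3), where h = h] that show thesis by blast
  qed
  define Y where "Y = closure C"
  obtain p where p: "smooth_gauge Y p" using gauge[OF C(1,3,4)] unfolding Y_def by blast
  have Y: "subspace Y" "closed Y" "xb \<in> Y" using C closure_subset unfolding Y_def by auto
  obtain y y' f where y: "y \<in> S" "y \<in> Y" "y' \<in> Y" "norm (y - xb) < \<eta>" "norm (y' - xb) < \<eta>"
    and f: "\<And>u v. u \<in> Y \<Longrightarrow> v \<in> Y \<Longrightarrow> f (u + v) = f u + f v" "\<And>c v. v \<in> Y \<Longrightarrow> f (c *\<^sub>R v) = c * f v"
    and fK: "\<exists>K. \<forall>v\<in>Y. \<bar>f v\<bar> \<le> K * norm v"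
    and sub: "subgradient_on (S \<inter> Y) h y f"
    and conv: "\<And>v. v \<in> Y \<Longrightarrow> g y' - f (v - y') - \<eta> * norm (v - y') \<le> g v"
    using separable_fuzzy_sum_rule[OF Y(1,2) p S h g gL abs_ge_zero xb Y(3) min \<eta>] by blast
  obtain K where K: "\<And>v. v \<in> Y \<Longrightarrow> \<bar>f v\<bar> \<le> K * norm v" using fK by blast
  have "\<exists>C. \<forall>v\<in>S \<inter> Y. f (v - y) \<le> h v - h y + modulus C m (norm (v - y))" for m
  proof -
    have 1: "f (v - y) \<le> K * norm (v - y)" if "v \<in> S \<inter> Y" for v
      using K[of "v - y"] that y(2) subspace_diff[OF Y(1)] by (simp add: abs_le_iff)
    \<comment> \<open>Minimality of \<open>xb\<close> and the Lipschitz property of \<open>g\<close>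
      bound \<open>h\<close> from below by a linear function of the distance to
      \<open>y\<close>.\<close>
    have 2: "h y - (h y + g y - h xb - g xb) - \<bar>L\<bar> * norm (v - y) \<le> h v" if "v \<in> S \<inter> Y" for v
      using min[of v] that gL[of v y] by auto
    obtain C where "\<And>v. v \<in> S \<inter> Y \<Longrightarrow> f (v - y) \<le> h v - h y + modulus C m (norm (v - y))"
      using subgradient_modulus[OF sub 1 2] by blast
    then show ?thesis by blast
  qed
  then have "\<exists>c. \<forall>m. \<forall>v\<in>S \<inter> Y. f (v - y) \<le> h v - h y + modulus (c m) m (norm (v - y))"
    by (intro choice allI)
  then obtain c where c: "\<And>m v. v \<in> S \<inter> Y \<Longrightarrow> f (v - y) \<le> h v - h y + modulus (c m) m (norm (v - y))" by blast
  have gapY: "0 \<le> gap h g \<eta> y y' (h y) c W l" if W: "convex_weights ((S \<inter> Y) \<times> UNIV) W l" for W l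
  proof -
    define v where "v = (\<Sum>p\<in>W. l p *\<^sub>R (fst p - y))"
    have WY: "fst p \<in> S \<inter> Y" "fst p - y \<in> Y" "0 \<le> l p" if "p \<in> W" for p
      using W that y(2) subspace_diff[OF Y(1)] by (auto simp: convex_weights_def)
    have vY: "v \<in> Y" unfolding v_def using WY Y(1) by (intro subspace_sum subspace_scale) auto
    have "f v = (\<Sum>p\<in>W. l p * f (fst p - y))"
      unfolding v_def by (rule linear_on_subspace_sum[OF Y(1) f]) (use WY in auto)
    also have "\<dots> \<le> (\<Sum>p\<in>W. l p * (h (fst p) - h y + modulus (c (snd p)) (snd p) (norm (fst p - y))))"
      using WY c by (intro sum_mono mult_left_mono) auto
    finally show ?thesis
      using conv[of "y' + v"] vY y(3) subspace_add[OF Y(1)] unfolding gap_def v_def[symmetric] by simp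
  qed
  have gapV: "0 \<le> gap h g \<eta> y y' (h y) c W l" if "convex_weights (S \<times> UNIV) W l" for W l
    using red[of y y' "h y" c W l] y gapY that unfolding Y_def by blast
  \<comment> \<open>Data for \<open>sandwich\<close>: its first conclusion becomes the family of
    modulus inequalities at \<open>y\<close>, its second the \<open>\<eta>\<close>-subgradient
    inequality for \<open>g\<close> at \<open>y'\<close>. The pair \<open>(y, 0)\<close> is the base
    point, as the modulus vanishes at 0.\<close>
  define pt where "pt p = fst p - y" for p :: "'b \<times> nat"
  define val where "val p = h (fst p) - h y + modulus (c (snd p)) (snd p) (norm (fst p - y))" for p
  define G where "G v = g (y' + v) - g y' + \<eta> * norm v" for v
  have G: "convex_on UNIV G"
  proof (rule convex_onI)
    fix t :: real and v w assume t: "0 < t" "t < 1"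
    have "y' + ((1 - t) *\<^sub>R v + t *\<^sub>R w) = (1 - t) *\<^sub>R (y' + v) + t *\<^sub>R (y' + w)" by (simp add: algebra_simps)
    then have 1: "g (y' + ((1 - t) *\<^sub>R v + t *\<^sub>R w)) \<le> (1 - t) * g (y' + v) + t * g (y' + w)"
      using convex_onD[OF g, of t "y' + v" "y' + w"] t by simp
    have "norm ((1 - t) *\<^sub>R v + t *\<^sub>R w) \<le> (1 - t) * norm v + t * norm w"
      using norm_triangle_ineq[of "(1 - t) *\<^sub>R v" "t *\<^sub>R w"] t by simp
    then have "\<eta> * norm ((1 - t) *\<^sub>R v + t *\<^sub>R w) \<le> \<eta> * ((1 - t) * norm v + t * norm w)"
      using \<eta> by (intro mult_left_mono) auto
    then show "G ((1 - t) *\<^sub>R v + t *\<^sub>R w) \<le> (1 - t) * G v + t * G w"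
      using 1 unfolding G_def by (simp add: algebra_simps)
  qed simp
  have GL: "\<bar>G v - G w\<bar> \<le> (\<bar>L\<bar> + \<eta>) * norm (v - w)" for v w
  proof -
    have "\<bar>g (y' + v) - g (y' + w)\<bar> \<le> \<bar>L\<bar> * norm (v - w)" using gL[of "y' + v" "y' + w"] by simp
    moreover have "\<bar>\<eta> * norm v - \<eta> * norm w\<bar> \<le> \<eta> * norm (v - w)"
      using mult_left_mono[OF norm_triangle_ineq3[of v w], of \<eta>] \<eta> by (simp add: right_diff_distrib[symmetric] abs_mult)
    ultimately show ?thesis unfolding G_def distrib_right by linarith
  qed
  have "\<exists>F :: 'b \<Rightarrow>\<^sub>L real. (\<forall>p\<in>S \<times> UNIV. blinfun_apply F (pt p) \<le> val p) \<and> (\<forall>v. - blinfun_apply F v \<le> G v)"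
  proof (rule sandwich[OF G GL, of "(y, 0)" "S \<times> UNIV" pt val])
    show "G 0 = 0" "(y, 0) \<in> S \<times> UNIV" "pt (y, 0) = 0" "val (y, 0) = 0"
      using y by (auto simp: G_def pt_def val_def modulus_def)
    fix W and l :: "'b \<times> nat \<Rightarrow> real"
    assume "finite W" "W \<subseteq> S \<times> UNIV" "\<And>p. p \<in> W \<Longrightarrow> 0 \<le> l p" "sum l W = 1"
    then show "0 \<le> (\<Sum>p\<in>W. l p * val p) + G (\<Sum>p\<in>W. l p *\<^sub>R pt p)"
      using gapV[of W l] unfolding convex_weights_def gap_def G_def pt_def val_def by blast
  qed blast
  then obtain F :: "'b \<Rightarrow>\<^sub>L real" where F: "\<And>p. p \<in> S \<times> UNIV \<Longrightarrow> blinfun_apply F (pt p) \<le> val p"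
    "\<And>v. - blinfun_apply F v \<le> G v" by blast
  show ?thesis
  proof (rule that[of y y' F])
    show "subgradient_on S h y (blinfun_apply F)"
      by (rule modulus_subgradient[of _ _ _ _ c]) (use F(1) in \<open>auto simp: pt_def val_def\<close>)
    show "g y' - blinfun_apply F (v - y') - \<eta> * norm (v - y') \<le> g v" for v
      using F(2)[of "v - y'"] by (simp add: G_def)
  qed (use y C(4) in \<open>auto simp: Y_def\<close>)
qed

section \<open>Finite families of vectors\<close>

lemma countable_dense_in_span:
  fixes X :: "'a::real_normed_vector set"
  assumes X: "countable X"
  obtains C where "countable C" "X \<subseteq> C" "C \<subseteq> span X" "subspace (closure C)" "span X \<subseteq> closure C"
proof -
  obtain C where C: "countable C" "insert 0 X \<subseteq> C" "C \<subseteq> span X"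
    "\<And>x y rs. x \<in> C \<Longrightarrow> y \<in> C \<Longrightarrow> {real_of_rat (fst rs) *\<^sub>R x + real_of_rat (snd rs) *\<^sub>R y} \<subseteq> C"
  proof (rule countable_closure[where F = "\<lambda>x y rs. {real_of_rat (fst rs) *\<^sub>R x + real_of_rat (snd rs) *\<^sub>R y}"])
    show "countable {real_of_rat (fst rs) *\<^sub>R x + real_of_rat (snd rs) *\<^sub>R y}" for x y :: 'a and rs :: "rat \<times> rat"
      by simp
    show "insert 0 X \<subseteq> span X" using span_superset[of X] span_zero by auto
    show "{real_of_rat (fst rs) *\<^sub>R x + real_of_rat (snd rs) *\<^sub>R y} \<subseteq> span X"
      if "x \<in> span X" "y \<in> span X" for x y and rs :: "rat \<times> rat"
      using that by (simp add: span_add span_scale)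
  qed (use X in \<open>auto intro: that\<close>)
  have sub: "subspace (closure C)"
  proof (rule subspace_closure_rational)
    show "C \<noteq> {}" using C(2) by blast
    show "real_of_rat r *\<^sub>R x + real_of_rat s *\<^sub>R y \<in> C" if "x \<in> C" "y \<in> C" for x y r s
      using C(4)[OF that, of "(r, s)"] by simp
  qed
  have "X \<subseteq> closure C" using C(2) closure_subset by blast
  then have "span X \<subseteq> closure C" using sub by (rule span_minimal)
  then show ?thesis using that[OF C(1) _ C(3) sub] C(2) by blast
qed

lemma separable_space_subtopologyI:
  assumes "countable C" "C \<subseteq> Y" "Y \<subseteq> closure C"
  shows "separable_space (top_of_set Y)"
  unfolding separable_space_def
proof (intro exI[of _ C] conjI)
  have "Y \<inter> C = C" using assms(2) by blast
  then show "top_of_set Y closure_of C = topspace (top_of_set Y)"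
    using assms(3) by (auto simp: closure_of_subtopology)
qed (use assms in auto)

section \<open>Finite powers inside a Banach space of bounded sequences\<close>

text \<open>Spaces of bounded continuous functions are known to be complete over metric index types only.\<close>
instantiation nat :: metric_space
begin

definition dist_nat :: "nat \<Rightarrow> nat \<Rightarrow> real" where
  "dist_nat m n = (if m = n then 0 else 1)"

definition uniformity_nat :: "(nat \<times> nat) filter" where
  "uniformity_nat = (INF e\<in>{0<..}. principal {(x, y). dist x y < e})"

instance
proof
  fix U :: "nat set"
  have "eventually (\<lambda>(x', y). x' = x \<longrightarrow> y \<in> U) (INF e\<in>{0<..}. principal {(x, y). dist x y < e})" if "x \<in> U" for x
    by (rule eventually_INF1[of 1]) (use that in \<open>auto simp: eventually_principal dist_nat_def split: if_splits\<close>)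
  then show "open U \<longleftrightarrow> (\<forall>x\<in>U. eventually (\<lambda>(x', y). x' = x \<longrightarrow> y \<in> U) uniformity)"
    unfolding uniformity_nat_def by (simp add: open_discrete)
qed (auto simp: uniformity_nat_def dist_nat_def)

end

instance bcontfun :: (metric_space, banach) banach ..

text \<open>The power \<open>'a^n\<close> with the maximum norm, as a closed subspace of a Banach space that does not
  depend on \<open>n\<close>.\<close>
definition fin_space :: "nat \<Rightarrow> (nat \<Rightarrow>\<^sub>C 'a::real_normed_vector) set" where
  "fin_space n = {z. \<forall>k\<ge>n. apply_bcontfun z k = 0}"

definition fin_vec :: "nat \<Rightarrow> (nat \<Rightarrow> 'a) \<Rightarrow> (nat \<Rightarrow>\<^sub>C 'a::real_normed_vector)" where
  "fin_vec n x = Bcontfun (\<lambda>k. if k < n then x k else 0)"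

lemma apply_fin_vec [simp]: "apply_bcontfun (fin_vec n x) k = (if k < n then x k else 0)"
proof -
  have "(\<lambda>k. if k < n then x k else 0) \<in> bcontfun"
  proof (rule bcontfun_normI)
    show "norm (if k < n then x k else 0) \<le> (\<Sum>k<n. norm (x k))" for k
      by (auto intro: member_le_sum sum_nonneg)
  qed simp
  then show ?thesis by (simp add: fin_vec_def Bcontfun_inverse)
qed

lemma fin_vec_in [simp]: "fin_vec n x \<in> fin_space n"
  by (simp add: fin_space_def)

lemma subspace_fin_space: "subspace (fin_space n)"
  by (auto simp: subspace_def fin_space_def)

lemma bounded_linear_apply_bcontfun: "bounded_linear (\<lambda>z :: nat \<Rightarrow>\<^sub>C 'a::real_normed_vector. apply_bcontfun z k)"
  by (rule bounded_linear_intro[where K = 1]) (auto simp: norm_bounded)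

lemma closed_fin_space: "closed (fin_space n)"
proof -
  have "fin_space n = (\<Inter>k\<in>{n..}. {z :: nat \<Rightarrow>\<^sub>C 'a. apply_bcontfun z k = 0})"
    by (auto simp: fin_space_def)
  also have "closed \<dots>"
    by (intro closed_INT ballI closed_Collect_eq continuous_on_const
        linear_continuous_on bounded_linear_apply_bcontfun)
  finally show ?thesis .
qed

lemma norm_fin_space_attained:
  assumes z: "z \<in> fin_space n" and pos: "0 < norm z"
  obtains k where "k < n" "norm z \<le> norm (apply_bcontfun z k)"
proof -
  have "\<exists>k<n. norm z \<le> norm (apply_bcontfun z k)"
  proof (rule ccontr)
    assume neg: "\<not> ?thesis"
    define M where "M = Max (insert 0 ((\<lambda>k. norm (apply_bcontfun z k)) ` {..<n}))"
    have "M < norm z" unfolding M_def using neg pos by (subst Max_less_iff) auto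
    moreover have "norm z \<le> M"
    proof (rule norm_bound)
      fix k show "norm (apply_bcontfun z k) \<le> M"
        unfolding M_def using z by (cases "k < n") (auto simp: fin_space_def intro!: Max_ge)
    qed
    ultimately show False by simp
  qed
  then show ?thesis using that by blast
qed

lemma norm_fin_space_le:
  assumes "z \<in> fin_space n" "\<And>k. k < n \<Longrightarrow> norm (apply_bcontfun z k) \<le> b" "0 \<le> b"
  shows "norm z \<le> b"
proof (rule norm_bound)
  fix k show "norm (apply_bcontfun z k) \<le> b"
    using assms by (cases "k < n") (auto simp: fin_space_def)
qed

text \<open>All coordinates of points of \<open>C\<close> lie in one separable closed subspace of
  \<open>'a\<close>. The average of its gauge over the coordinates is a gauge on the power; the
  growth condition holds because the maximum norm is attained in some coordinate.\<close>

lemma smooth_gauge_fin_space: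
  fixes C :: "(nat \<Rightarrow>\<^sub>C 'a::banach) set"
  assumes asplund: "asplund_space TYPE('a)"
    and C: "countable C" "subspace (closure C)" "closure C \<subseteq> fin_space n"
  shows "\<exists>p. smooth_gauge (closure C) p"
proof -
  define D where "D = (\<Union>k<n. (\<lambda>z. apply_bcontfun z k) ` C)"
  have "countable D" unfolding D_def using C(1) by auto
  then obtain E where E: "countable E" "D \<subseteq> E" "subspace (closure E)" using countable_dense_in_span by metis
  have "separable_space (top_of_set (closure E))"
    using E(1) closure_subset by (intro separable_space_subtopologyI[of E]) auto
  then have "separable_dual_on (closure E)" using asplund E(3) by (simp add: asplund_space_def)
  then obtain p where p: "smooth_gauge (closure E) p"
    using smooth_gauge_exists[OF E(3,1) closure_subset order_refl] by blast
  define Y where "Y = closure C"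
  have Y: "subspace Y" "Y \<subseteq> fin_space n" using C by (auto simp: Y_def)
  have YE: "apply_bcontfun z k \<in> closure E" if "z \<in> Y" "k < n" for z k
  proof -
    have "(\<lambda>z. apply_bcontfun z k) ` closure C \<subseteq> closure ((\<lambda>z. apply_bcontfun z k) ` C)"
      by (rule image_closure_subset[OF linear_continuous_on[OF bounded_linear_apply_bcontfun]])
        (auto intro: closure_subset[THEN subsetD])
    also have "\<dots> \<subseteq> closure E" using E(2) that(2) by (intro closure_mono) (auto simp: D_def)
    finally show ?thesis using that(1) by (auto simp: Y_def)
  qed
  have p0: "p 0 = 0" and ppos: "\<And>x. x \<in> closure E \<Longrightarrow> 0 \<le> p x"
    and pL: "\<And>x y. x \<in> closure E \<Longrightarrow> y \<in> closure E \<Longrightarrow> \<bar>p x - p y\<bar> \<le> norm (x - y)"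
    and plow: "\<And>e. e > 0 \<Longrightarrow> \<exists>c>0. \<forall>y\<in>closure E. e \<le> norm y \<longrightarrow> c * norm y \<le> p y"
    and pd: "\<And>y. y \<in> closure E \<Longrightarrow> \<exists>f\<in>dual_ball (closure E). \<forall>e>0. \<exists>d>0. \<forall>v\<in>closure E. norm v < d \<longrightarrow> \<bar>p (y + v) - p y - f v\<bar> \<le> e * norm v"
    using p unfolding smooth_gauge_def by blast+
  have n1: "real n + 1 > 0" by simp
  have avg: "(\<Sum>k<n. a k) / (real n + 1) \<le> b" if "\<And>k. k < n \<Longrightarrow> a k \<le> b" "0 \<le> b" for a :: "nat \<Rightarrow> real" and b
  proof -
    have "(\<Sum>k<n. a k) \<le> real n * b" using sum_bounded_above[of "{..<n}" a b] that by simp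
    also have "\<dots> \<le> b * (real n + 1)" using that by (simp add: algebra_simps)
    finally show ?thesis by (simp add: divide_le_eq)
  qed
  have abs_avg: "\<bar>(\<Sum>k<n. a k) / (real n + 1)\<bar> \<le> b" if "\<And>k. k < n \<Longrightarrow> \<bar>a k\<bar> \<le> b" "0 \<le> b" for a :: "nat \<Rightarrow> real" and b
  proof -
    have "\<bar>(\<Sum>k<n. a k) / (real n + 1)\<bar> \<le> (\<Sum>k<n. \<bar>a k\<bar>) / (real n + 1)"
      by (simp add: abs_divide divide_right_mono)
    also have "\<dots> \<le> b" by (rule avg) (use that in auto)
    finally show ?thesis .
  qed
  \<comment> \<open>Division by \<open>n + 1\<close> instead of \<open>n\<close> keeps the Lipschitz
    constant at most 1 and covers \<open>n = 0\<close>.\<close>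
  define q where "q z = (\<Sum>k<n. p (apply_bcontfun z k)) / (real n + 1)" for z
  have "smooth_gauge Y q"
    unfolding smooth_gauge_def
  proof (intro conjI ballI allI impI)
    show "q 0 = 0" by (simp add: q_def p0)
    show "0 \<le> q x" if "x \<in> Y" for x
      unfolding q_def using ppos YE[OF that] by (intro divide_nonneg_pos sum_nonneg) auto
    show "\<bar>q x - q y\<bar> \<le> norm (x - y)" if xy: "x \<in> Y" "y \<in> Y" for x y
      unfolding q_def diff_divide_distrib[symmetric] sum_subtractf[symmetric]
    proof (rule abs_avg)
      fix k assume "k < n"
      then have "\<bar>p (apply_bcontfun x k) - p (apply_bcontfun y k)\<bar> \<le> norm (apply_bcontfun (x - y) k)"
        using pL YE xy by simp
      also have "\<dots> \<le> norm (x - y)" by (rule norm_bounded)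
      finally show "\<bar>p (apply_bcontfun x k) - p (apply_bcontfun y k)\<bar> \<le> norm (x - y)" .
    qed simp
  next
    fix e :: real assume e: "e > 0"
    obtain c where c: "c > 0" "\<And>y. y \<in> closure E \<Longrightarrow> e \<le> norm y \<Longrightarrow> c * norm y \<le> p y" using plow[OF e] by blast
    show "\<exists>c>0. \<forall>y\<in>Y. e \<le> norm y \<longrightarrow> c * norm y \<le> q y"
    proof (intro exI[of _ "c / (real n + 1)"] conjI ballI impI)
      fix y assume y: "y \<in> Y" "e \<le> norm y"
      obtain k where k: "k < n" "norm y \<le> norm (apply_bcontfun y k)"
      proof -
        have "y \<in> fin_space n" "0 < norm y" using y e Y(2) by auto
        then show thesis using norm_fin_space_attained that by blast
      qed
      have "c * norm y \<le> c * norm (apply_bcontfun y k)" using k c by simp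
      also have "\<dots> \<le> p (apply_bcontfun y k)" using c(2) YE[OF y(1) k(1)] k y by simp
      also have "\<dots> \<le> (\<Sum>k<n. p (apply_bcontfun y k))"
        by (rule member_le_sum[of k]) (use k ppos YE y in auto)
      finally show "c / (real n + 1) * norm y \<le> q y"
        unfolding q_def by (simp add: divide_right_mono)
    qed (use c n1 in auto)
  next
    fix y assume y: "y \<in> Y"
    have "\<exists>f. \<forall>k<n. f k \<in> dual_ball (closure E) \<and> (\<forall>e>0. \<exists>d>0. \<forall>v\<in>closure E. norm v < d \<longrightarrow>
        \<bar>p (apply_bcontfun y k + v) - p (apply_bcontfun y k) - f k v\<bar> \<le> e * norm v)"
      using pd[OF YE[OF y]] by (intro choice) blast
    then obtain f where f: "\<And>k. k < n \<Longrightarrow> f k \<in> dual_ball (closure E)"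
      and df: "\<And>k e. k < n \<Longrightarrow> e > 0 \<Longrightarrow> \<exists>d>0. \<forall>v\<in>closure E. norm v < d \<longrightarrow>
        \<bar>p (apply_bcontfun y k + v) - p (apply_bcontfun y k) - f k v\<bar> \<le> e * norm v" by blast
    define F where "F z = (\<Sum>k<n. f k (apply_bcontfun z k)) / (real n + 1)" for z
    have "F \<in> dual_ball Y"
      unfolding dual_ball_def
    proof (intro CollectI conjI ballI allI)
      fix x z assume xz: "x \<in> Y" "z \<in> Y"
      have "(\<Sum>k<n. f k (apply_bcontfun (x + z) k)) = (\<Sum>k<n. f k (apply_bcontfun x k) + f k (apply_bcontfun z k))"
        using f YE xz by (intro sum.cong) (auto simp: dual_ball_def)
      then show "F (x + z) = F x + F z" by (simp add: F_def sum.distrib add_divide_distrib)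
    next
      fix c x assume x: "x \<in> Y"
      have "(\<Sum>k<n. f k (apply_bcontfun (c *\<^sub>R x) k)) = (\<Sum>k<n. c * f k (apply_bcontfun x k))"
        using f YE x by (intro sum.cong) (auto simp: dual_ball_def)
      then show "F (c *\<^sub>R x) = c * F x" by (simp add: F_def sum_distrib_left)
    next
      fix x assume x: "x \<in> Y"
      show "\<bar>F x\<bar> \<le> norm x" unfolding F_def
      proof (rule abs_avg)
        fix k assume "k < n"
        then have "\<bar>f k (apply_bcontfun x k)\<bar> \<le> norm (apply_bcontfun x k)" using f YE x by (auto simp: dual_ball_def)
        then show "\<bar>f k (apply_bcontfun x k)\<bar> \<le> norm x" using norm_bounded[of x k] by linarith
      qed simp
    qed
    moreover have "\<exists>d>0. \<forall>v\<in>Y. norm v < d \<longrightarrow> \<bar>q (y + v) - q y - F v\<bar> \<le> e * norm v" if e: "e > 0" for e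
    proof -
      have "\<exists>d>0. \<forall>k<m. \<forall>v\<in>closure E. norm v < d \<longrightarrow>
        \<bar>p (apply_bcontfun y k + v) - p (apply_bcontfun y k) - f k v\<bar> \<le> e * norm v" if "m \<le> n" for m
        using that
      proof (induction m)
        case (Suc m)
        then obtain d where d: "d > 0" "\<forall>k<m. \<forall>v\<in>closure E. norm v < d \<longrightarrow>
          \<bar>p (apply_bcontfun y k + v) - p (apply_bcontfun y k) - f k v\<bar> \<le> e * norm v" by auto
        obtain d' where d': "d' > 0" "\<forall>v\<in>closure E. norm v < d' \<longrightarrow>
          \<bar>p (apply_bcontfun y m + v) - p (apply_bcontfun y m) - f m v\<bar> \<le> e * norm v"
          using df[of m e] Suc.prems e by auto
        show ?case using d d' by (intro exI[of _ "min d d'"]) (auto simp: less_Suc_eq)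
      qed (auto intro: exI[of _ 1])
      from this[OF order_refl] obtain d where d: "d > 0" "\<And>k v. k < n \<Longrightarrow> v \<in> closure E \<Longrightarrow> norm v < d \<Longrightarrow>
        \<bar>p (apply_bcontfun y k + v) - p (apply_bcontfun y k) - f k v\<bar> \<le> e * norm v" by blast
      show ?thesis
      proof (intro exI[of _ d] conjI d(1) ballI impI)
        fix v assume v: "v \<in> Y" "norm v < d"
        show "\<bar>q (y + v) - q y - F v\<bar> \<le> e * norm v"
          unfolding q_def F_def diff_divide_distrib[symmetric] sum_subtractf[symmetric]
        proof (rule abs_avg)
          fix k assume k: "k < n"
          have nv: "norm (apply_bcontfun v k) \<le> norm v" by (rule norm_bounded)
          have "\<bar>p (apply_bcontfun y k + apply_bcontfun v k) - p (apply_bcontfun y k) - f k (apply_bcontfun v k)\<bar>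
              \<le> e * norm (apply_bcontfun v k)" using d(2)[OF k YE[OF v(1) k]] nv v(2) by simp
          also have "\<dots> \<le> e * norm v" using nv e by simp
          finally show "\<bar>p (apply_bcontfun (y + v) k) - p (apply_bcontfun y k) - f k (apply_bcontfun v k)\<bar> \<le> e * norm v"
            by simp
        qed (use e in simp)
      qed
    qed
    ultimately show "\<exists>f\<in>dual_ball Y. \<forall>e>0. \<exists>d>0. \<forall>v\<in>Y. norm v < d \<longrightarrow> \<bar>q (y + v) - q y - f v\<bar> \<le> e * norm v"
      by blast
  qed
  then show ?thesis unfolding Y_def by blast
qed

section \<open>Weak-star sequential compactness\<close>

text \<open>One level lies near the limit of a convergent subsequence, the other comes from the
  terms that keep the distance \<open>e\<close> from this limit, infinitely many of which are on the
  same side.\<close>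

lemma bounded_not_convergent_split:
  fixes u :: "nat \<Rightarrow> real"
  assumes b: "bounded (range u)" and nc: "\<not> convergent u"
  obtains a e where "e > 0" "infinite {n. u n \<le> a}" "infinite {n. a + e \<le> u n}"
proof -
  obtain l r where r: "strict_mono r" "(u \<circ> r) \<longlonglongrightarrow> l" using bounded_imp_convergent_subsequence[OF b] by blast
  have "\<not> u \<longlonglongrightarrow> l" using nc convergentI by blast
  then obtain e where e: "e > 0" "\<And>N. \<exists>n\<ge>N. \<not> \<bar>u n - l\<bar> < e" unfolding LIMSEQ_iff by auto
  have near: "infinite {n. \<bar>u n - l\<bar> < e / 2}"
    unfolding infinite_nat_iff_unbounded_le
  proof
    fix M
    obtain N where N: "\<And>n. n \<ge> N \<Longrightarrow> \<bar>(u \<circ> r) n - l\<bar> < e / 2"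
      using r(2) e(1) unfolding LIMSEQ_iff by (metis half_gt_zero real_norm_def)
    have "M \<le> r (max M N)" using seq_suble[OF r(1), of "max M N"] by simp
    then show "\<exists>n\<ge>M. n \<in> {n. \<bar>u n - l\<bar> < e / 2}" using N[of "max M N"] by auto
  qed
  have "infinite {n. e \<le> \<bar>u n - l\<bar>}"
    unfolding infinite_nat_iff_unbounded_le using e(2) by (auto simp: not_less)
  moreover have "{n. e \<le> \<bar>u n - l\<bar>} = {n. l + e \<le> u n} \<union> {n. u n \<le> l - e}" by auto
  ultimately consider "infinite {n. l + e \<le> u n}" | "infinite {n. u n \<le> l - e}" by auto
  then show ?thesis
  proof cases
    case 1
    have "{n. l + e \<le> u n} = {n. (l + e / 2) + e / 2 \<le> u n}" by (auto simp: add.commute)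
    moreover have "u n \<le> l + e / 2" if "\<bar>u n - l\<bar> < e / 2" for n using that unfolding abs_less_iff by argo
    then have "infinite {n. u n \<le> l + e / 2}" by (intro infinite_super[OF _ near]) auto
    ultimately show ?thesis using that[of "e / 2" "l + e / 2"] 1 e(1) by simp
  next
    case 2
    have "(l - e) + e / 2 \<le> u n" if "\<bar>u n - l\<bar> < e / 2" for n using that unfolding abs_less_iff by argo
    then have "infinite {n. (l - e) + e / 2 \<le> u n}" by (intro infinite_super[OF _ near]) auto
    then show ?thesis using that[of "e / 2" "l - e"] 2 e(1) by simp
  qed
qed

lemma limitin_weak_star_iff:
  "limitin weak_star_topology f l F \<longleftrightarrow> (\<forall>x. ((\<lambda>n. blinfun_apply (f n) x) \<longlongrightarrow> blinfun_apply l x) F)"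
proof -
  have "limitin weak_star_topology f l F \<longleftrightarrow> limitin euclidean (\<lambda>n. blinfun_apply (f n)) (blinfun_apply l) F"
    by (auto simp: limitin_def strong_operator_topology_def topspace_pullback_topology openin_pullback_topology)
  then show ?thesis
    unfolding euclidean_product_topology[symmetric] limitin_componentwise by (simp add: extensional_UNIV)
qed

lemma blinfun_pointwise_limit:
  fixes f :: "nat \<Rightarrow> 'a::real_normed_vector \<Rightarrow>\<^sub>L real"
  assumes K: "\<And>n. norm (f n) \<le> K" and conv: "\<And>x. norm x \<le> 1 \<Longrightarrow> convergent (\<lambda>n. blinfun_apply (f n) x)"
  obtains l where "\<And>x. (\<lambda>n. blinfun_apply (f n) x) \<longlonglongrightarrow> blinfun_apply l x"
proof -
  define g where "g x = lim (\<lambda>n. blinfun_apply (f n) x)" for x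
  have lim: "(\<lambda>n. blinfun_apply (f n) x) \<longlonglongrightarrow> g x" for x
  proof -
    have "convergent (\<lambda>n. (norm x + 1) * blinfun_apply (f n) (inverse (norm x + 1) *\<^sub>R x))"
      by (intro convergent_mult convergent_const conv) (simp add: divide_inverse_commute[symmetric] add_nonneg_pos)
    moreover have "norm x + 1 \<noteq> 0" using norm_ge_zero[of x] by linarith
    ultimately have "convergent (\<lambda>n. blinfun_apply (f n) x)" by (simp add: blinfun.scaleR_right mult.assoc[symmetric])
    then show ?thesis unfolding g_def convergent_LIMSEQ_iff .
  qed
  have "bounded_linear g"
  proof (rule bounded_linear_intro[where K = K])
    show "g (x + y) = g x + g y" for x y
      using tendsto_add[OF lim[of x] lim[of y]] lim[of "x + y"] by (auto simp: blinfun.add_right intro: LIMSEQ_unique)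
    show "g (c *\<^sub>R x) = c *\<^sub>R g x" for c x
      using tendsto_mult_left[OF lim[of x], of c] lim[of "c *\<^sub>R x"] by (auto simp: blinfun.scaleR_right intro: LIMSEQ_unique)
    show "norm (g x) \<le> norm x * K" for x
    proof (rule LIMSEQ_le_const2[OF tendsto_norm[OF lim]])
      have "norm (blinfun_apply (f n) x) \<le> norm x * K" for n
        using norm_blinfun[of "f n" x] mult_right_mono[OF K[of n] norm_ge_zero[of x]] by (simp add: mult.commute)
      then show "\<exists>N. \<forall>n\<ge>N. norm (blinfun_apply (f n) x) \<le> norm x * K" by blast
    qed
  qed
  then show ?thesis using that[of "Blinfun g"] lim by (simp add: bounded_linear_Blinfun_apply)
qed

text \<open>A quantitative form of divergence on the unit ball. Its negation for fixed
  \<open>e\<close> passes to subsequences and depends on tails only, as a diagonal argument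
  requires. A bounded sequence that does not oscillate for any \<open>e > 0\<close> converges at
  each point of the unit ball.\<close>

definition oscillates :: "real \<Rightarrow> (nat \<Rightarrow> 'a::real_normed_vector \<Rightarrow>\<^sub>L real) \<Rightarrow> bool" where
  "oscillates e f \<longleftrightarrow> (\<exists>x a. norm x \<le> 1 \<and> infinite {n. blinfun_apply (f n) x \<le> a} \<and> infinite {n. a + e \<le> blinfun_apply (f n) x})"

lemma composition_chain:
  fixes k :: "nat \<Rightarrow> nat \<Rightarrow> nat"
  assumes step: "\<And>n. \<exists>j. k (Suc n) = k n \<circ> j" and "n \<le> m"
  shows "\<exists>j. k m = k n \<circ> j"
  using assms(2)
proof (induction m rule: dec_induct)
  case base
  show ?case by (intro exI[of _ id]) simp
next
  case (step m)
  then obtain i where "k m = k n \<circ> i" by blast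
  moreover obtain j where "k (Suc m) = k m \<circ> j" using assms(1) by blast
  ultimately have "k (Suc m) = k n \<circ> (i \<circ> j)" by (simp add: o_assoc)
  then show ?case by blast
qed

text \<open>If every subsequence of \<open>f \<circ> r\<close> oscillates by \<open>e\<close>, a dyadic tree of subsequences
  produces uncountably many functionals that are \<open>e\<close>-separated on a separable subspace.\<close>
lemma not_everywhere_oscillating:
  fixes f :: "nat \<Rightarrow> 'a::banach \<Rightarrow>\<^sub>L real" and r :: "nat \<Rightarrow> nat"
  assumes asplund: "asplund_space TYPE('a)" and K: "\<And>n. norm (f n) \<le> K" and e: "e > 0"
  shows "\<exists>k. strict_mono k \<and> \<not> oscillates e (f \<circ> r \<circ> k)"
proof (rule ccontr)
  assume "\<not> ?thesis"
  then have osc: "oscillates e (f \<circ> r \<circ> k)" if "strict_mono k" for k using that by blast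
  have ex: "\<exists>x a (k0 :: nat \<Rightarrow> nat) (k1 :: nat \<Rightarrow> nat). norm x \<le> 1 \<and> strict_mono k0 \<and> strict_mono k1 \<and>
      (\<forall>n. blinfun_apply (f (r (k (k0 n)))) x \<le> a) \<and> (\<forall>n. a + e \<le> blinfun_apply (f (r (k (k1 n)))) x)"
    if k: "strict_mono k" for k :: "nat \<Rightarrow> nat"
  proof -
    obtain x a where xa: "norm x \<le> 1" "infinite {n. blinfun_apply (f (r (k n))) x \<le> a}"
      "infinite {n. a + e \<le> blinfun_apply (f (r (k n))) x}"
      using osc[OF k] unfolding oscillates_def by auto
    have sub: "\<exists>k0 :: nat \<Rightarrow> nat. strict_mono k0 \<and> (\<forall>n. Q (k0 n))" if "infinite {n. Q n}" for Q :: "nat \<Rightarrow> bool"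
      using infinite_enumerate[OF that] by simp
    obtain k0 k1 :: "nat \<Rightarrow> nat" where "strict_mono k0" "\<forall>n. blinfun_apply (f (r (k (k0 n)))) x \<le> a"
      "strict_mono k1" "\<forall>n. a + e \<le> blinfun_apply (f (r (k (k1 n)))) x"
      using sub[OF xa(2)] sub[OF xa(3)] by blast
    then show ?thesis using xa(1) by blast
  qed
  define good where "good k X \<longleftrightarrow> (case X of (x, a, k0, k1) \<Rightarrow> norm x \<le> 1 \<and> strict_mono k0 \<and> strict_mono k1 \<and>
      (\<forall>n. blinfun_apply (f (r (k (k0 n)))) x \<le> a) \<and> (\<forall>n. a + e \<le> blinfun_apply (f (r (k (k1 n)))) x))"
    for k :: "nat \<Rightarrow> nat" and X :: "'a \<times> real \<times> (nat \<Rightarrow> nat) \<times> (nat \<Rightarrow> nat)"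
  define ch where "ch k = (SOME X. good k X)" for k
  have ch: "good k (ch k)" if k: "strict_mono k" for k
  proof -
    have "\<exists>X. good k X" using ex[OF k] unfolding good_def by auto
    then show ?thesis unfolding ch_def by (rule someI_ex)
  qed
  \<comment> \<open>\<open>N s\<close> is the index map of the subsequence at the node
    \<open>s\<close>. The head of the list is the latest decision, and \<open>True\<close> stands
    for the upper level.\<close>
  define N where "N = rec_list (id :: nat \<Rightarrow> nat) (\<lambda>b s k. k \<circ> (if b then snd (snd (snd (ch k))) else fst (snd (snd (ch k)))))"
  have N: "N [] = id" "\<And>b s. N (b # s) = N s \<circ> (if b then snd (snd (snd (ch (N s)))) else fst (snd (snd (ch (N s)))))"
    by (simp_all add: N_def)
  have goodX: "strict_mono (fst (snd (snd X))) \<and> strict_mono (snd (snd (snd X))) \<and> norm (fst X) \<le> 1 \<and>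
      (\<forall>n. blinfun_apply (f (r (k (fst (snd (snd X)) n)))) (fst X) \<le> fst (snd X)) \<and>
      (\<forall>n. fst (snd X) + e \<le> blinfun_apply (f (r (k (snd (snd (snd X)) n)))) (fst X))" if "good k X" for k X
    using that by (auto simp: good_def split: prod.splits)
  have mono: "strict_mono (N s)" for s
  proof (induction s)
    case (Cons b s)
    then show ?case using goodX[OF ch[OF Cons]] unfolding N(2) by (intro strict_mono_o) simp_all
  qed (simp add: N strict_mono_def)
  define x a where "x s = fst (ch (N s))" and "a s = fst (snd (ch (N s)))" for s
  have x1: "norm (x s) \<le> 1" for s using goodX[OF ch[OF mono]] by (simp add: x_def)
  have left: "blinfun_apply (f (r (N (False # s) n))) (x s) \<le> a s" for s n
    using goodX[OF ch[OF mono[of s]]] by (simp add: N x_def a_def)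
  have right: "a s + e \<le> blinfun_apply (f (r (N (True # s) n))) (x s)" for s n
    using goodX[OF ch[OF mono[of s]]] by (simp add: N x_def a_def)
  define pre where "pre \<sigma> = rec_nat [] (\<lambda>n s. \<sigma> n # s)" for \<sigma> :: "nat \<Rightarrow> bool"
  have pre: "pre \<sigma> 0 = []" "pre \<sigma> (Suc n) = \<sigma> n # pre \<sigma> n" for \<sigma> n by (simp_all add: pre_def)
  define Y where "Y = span (range x)"
  have cx: "countable (range x)" by simp
  have Ysub: "subspace Y" by (simp add: Y_def)
  obtain C where C: "countable C" "C \<subseteq> Y" "Y \<subseteq> closure C"
    using countable_dense_in_span[OF cx] unfolding Y_def by metis
  have "separable_dual_on Y"
    using asplund separable_space_subtopologyI[OF C] Ysub by (simp add: asplund_space_def)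
  then obtain D where D: "D \<subseteq> dual_on Y" "countable D"
    "\<And>f \<epsilon>. f \<in> dual_on Y \<Longrightarrow> \<epsilon> > 0 \<Longrightarrow> \<exists>g\<in>D. dual_norm_on Y (\<lambda>x. f x - g x) < \<epsilon>"
    unfolding separable_dual_on_def by blast
  have fb: "\<bar>blinfun_apply (f n) v\<bar> \<le> K * norm v" for n v
    using norm_blinfun[of "f n" v] mult_right_mono[OF K[of n] norm_ge_zero[of v]] by simp
  have K0: "0 \<le> K" using norm_ge_zero order_trans K by blast
  have branch: "\<exists>g\<in>dual_on Y. (\<forall>v\<in>Y. \<bar>g v\<bar> \<le> K * norm v) \<and>
      (\<forall>n. if \<sigma> n then a (pre \<sigma> n) + e \<le> g (x (pre \<sigma> n)) else g (x (pre \<sigma> n)) \<le> a (pre \<sigma> n))" for \<sigma>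
  proof -
    \<comment> \<open>A diagonal along the branch: for \<open>m \<ge> n\<close> the index
      \<open>d m\<close> belongs to the subsequence at the node
      \<open>pre \<sigma> n\<close>.\<close>
    define d where "d m = N (pre \<sigma> m) m" for m
    have d: "\<exists>i. d m = N (pre \<sigma> n) i" if "n \<le> m" for n m
    proof -
      have "\<exists>j. N (pre \<sigma> (Suc m)) = N (pre \<sigma> m) \<circ> j" for m unfolding pre N by (rule exI, rule refl)
      from composition_chain[of "\<lambda>m. N (pre \<sigma> m)", OF this that]
      obtain j where "N (pre \<sigma> m) = N (pre \<sigma> n) \<circ> j" by blast
      then show ?thesis by (auto simp: d_def)
    qed
    have bd: "norm (blinfun_apply (f (r (d n))) v) \<le> K" if "v \<in> range x" for n v
      using fb[of "r (d n)" v] that x1 K0 mult_left_mono[of "norm v" 1 K] by auto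
    \<comment> \<open>Convergence is arranged on the countable set of node vectors and extends to
      their span by linearity, so the limit is a functional on \<open>Y\<close>.\<close>
    obtain \<kappa> where \<kappa>: "strict_mono \<kappa>" "\<And>v. v \<in> range x \<Longrightarrow> \<exists>l. (\<lambda>n. blinfun_apply (f (r (d (\<kappa> n)))) v) \<longlonglongrightarrow> l"
      using function_convergent_subsequence[where f = "\<lambda>n. blinfun_apply (f (r (d n)))" and M = K, OF cx bd] by blast
    have conv: "\<exists>l. (\<lambda>n. blinfun_apply (f (r (d (\<kappa> n)))) v) \<longlonglongrightarrow> l" if "v \<in> Y" for v
      using that unfolding Y_def
    proof (induction rule: span_induct_alt)
      case base
      then show ?case by (auto simp: blinfun.zero_right)
    next
      case (step c u v)
      obtain l1 l2 where "(\<lambda>n. blinfun_apply (f (r (d (\<kappa> n)))) u) \<longlonglongrightarrow> l1"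
        "(\<lambda>n. blinfun_apply (f (r (d (\<kappa> n)))) v) \<longlonglongrightarrow> l2" using \<kappa>(2)[OF step(1)] step(2) by blast
      then have "(\<lambda>n. blinfun_apply (f (r (d (\<kappa> n)))) (c *\<^sub>R u + v)) \<longlonglongrightarrow> c *\<^sub>R l1 + l2"
        unfolding blinfun.add_right blinfun.scaleR_right by (intro tendsto_intros)
      then show ?case by blast
    qed
    define g where "g = restrict (\<lambda>v. lim (\<lambda>n. blinfun_apply (f (r (d (\<kappa> n)))) v)) Y"
    have lim: "(\<lambda>n. blinfun_apply (f (r (d (\<kappa> n)))) v) \<longlonglongrightarrow> g v" if "v \<in> Y" for v
      using conv[OF that] that limI by (auto simp: g_def)
    have gK: "\<bar>g v\<bar> \<le> K * norm v" if "v \<in> Y" for v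
      by (rule LIMSEQ_le_const2[OF tendsto_rabs[OF lim[OF that]]]) (use fb in blast)
    have "g \<in> dual_on Y"
      unfolding dual_on_def
    proof (intro CollectI conjI ballI allI)
      show "g \<in> extensional Y" by (simp add: g_def)
      show "g (u + v) = g u + g v" if "u \<in> Y" "v \<in> Y" for u v
        using tendsto_add[OF lim[OF that(1)] lim[OF that(2)]] lim[OF subspace_add[OF Ysub that]]
        by (auto simp: blinfun.add_right intro: LIMSEQ_unique)
      show "g (c *\<^sub>R v) = c * g v" if "v \<in> Y" for c v
        using tendsto_mult_left[OF lim[OF that], of c] lim[OF subspace_scale[OF Ysub that]]
        by (auto simp: blinfun.scaleR_right intro: LIMSEQ_unique)
      show "\<exists>K. \<forall>x\<in>Y. \<bar>g x\<bar> \<le> K * norm x" using gK by blast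
    qed
    moreover have "if \<sigma> n then a (pre \<sigma> n) + e \<le> g (x (pre \<sigma> n)) else g (x (pre \<sigma> n)) \<le> a (pre \<sigma> n)" for n
    proof -
      let ?v = "x (pre \<sigma> n)"
      have v: "?v \<in> Y" unfolding Y_def by (rule span_base) simp
      have "if \<sigma> n then a (pre \<sigma> n) + e \<le> blinfun_apply (f (r (d (\<kappa> m)))) ?v
          else blinfun_apply (f (r (d (\<kappa> m)))) ?v \<le> a (pre \<sigma> n)" if "m \<ge> Suc n" for m
      proof -
        have "Suc n \<le> \<kappa> m" using that seq_suble[OF \<kappa>(1), of m] by simp
        then obtain i where "d (\<kappa> m) = N (\<sigma> n # pre \<sigma> n) i" using d pre(2) by metis
        then show ?thesis using left[of "pre \<sigma> n" i] right[of "pre \<sigma> n" i] by (cases "\<sigma> n") auto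
      qed
      then show ?thesis
        using LIMSEQ_le_const[OF lim[OF v], of "a (pre \<sigma> n) + e"] LIMSEQ_le_const2[OF lim[OF v], of "a (pre \<sigma> n)"]
        by (cases "\<sigma> n") auto
    qed
    ultimately show ?thesis using gK by blast
  qed
  then have "\<exists>G. \<forall>\<sigma>. G \<sigma> \<in> dual_on Y \<and> (\<forall>v\<in>Y. \<bar>G \<sigma> v\<bar> \<le> K * norm v) \<and>
      (\<forall>n. if \<sigma> n then a (pre \<sigma> n) + e \<le> G \<sigma> (x (pre \<sigma> n)) else G \<sigma> (x (pre \<sigma> n)) \<le> a (pre \<sigma> n))"
    by (intro choice) blast
  then obtain G where G: "\<And>\<sigma>. G \<sigma> \<in> dual_on Y" "\<And>\<sigma> v. v \<in> Y \<Longrightarrow> \<bar>G \<sigma> v\<bar> \<le> K * norm v"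
    "\<And>\<sigma> n. if \<sigma> n then a (pre \<sigma> n) + e \<le> G \<sigma> (x (pre \<sigma> n)) else G \<sigma> (x (pre \<sigma> n)) \<le> a (pre \<sigma> n)"
    by blast
  \<comment> \<open>Half the separation: two branches with the same approximant would differ by less
    than \<open>e\<close> at every node vector.\<close>
  have "\<exists>\<Delta>. \<forall>\<sigma>. \<Delta> \<sigma> \<in> D \<and> dual_norm_on Y (\<lambda>x. G \<sigma> x - \<Delta> \<sigma> x) < e / 2"
    using D(3)[OF G(1), of "e / 2"] e by (intro choice) auto
  then obtain \<Delta> where \<Delta>: "\<And>\<sigma>. \<Delta> \<sigma> \<in> D" "\<And>\<sigma>. dual_norm_on Y (\<lambda>x. G \<sigma> x - \<Delta> \<sigma> x) < e / 2" by blast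
  have close: "\<bar>G \<sigma> (x s) - \<Delta> \<sigma> (x s)\<bar> < e / 2" for \<sigma> s
  proof -
    obtain K' where K': "\<And>v. v \<in> Y \<Longrightarrow> \<bar>\<Delta> \<sigma> v\<bar> \<le> K' * norm v"
    proof -
      have "\<Delta> \<sigma> \<in> dual_on Y" using \<Delta>(1) D(1) by blast
      then show thesis using that unfolding dual_on_def by blast
    qed
    have "\<bar>G \<sigma> v - \<Delta> \<sigma> v\<bar> \<le> K + \<bar>K'\<bar>" if v: "v \<in> Y" "norm v \<le> 1" for v
    proof -
      have "\<bar>G \<sigma> v\<bar> \<le> K" using G(2)[OF v(1), of \<sigma>] K0 v mult_left_mono[of "norm v" 1 K] by auto
      moreover have "\<bar>\<Delta> \<sigma> v\<bar> \<le> \<bar>K'\<bar>" using K'[OF v(1)] v(2) mult_mono[of K' "\<bar>K'\<bar>" "norm v" 1] abs_ge_self[of K'] by simp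
      ultimately show ?thesis by linarith
    qed
    then have "bdd_above ((\<lambda>v. \<bar>G \<sigma> v - \<Delta> \<sigma> v\<bar>) ` (Y \<inter> cball 0 1))"
      by (intro bdd_aboveI2[of _ _ "K + \<bar>K'\<bar>"]) auto
    then have "\<bar>G \<sigma> (x s) - \<Delta> \<sigma> (x s)\<bar> \<le> dual_norm_on Y (\<lambda>v. G \<sigma> v - \<Delta> \<sigma> v)"
      unfolding dual_norm_on_def by (rule cSUP_upper[rotated]) (use x1 in \<open>auto simp: Y_def intro: span_base\<close>)
    then show ?thesis using \<Delta>(2)[of \<sigma>] by linarith
  qed
  have "inj \<Delta>"
  proof (rule injI, rule ccontr)
    fix \<sigma> \<tau> assume eq: "\<Delta> \<sigma> = \<Delta> \<tau>" and "\<sigma> \<noteq> \<tau>"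
    then have "\<exists>n. \<sigma> n \<noteq> \<tau> n" by auto
    \<comment> \<open>Both branches pass through the same node before their first difference; at its
      vector one functional is at most \<open>a\<close> and the other at least
      \<open>a + e\<close>.\<close>
    then obtain n where n: "\<sigma> n \<noteq> \<tau> n" "\<And>m. m < n \<Longrightarrow> \<sigma> m = \<tau> m"
      using exists_least_iff[of "\<lambda>n. \<sigma> n \<noteq> \<tau> n"] by blast
    have "m \<le> n \<Longrightarrow> pre \<sigma> m = pre \<tau> m" for m by (induction m) (use n(2) in \<open>auto simp: pre\<close>)
    then have p: "pre \<sigma> n = pre \<tau> n" by simp
    have "e \<le> \<bar>G \<sigma> (x (pre \<sigma> n)) - G \<tau> (x (pre \<sigma> n))\<bar>"
      using G(3)[of \<sigma> n] G(3)[of \<tau> n] n(1) unfolding p by (auto split: if_splits)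
    moreover have "\<bar>G \<sigma> (x (pre \<sigma> n)) - \<Delta> \<sigma> (x (pre \<sigma> n))\<bar> < e / 2" "\<bar>G \<tau> (x (pre \<sigma> n)) - \<Delta> \<sigma> (x (pre \<sigma> n))\<bar> < e / 2"
      using close[of \<sigma>] close[of \<tau>] eq by auto
    moreover have "\<bar>G \<sigma> (x (pre \<sigma> n)) - G \<tau> (x (pre \<sigma> n))\<bar>
        \<le> \<bar>G \<sigma> (x (pre \<sigma> n)) - \<Delta> \<sigma> (x (pre \<sigma> n))\<bar> + \<bar>G \<tau> (x (pre \<sigma> n)) - \<Delta> \<sigma> (x (pre \<sigma> n))\<bar>"
      using abs_triangle_ineq4[of "G \<sigma> (x (pre \<sigma> n)) - \<Delta> \<sigma> (x (pre \<sigma> n))" "G \<tau> (x (pre \<sigma> n)) - \<Delta> \<sigma> (x (pre \<sigma> n))"] by simp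
    ultimately show False by argo
  qed
  moreover have "range \<Delta> \<subseteq> D" using \<Delta>(1) by blast
  then have "countable (range \<Delta>)" using D(2) by (rule countable_subset)
  ultimately have "countable (UNIV :: (nat \<Rightarrow> bool) set)" using countable_image_inj_on by blast
  then obtain h :: "nat \<Rightarrow> nat \<Rightarrow> bool" where "range h = UNIV" using uncountable_def by (metis UNIV_not_empty)
  then obtain m where "h m = (\<lambda>n. \<not> h n n)" by (metis UNIV_I image_iff)
  then show False by metis
qed

text \<open>For a nonseparable space the dual ball is not metrizable in the weak-star topology, so
  the subsequence is obtained by excluding oscillation: passing to subsequences removes it for each
  \<open>e = 1 / (i + 1)\<close>, and a diagonal sequence removes it for all of them.\<close>

theorem asplund_weak_star_sequentially_compact:
  fixes f :: "nat \<Rightarrow> 'a::banach \<Rightarrow>\<^sub>L real"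
  assumes asplund: "asplund_space TYPE('a)" and K: "\<And>n. norm (f n) \<le> K"
  obtains k l where "strict_mono k" "limitin weak_star_topology (f \<circ> k) l sequentially"
proof -
  define P where "P i r \<longleftrightarrow> \<not> oscillates (inverse (real (Suc i))) (f \<circ> r)" for i and r :: "nat \<Rightarrow> nat"
  have "\<exists>k. strict_mono k \<and> (\<forall>i. P i (id \<circ> k))"
  proof (rule subsequence_diagonalization_lemma[of P id])
    show "\<exists>k. strict_mono k \<and> P i (r \<circ> k)" for i and r :: "nat \<Rightarrow> nat"
      using not_everywhere_oscillating[where f = f, OF asplund K, of "inverse (real (Suc i))" r] by (simp add: P_def o_assoc)
  next
    fix i :: nat and r k1 k2 :: "nat \<Rightarrow> nat" and N :: nat
    assume P: "P i (r \<circ> k1)" and tail: "\<And>j. N \<le> j \<Longrightarrow> \<exists>j'\<ge>j. k2 j = k1 j'"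
    \<comment> \<open>The diagonal sequence consists only eventually of terms of the given
      subsequence, with indices at least as large; this suffices for infinite sets of
      indices.\<close>
    have inf: "infinite {n. Q (k1 n)}" if "infinite {n. Q (k2 n)}" for Q
      unfolding infinite_nat_iff_unbounded_le
    proof
      fix m
      have "\<exists>n\<ge>max m N. n \<in> {n. Q (k2 n)}" using that unfolding infinite_nat_iff_unbounded_le by (rule spec)
      then obtain n where n: "n \<ge> max m N" "Q (k2 n)" by blast
      then obtain j' where "j' \<ge> n" "k2 n = k1 j'" using tail[of n] by auto
      then show "\<exists>n\<ge>m. n \<in> {n. Q (k1 n)}" using n by (intro exI[of _ j']) auto
    qed
    show "P i (r \<circ> k2)"
      unfolding P_def
    proof
      assume "oscillates (inverse (real (Suc i))) (f \<circ> (r \<circ> k2))"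
      then obtain x a where x: "norm x \<le> 1" and a: "infinite {n. blinfun_apply (f (r (k2 n))) x \<le> a}"
        "infinite {n. a + inverse (real (Suc i)) \<le> blinfun_apply (f (r (k2 n))) x}"
        unfolding oscillates_def o_def by blast
      have "infinite {n. blinfun_apply (f (r (k1 n))) x \<le> a}"
        using a(1) by (rule inf[where Q = "\<lambda>j. blinfun_apply (f (r j)) x \<le> a"])
      moreover have "infinite {n. a + inverse (real (Suc i)) \<le> blinfun_apply (f (r (k1 n))) x}"
        using a(2) by (rule inf[where Q = "\<lambda>j. a + inverse (real (Suc i)) \<le> blinfun_apply (f (r j)) x"])
      ultimately have "oscillates (inverse (real (Suc i))) (f \<circ> (r \<circ> k1))"
        using x unfolding oscillates_def o_def by blast
      then show False using P by (simp add: P_def)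
    qed
  qed blast
  then obtain k where k: "strict_mono k" "\<And>i. P i (id \<circ> k)" by blast
  have "convergent (\<lambda>n. blinfun_apply (f (k n)) x)" if x: "norm x \<le> 1" for x
  proof (rule ccontr)
    assume nc: "\<not> ?thesis"
    have "bounded (range (\<lambda>n. blinfun_apply (f (k n)) x))"
    proof (rule boundedI)
      fix y assume "y \<in> range (\<lambda>n. blinfun_apply (f (k n)) x)"
      then obtain n where "y = blinfun_apply (f (k n)) x" by blast
      then have "norm y \<le> norm (f (k n)) * norm x" using norm_blinfun[of "f (k n)" x] by simp
      also have "\<dots> \<le> K * 1" using K[of "k n"] x order_trans[OF norm_ge_zero K] by (intro mult_mono) auto
      finally show "norm y \<le> K" by simp
    qed
    then obtain a e where ae: "e > 0" "infinite {n. blinfun_apply (f (k n)) x \<le> a}"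
      "infinite {n. a + e \<le> blinfun_apply (f (k n)) x}"
      using bounded_not_convergent_split nc by blast
    obtain i where i: "inverse (real (Suc i)) < e" using reals_Archimedean[OF ae(1)] by blast
    have "infinite {n. a + inverse (real (Suc i)) \<le> blinfun_apply (f (k n)) x}"
      by (rule infinite_super[OF _ ae(3)]) (use i in auto)
    then have "oscillates (inverse (real (Suc i))) (f \<circ> k)"
      using x ae(2) unfolding oscillates_def o_def by blast
    then show False using k(2)[of i] by (simp add: P_def)
  qed
  then obtain l where "\<And>x. (\<lambda>n. blinfun_apply (f (k n)) x) \<longlonglongrightarrow> blinfun_apply l x"
    using blinfun_pointwise_limit[of "\<lambda>n. f (k n)" K] K by blast
  then have "limitin weak_star_topology (f \<circ> k) l sequentially" by (simp add: limitin_weak_star_iff)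
  then show ?thesis using that k(1) by blast
qed

section \<open>Normals to product sets\<close>

lemma frechet_normals_iff:
  assumes "x \<in> S"
  shows "f \<in> frechet_normals x S \<longleftrightarrow>
    (\<forall>e>0. \<exists>d>0. \<forall>u\<in>S. norm (u - x) < d \<longrightarrow> blinfun_apply f (u - x) \<le> e * norm (u - x))"
proof -
  have "f \<in> frechet_normals x S \<longleftrightarrow>
      (\<forall>y>0. \<forall>\<^sub>F u in at x within S. ereal (blinfun_apply f (u - x) / norm (u - x)) < y)"
    using assms unfolding frechet_normals_def eps_normals_def by (simp add: Limsup_le_iff zero_ereal_def)
  also have "\<dots> \<longleftrightarrow> (\<forall>e>0. \<exists>d>0. \<forall>u\<in>S. norm (u - x) < d \<longrightarrow> blinfun_apply f (u - x) \<le> e * norm (u - x))"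
  proof (intro iffI allI impI)
    fix e :: real assume L: "\<forall>y>0. \<forall>\<^sub>F u in at x within S. ereal (blinfun_apply f (u - x) / norm (u - x)) < y" and "e > 0"
    then have "(0::ereal) < ereal e" by simp
    with L have "\<forall>\<^sub>F u in at x within S. ereal (blinfun_apply f (u - x) / norm (u - x)) < ereal e" by blast
    then obtain d where d: "d > 0" "\<And>u. u \<in> S \<Longrightarrow> u \<noteq> x \<Longrightarrow> dist u x < d \<Longrightarrow> blinfun_apply f (u - x) / norm (u - x) < e"
      unfolding eventually_at by auto
    have "blinfun_apply f (u - x) \<le> e * norm (u - x)" if "u \<in> S" "norm (u - x) < d" for u
      using d(2)[of u] that by (cases "u = x") (auto simp: dist_norm divide_less_eq)
    then show "\<exists>d>0. \<forall>u\<in>S. norm (u - x) < d \<longrightarrow> blinfun_apply f (u - x) \<le> e * norm (u - x)" using d(1) by blast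
  next
    fix y :: ereal assume R: "\<forall>e>0. \<exists>d>0. \<forall>u\<in>S. norm (u - x) < d \<longrightarrow> blinfun_apply f (u - x) \<le> e * norm (u - x)" and y: "y > 0"
    obtain e where e: "0 < e" "ereal e < y" using ereal_dense2[OF y] by auto
    then obtain d where d: "d > 0" "\<And>u. u \<in> S \<Longrightarrow> norm (u - x) < d \<Longrightarrow> blinfun_apply f (u - x) \<le> e * norm (u - x)"
      using R by blast
    show "\<forall>\<^sub>F u in at x within S. ereal (blinfun_apply f (u - x) / norm (u - x)) < y"
      unfolding eventually_at
    proof (intro exI[of _ d] conjI d(1) ballI impI)
      fix u assume u: "u \<in> S" "u \<noteq> x \<and> dist u x < d"
      then have "blinfun_apply f (u - x) / norm (u - x) \<le> e" using d(2)[of u] by (simp add: dist_norm divide_le_eq)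
      then have "ereal (blinfun_apply f (u - x) / norm (u - x)) \<le> ereal e" by simp
      then show "ereal (blinfun_apply f (u - x) / norm (u - x)) < y" using e(2) by (rule le_less_trans)
    qed
  qed
  finally show ?thesis .
qed

lemma frechet_normals_scaleR:
  assumes f: "f \<in> frechet_normals x S" and c: "0 \<le> c" shows "c *\<^sub>R f \<in> frechet_normals x S"
proof -
  have x: "x \<in> S" using f unfolding frechet_normals_def eps_normals_def by (auto split: if_splits)
  show ?thesis unfolding frechet_normals_iff[OF x]
  proof (intro allI impI)
    fix e :: real assume e: "e > 0"
    then have "e / (c + 1) > 0" using c by simp
    then obtain d where d: "d > 0" "\<And>u. u \<in> S \<Longrightarrow> norm (u - x) < d \<Longrightarrow> blinfun_apply f (u - x) \<le> e / (c + 1) * norm (u - x)"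
      using f unfolding frechet_normals_iff[OF x] by blast
    have "blinfun_apply (c *\<^sub>R f) (u - x) \<le> e * norm (u - x)" if u: "u \<in> S" "norm (u - x) < d" for u
    proof -
      have "c * blinfun_apply f (u - x) \<le> c * (e / (c + 1) * norm (u - x))" using d(2)[OF u] c by (rule mult_left_mono)
      also have "\<dots> \<le> (c + 1) * (e / (c + 1) * norm (u - x))" using c e by (intro mult_right_mono) auto
      also have "\<dots> = e * norm (u - x)" using c by simp
      finally show ?thesis by (simp add: blinfun.scaleR_left)
    qed
    then show "\<exists>d>0. \<forall>u\<in>S. norm (u - x) < d \<longrightarrow> blinfun_apply (c *\<^sub>R f) (u - x) \<le> e * norm (u - x)"
      using d(1) by blast
  qed
qed

definition fin_unit :: "nat \<Rightarrow> nat \<Rightarrow> 'a \<Rightarrow> (nat \<Rightarrow>\<^sub>C 'a::real_normed_vector)" where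
  "fin_unit n k u = fin_vec n (\<lambda>j. if j = k then u else 0)"

definition component :: "nat \<Rightarrow> ((nat \<Rightarrow>\<^sub>C 'a::real_normed_vector) \<Rightarrow>\<^sub>L real) \<Rightarrow> nat \<Rightarrow> 'a \<Rightarrow>\<^sub>L real" where
  "component n \<nu> k = Blinfun (\<lambda>u. blinfun_apply \<nu> (fin_unit n k u))"

lemma apply_fin_unit: "apply_bcontfun (fin_unit n k u) j = (if j = k \<and> k < n then u else 0)"
  by (auto simp: fin_unit_def)

lemma fin_unit_in [simp]: "fin_unit n k u \<in> fin_space n"
  by (simp add: fin_unit_def)

lemma norm_fin_unit: "norm (fin_unit n k u) \<le> norm u"
  by (rule norm_fin_space_le[OF fin_unit_in]) (auto simp: apply_fin_unit)

lemma apply_component: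
  fixes u :: "'a::real_normed_vector"
  shows "blinfun_apply (component n \<nu> k) u = blinfun_apply \<nu> (fin_unit n k u)"
proof -
  have "bounded_linear (fin_unit n k :: 'a \<Rightarrow> _)"
  proof (rule bounded_linear_intro[where K = 1])
    show "fin_unit n k (x + y) = fin_unit n k x + fin_unit n k y" for x y :: 'a
      by (rule bcontfun_eqI) (simp add: apply_fin_unit)
    show "fin_unit n k (c *\<^sub>R x) = c *\<^sub>R fin_unit n k x" for c and x :: 'a
      by (rule bcontfun_eqI) (simp add: apply_fin_unit)
  qed (simp add: norm_fin_unit)
  then have "bounded_linear (\<lambda>u :: 'a. blinfun_apply \<nu> (fin_unit n k u))"
    by (intro bounded_linear_compose[OF blinfun.bounded_linear_right])
  then show ?thesis by (simp add: component_def bounded_linear_Blinfun_apply)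
qed

lemma apply_bcontfun_sum: "apply_bcontfun (\<Sum>i\<in>A. z i) k = (\<Sum>i\<in>A. apply_bcontfun (z i) k)"
  by (induction A rule: infinite_finite_induct) auto

lemma sum_components:
  assumes "z \<in> fin_space n"
  shows "blinfun_apply \<nu> z = (\<Sum>k<n. blinfun_apply (component n \<nu> k) (apply_bcontfun z k))"
proof -
  have "z = (\<Sum>k<n. fin_unit n k (apply_bcontfun z k))"
  proof (rule bcontfun_eqI)
    fix j
    have "(\<Sum>k<n. apply_bcontfun (fin_unit n k (apply_bcontfun z k)) j) = (\<Sum>k<n. if k = j then apply_bcontfun z j else 0)"
      by (rule sum.cong) (auto simp: apply_fin_unit)
    also have "\<dots> = apply_bcontfun z j" using assms by (auto simp: fin_space_def)
    finally show "apply_bcontfun z j = apply_bcontfun (\<Sum>k<n. fin_unit n k (apply_bcontfun z k)) j"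
      by (simp add: apply_bcontfun_sum)
  qed
  then show ?thesis unfolding apply_component by (metis blinfun.sum_right)
qed

text \<open>Moving coordinate \<open>k\<close> alone within \<open>A\<close> leaves \<open>S\<close>
  and the value of \<open>h\<close> intact, so the subgradient inequality along such moves is the
  inequality of a normal. The radius \<open>r\<close> leaves room for constraints in
  \<open>S\<close> that are inactive near the point.\<close>

lemma component_normal:
  assumes y: "subgradient_on S h y (blinfun_apply \<nu>)" and yA: "apply_bcontfun y k \<in> A" and r: "r > 0"
    and move: "\<And>u. u \<in> A \<Longrightarrow> norm (u - apply_bcontfun y k) < r \<Longrightarrow>
      y + fin_unit n k (u - apply_bcontfun y k) \<in> S \<and> h (y + fin_unit n k (u - apply_bcontfun y k)) = h y"
  shows "component n \<nu> k \<in> frechet_normals (apply_bcontfun y k) A"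
  unfolding frechet_normals_iff[OF yA]
proof (intro allI impI)
  fix e :: real assume e: "e > 0"
  then obtain d where d: "d > 0" "\<And>v. v \<in> S \<Longrightarrow> norm (v - y) < d \<Longrightarrow> h y + blinfun_apply \<nu> (v - y) - e * norm (v - y) \<le> h v"
    using y unfolding subgradient_on_def by blast
  have "blinfun_apply (component n \<nu> k) (u - apply_bcontfun y k) \<le> e * norm (u - apply_bcontfun y k)"
    if u: "u \<in> A" "norm (u - apply_bcontfun y k) < min d r" for u
  proof -
    let ?w = "fin_unit n k (u - apply_bcontfun y k)"
    have w: "norm ?w \<le> norm (u - apply_bcontfun y k)" by (rule norm_fin_unit)
    have m: "y + ?w \<in> S" "h (y + ?w) = h y" using move[OF u(1)] u(2) by auto
    have "blinfun_apply \<nu> ?w \<le> e * norm ?w" using d(2)[OF m(1)] m(2) w u(2) by simp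
    also have "\<dots> \<le> e * norm (u - apply_bcontfun y k)" using w e by simp
    finally show ?thesis by (simp add: apply_component)
  qed
  then show "\<exists>d>0. \<forall>u\<in>A. norm (u - apply_bcontfun y k) < d \<longrightarrow>
      blinfun_apply (component n \<nu> k) (u - apply_bcontfun y k) \<le> e * norm (u - apply_bcontfun y k)"
    using d(1) r by (intro exI[of _ "min d r"]) auto
qed

lemma frechet_normal_interior_zero:
  assumes "f \<in> frechet_normals x UNIV" shows "f = 0"
proof -
  have zero: "blinfun_apply f v \<le> 0" for v
  proof (rule field_le_epsilon)
    fix e :: real assume e: "e > 0"
    define e' where "e' = e / (norm v + 1)"
    have n1: "norm v + 1 > 0" by (simp add: add_nonneg_pos)
    have e': "e' > 0" using e n1 by (simp add: e'_def)
    obtain d where d: "d > 0" "\<And>u. norm (u - x) < d \<Longrightarrow> blinfun_apply f (u - x) \<le> e' * norm (u - x)"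
      using assms e' unfolding frechet_normals_iff[OF UNIV_I] by blast
    define t where "t = d / (2 * (norm v + 1))"
    have t: "t > 0" using d(1) n1 by (simp add: t_def)
    have "t * norm v \<le> t * (norm v + 1)" using t by simp
    also have "\<dots> = d / 2" using n1 by (simp add: t_def divide_simps)
    finally have "norm (t *\<^sub>R v) < d" using d(1) t by simp
    then have "t * blinfun_apply f v \<le> t * (e' * norm v)"
      using d(2)[of "x + t *\<^sub>R v"] t by (simp add: blinfun.scaleR_right algebra_simps)
    then have "blinfun_apply f v \<le> e' * norm v" using t by simp
    also have "\<dots> \<le> e' * (norm v + 1)" using e' by simp
    also have "\<dots> = e" using n1 by (simp add: e'_def)
    finally show "blinfun_apply f v \<le> 0 + e" by simp
  qed
  have "blinfun_apply f v = 0" for v using zero[of v] zero[of "- v"] by (simp add: blinfun.minus_right)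
  then show ?thesis by (intro blinfun_eqI) simp
qed

lemma norm_blinfun_bound_above:
  fixes f :: "'a::real_normed_vector \<Rightarrow>\<^sub>L real"
  assumes "\<And>v. blinfun_apply f v \<le> b * norm v" "0 \<le> b"
  shows "norm f \<le> b"
proof (rule norm_blinfun_bound[OF assms(2)])
  fix v show "norm (blinfun_apply f v) \<le> b * norm v"
    using assms(1)[of v] assms(1)[of "- v"] by (simp add: blinfun.minus_right abs_le_iff)
qed

section \<open>Rated normals\<close>

text \<open>The coordinates \<open>k < N\<close> of \<open>z\<close> stand for points of the sets, the coordinate \<open>N\<close> for the point at
  which the inequality defining a rated normal is tested.  If every point of the first kind
  coincides with the last one, the penalty is positive by that inequality.\<close>
definition penalty_term :: "nat \<Rightarrow> real \<Rightarrow> ('a::real_normed_vector \<Rightarrow>\<^sub>L real) \<Rightarrow> 'a \<Rightarrow> (nat \<Rightarrow>\<^sub>C 'a) \<Rightarrow> nat \<Rightarrow> real" where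
  "penalty_term N r f x0 z k = (if k < N then norm (apply_bcontfun z k - apply_bcontfun z N)
     else max 0 (r - blinfun_apply f (apply_bcontfun z N - x0) + r * norm (apply_bcontfun z N - x0)))"

definition penalty :: "nat \<Rightarrow> real \<Rightarrow> ('a::real_normed_vector \<Rightarrow>\<^sub>L real) \<Rightarrow> 'a \<Rightarrow> (nat \<Rightarrow>\<^sub>C 'a) \<Rightarrow> real" where
  "penalty N r f x0 z = L2_set (penalty_term N r f x0 z) {..N}"

lemma penalty_term_nonneg: "0 \<le> penalty_term N r f x0 z k"
  by (simp add: penalty_term_def)

lemma penalty_square:
  "(penalty N r f x0 z)\<^sup>2 = (\<Sum>k<N. (penalty_term N r f x0 z k)\<^sup>2) + (penalty_term N r f x0 z N)\<^sup>2"
  unfolding penalty_def L2_set_def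
  by (simp add: sum_nonneg lessThan_Suc_atMost[symmetric] del: lessThan_Suc_atMost)

lemma penalty_nonneg: "0 \<le> penalty N r f x0 z"
  by (simp add: penalty_def)

text \<open>The Euclidean norm is subadditive and is monotone on nonnegative vectors; each term is
  convex and nonnegative, the last one as the positive part of a convex function.\<close>

lemma convex_penalty:
  assumes r: "0 \<le> r" shows "convex_on UNIV (penalty N r f x0)"
proof (rule convex_onI)
  fix t :: real and v w :: "nat \<Rightarrow>\<^sub>C 'a" assume t: "0 < t" "t < 1"
  let ?z = "(1 - t) *\<^sub>R v + t *\<^sub>R w" and ?c = "penalty_term N r f x0"
  have n: "norm ((1 - t) *\<^sub>R a + t *\<^sub>R b) \<le> (1 - t) * norm a + t * norm b" for a b :: 'a
    using norm_triangle_ineq[of "(1 - t) *\<^sub>R a" "t *\<^sub>R b"] t by simp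
  have "?c ?z k \<le> (1 - t) * ?c v k + t * ?c w k" for k
  proof (cases "k < N")
    case True
    have "apply_bcontfun ?z k - apply_bcontfun ?z N = (1 - t) *\<^sub>R (apply_bcontfun v k - apply_bcontfun v N)
        + t *\<^sub>R (apply_bcontfun w k - apply_bcontfun w N)" by (simp add: algebra_simps)
    then show ?thesis using n True by (simp add: penalty_term_def)
  next
    case False
    let ?A = "\<lambda>z. r - blinfun_apply f (apply_bcontfun z N - x0) + r * norm (apply_bcontfun z N - x0)"
    let ?a = "apply_bcontfun v N - x0" and ?b = "apply_bcontfun w N - x0"
    have e: "apply_bcontfun ?z N - x0 = (1 - t) *\<^sub>R ?a + t *\<^sub>R ?b"
      by (simp add: algebra_simps)
    have "r * norm (apply_bcontfun ?z N - x0) \<le> r * ((1 - t) * norm ?a + t * norm ?b)"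
      unfolding e using r n by (rule mult_left_mono[rotated])
    moreover have "blinfun_apply f (apply_bcontfun ?z N - x0) = (1 - t) * blinfun_apply f ?a + t * blinfun_apply f ?b"
      unfolding e by (simp only: blinfun.add_right blinfun.scaleR_right real_scaleR_def)
    moreover have "(1 - t) * ?A v + t * ?A w
        = r - ((1 - t) * blinfun_apply f ?a + t * blinfun_apply f ?b) + r * ((1 - t) * norm ?a + t * norm ?b)"
      by (simp add: algebra_simps)
    ultimately have "?A ?z \<le> (1 - t) * ?A v + t * ?A w" by linarith
    also have "\<dots> \<le> (1 - t) * max 0 (?A v) + t * max 0 (?A w)"
      using t by (intro add_mono mult_left_mono) auto
    finally show ?thesis using t False by (simp add: penalty_term_def)
  qed
  then have "penalty N r f x0 ?z \<le> L2_set (\<lambda>k. (1 - t) * ?c v k + t * ?c w k) {..N}"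
    unfolding penalty_def by (intro L2_set_mono) (auto simp: penalty_term_nonneg)
  also have "\<dots> \<le> L2_set (\<lambda>k. (1 - t) * ?c v k) {..N} + L2_set (\<lambda>k. t * ?c w k) {..N}"
    by (rule L2_set_triangle_ineq)
  also have "\<dots> = (1 - t) * penalty N r f x0 v + t * penalty N r f x0 w"
    unfolding penalty_def using t by (simp add: L2_set_right_distrib[symmetric])
  finally show "penalty N r f x0 ?z \<le> (1 - t) * penalty N r f x0 v + t * penalty N r f x0 w" .
qed simp

text \<open>The factor \<open>N + 1\<close> is crude but harmless: the constant affects only how
  close the points of the fuzzy sum rule have to be, not the bounds for the multipliers.\<close>

lemma penalty_lipschitz:
  assumes r: "0 \<le> r"
  shows "\<bar>penalty N r f x0 v - penalty N r f x0 w\<bar> \<le> ((2 + norm f + r) * (real N + 1)) * norm (v - w)"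
proof -
  let ?c = "penalty_term N r f x0" and ?M = "2 + norm f + r"
  have M: "2 \<le> ?M" using r by simp
  have diff: "\<bar>?c v k - ?c w k\<bar> \<le> ?M * norm (v - w)" for v w k
  proof (cases "k < N")
    case True
    have "\<bar>?c v k - ?c w k\<bar> \<le> norm ((apply_bcontfun v k - apply_bcontfun v N) - (apply_bcontfun w k - apply_bcontfun w N))"
      using True by (simp add: penalty_term_def norm_triangle_ineq3)
    also have "\<dots> = norm (apply_bcontfun (v - w) k - apply_bcontfun (v - w) N)" by (simp add: algebra_simps)
    also have "\<dots> \<le> norm (apply_bcontfun (v - w) k) + norm (apply_bcontfun (v - w) N)" by (rule norm_triangle_ineq4)
    also have "\<dots> \<le> 2 * norm (v - w)" using norm_bounded[of "v - w" k] norm_bounded[of "v - w" N] by linarith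
    also have "\<dots> \<le> ?M * norm (v - w)" using M by (rule mult_right_mono) simp
    finally show ?thesis .
  next
    case False
    let ?a = "apply_bcontfun v N - x0" and ?b = "apply_bcontfun w N - x0"
    have ab: "norm (?a - ?b) \<le> norm (v - w)" using norm_bounded[of "v - w" N] by simp
    have "\<bar>blinfun_apply f ?a - blinfun_apply f ?b\<bar> \<le> norm f * norm (?a - ?b)"
      using norm_blinfun[of f "?a - ?b"] by (simp add: blinfun.diff_right)
    moreover have "\<bar>r * norm ?a - r * norm ?b\<bar> \<le> r * norm (?a - ?b)"
      using mult_left_mono[OF norm_triangle_ineq3[of ?a ?b] r] r by (simp add: right_diff_distrib[symmetric] abs_mult)
    moreover have "norm f * norm (?a - ?b) \<le> norm f * norm (v - w)" "r * norm (?a - ?b) \<le> r * norm (v - w)"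
      using ab r by (auto intro: mult_left_mono)
    ultimately have "\<bar>?c v k - ?c w k\<bar> \<le> norm f * norm (v - w) + r * norm (v - w)"
      using False unfolding penalty_term_def by (simp only: if_False)
    also have "\<dots> \<le> ?M * norm (v - w)" by (simp add: distrib_right)
    finally show ?thesis .
  qed
  have one: "penalty N r f x0 v \<le> penalty N r f x0 w + (?M * (real N + 1)) * norm (v - w)" for v w
  proof -
    have "penalty N r f x0 v \<le> L2_set (\<lambda>k. ?c w k + ?M * norm (v - w)) {..N}"
      unfolding penalty_def using diff[of v _ w] by (intro L2_set_mono) (auto simp: penalty_term_nonneg abs_le_iff algebra_simps)
    also have "\<dots> \<le> penalty N r f x0 w + L2_set (\<lambda>k. ?M * norm (v - w)) {..N}"
      unfolding penalty_def by (rule L2_set_triangle_ineq)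
    also have "L2_set (\<lambda>k. ?M * norm (v - w)) {..N} \<le> (\<Sum>k\<le>N. ?M * norm (v - w))"
      using M by (intro L2_set_le_sum) simp
    finally show ?thesis by (simp add: algebra_simps)
  qed
  show ?thesis using one[of v w] one[of w v] by (simp add: abs_le_iff norm_minus_commute)
qed

text \<open>The square root lies below its tangent at \<open>F\<^sup>2\<close>. This replaces the
  penalty by its square, an explicit sum.\<close>

lemma sqrt_tangent:
  fixes p F :: real assumes "F > 0" shows "p - F \<le> (p\<^sup>2 - F\<^sup>2) / (2 * F)"
proof -
  have "0 \<le> (p - F)\<^sup>2" by simp
  then show ?thesis using assms by (simp add: power2_eq_square field_simps)
qed

text \<open>The squared positive part is differentiable with derivative \<open>2 * max 0 A\<close>;
  this expansion bounds it from above with the remainder \<open>h\<^sup>2\<close>.\<close>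

lemma max_zero_square_le: "(max 0 (A + h))\<^sup>2 \<le> (max 0 A)\<^sup>2 + 2 * max 0 A * h + h\<^sup>2" for A h :: real
proof (cases "A \<ge> 0")
  case True
  have "(max 0 (A + h))\<^sup>2 \<le> (A + h)\<^sup>2" by (cases "A + h \<ge> 0") auto
  also have "\<dots> = A\<^sup>2 + 2 * A * h + h\<^sup>2" by (simp add: power2_sum)
  finally show ?thesis using True by (simp add: max_def)
next
  case False
  then have "max 0 (A + h) \<le> \<bar>h\<bar>" by auto
  then have "(max 0 (A + h))\<^sup>2 \<le> \<bar>h\<bar>\<^sup>2" by (intro power_mono) auto
  then show ?thesis using False by (simp add: max_def)
qed

text \<open>The multiplier \<open>l = a / F\<close> is the derivative of the Euclidean norm with
  respect to its last entry. Each conclusion tests one displacement: a common translation changes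
  the last term only and gives the sum; moving one coordinate gives the norm bound; moving all
  points to \<open>x\<close> removes the distance terms and gives, by the Cauchy-Schwarz inequality,
  the lower bound.\<close>

lemma penalty_subgradient:
  fixes f :: "'a::real_normed_vector \<Rightarrow>\<^sub>L real" and \<nu> :: "(nat \<Rightarrow>\<^sub>C 'a) \<Rightarrow>\<^sub>L real"
  assumes r: "0 \<le> r" and \<kappa>: "0 \<le> \<kappa>" "\<kappa> \<le> 1/8"
    and pos: "0 < penalty N r f x0 y"
    and sub: "\<And>v. penalty N r f x0 y - blinfun_apply \<nu> (v - y) - \<kappa> * norm (v - y) \<le> penalty N r f x0 v"
    and free: "component (Suc N) \<nu> N = 0"
  obtains l where "0 \<le> l" "norm (l *\<^sub>R f - (\<Sum>k<N. component (Suc N) \<nu> k)) \<le> r + \<kappa>"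
    "\<And>k. k < N \<Longrightarrow> norm (component (Suc N) \<nu> k) \<le> 1 + \<kappa>"
    "1/64 \<le> l\<^sup>2 + (\<Sum>k<N. (norm (component (Suc N) \<nu> k))\<^sup>2)"
proof -
  let ?c = "penalty_term N r f x0" and ?\<nu> = "component (Suc N) \<nu>"
  define F where "F = penalty N r f x0 y"
  define B2 where "B2 = (\<Sum>k<N. (?c y k)\<^sup>2)"
  define a where "a = ?c y N"
  define x where "x = apply_bcontfun y N"
  define l where "l = a / F"
  have F: "F > 0" using pos by (simp add: F_def)
  have F2: "F\<^sup>2 = B2 + a\<^sup>2" by (simp add: F_def B2_def a_def penalty_square)
  have a0: "0 \<le> a" by (simp add: a_def penalty_term_nonneg)
  have B0: "0 \<le> B2" by (simp add: B2_def sum_nonneg)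
  have "a \<le> F" by (rule power2_le_imp_le) (use F F2 B0 in auto)
  then have l: "0 \<le> l" "l \<le> 1" using a0 F by (auto simp: l_def)
  have key: "- blinfun_apply \<nu> w - \<kappa> * norm w \<le> ((penalty N r f x0 (y + w))\<^sup>2 - F\<^sup>2) / (2 * F)" for w
    using sub[of "y + w"] sqrt_tangent[OF F, of "penalty N r f x0 (y + w)"] unfolding F_def[symmetric] by simp
  have \<nu>1: "norm (?\<nu> k) \<le> 1 + \<kappa>" if k: "k < N" for k
  proof (rule norm_blinfun_bound_above)
    fix u :: 'a
    let ?w = "fin_unit (Suc N) k (- u)"
    have "penalty N r f x0 (y + ?w) \<le> L2_set (\<lambda>j. ?c y j + (if j = k then norm u else 0)) {..N}"
      unfolding penalty_def
    proof (rule L2_set_mono)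
      fix j
      have "norm (apply_bcontfun y k - u - x) \<le> norm (apply_bcontfun y k - x) + norm u"
        using norm_triangle_ineq4[of "apply_bcontfun y k - x" u] by (simp add: algebra_simps)
      then show "?c (y + ?w) j \<le> ?c y j + (if j = k then norm u else 0)"
        using k by (auto simp: penalty_term_def apply_fin_unit x_def)
    qed (simp add: penalty_term_nonneg)
    also have "\<dots> \<le> F + L2_set (\<lambda>j. if j = k then norm u else 0) {..N}"
      unfolding F_def penalty_def by (rule L2_set_triangle_ineq)
    also have "L2_set (\<lambda>j. if j = k then norm u else 0) {..N} \<le> (\<Sum>j\<le>N. if j = k then norm u else 0)"
      by (rule L2_set_le_sum) simp
    also have "\<dots> = norm u" using k by simp
    finally have "penalty N r f x0 (y + ?w) \<le> F + norm u" by simp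
    moreover have "\<kappa> * norm ?w \<le> \<kappa> * norm u" using norm_fin_unit[of "Suc N" k "- u"] \<kappa> by (intro mult_left_mono) auto
    moreover have "blinfun_apply \<nu> ?w = - blinfun_apply (?\<nu> k) u"
      unfolding apply_component[symmetric] by (rule blinfun.minus_right)
    ultimately show "blinfun_apply (?\<nu> k) u \<le> (1 + \<kappa>) * norm u"
      using sub[of "y + ?w"] unfolding F_def[symmetric] by (simp add: algebra_simps)
  qed (use \<kappa> in simp)
  have "norm (l *\<^sub>R f - (\<Sum>k<N. ?\<nu> k)) \<le> r + \<kappa>"
  proof (rule norm_blinfun_bound_above)
    fix d :: 'a
    define D where "D = (\<Sum>k<N. blinfun_apply (?\<nu> k) d)"
    define A where "A = r - blinfun_apply f (x - x0) + r * norm (x - x0)"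
    define \<beta> where "\<beta> = - blinfun_apply f d + r * norm d"
    have aA: "a = max 0 A" by (simp add: a_def A_def penalty_term_def x_def)
    have "- D - \<kappa> * norm d \<le> l * \<beta>"
    proof (rule field_le_epsilon)
      fix e :: real assume e: "e > 0"
      \<comment> \<open>Chosen so that the second-order term
        \<open>\<tau> * \<beta>\<^sup>2 / (2 * F)\<close> is at most \<open>e\<close>.\<close>
      define \<tau> where "\<tau> = e * (2 * F) / (\<beta>\<^sup>2 + 1)"
      have b1: "\<beta>\<^sup>2 + 1 > 0" by (simp add: add_nonneg_pos)
      have \<tau>: "\<tau> > 0" using e F b1 by (simp add: \<tau>_def)
      define w where "w = fin_vec (Suc N) (\<lambda>_. \<tau> *\<^sub>R d)"
      have w: "apply_bcontfun w k = \<tau> *\<^sub>R d" if "k \<le> N" for k using that by (simp add: w_def)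
      have nw: "norm w \<le> \<tau> * norm d"
        unfolding w_def by (rule norm_fin_space_le[OF fin_vec_in]) (use \<tau> in auto)
      have \<nu>w: "blinfun_apply \<nu> w = \<tau> * D"
      proof -
        have "w \<in> fin_space (Suc N)" by (simp add: w_def)
        then have "blinfun_apply \<nu> w = (\<Sum>k<Suc N. blinfun_apply (?\<nu> k) (apply_bcontfun w k))" by (rule sum_components)
        also have "\<dots> = (\<Sum>k<N. \<tau> * blinfun_apply (?\<nu> k) d)" by (simp add: free w blinfun.scaleR_right)
        finally show ?thesis by (simp add: D_def sum_distrib_left)
      qed
      have ck: "?c (y + w) k = ?c y k" if "k < N" for k using that by (simp add: penalty_term_def w)
      have cN: "(?c (y + w) N)\<^sup>2 \<le> a\<^sup>2 + 2 * a * (\<tau> * \<beta>) + (\<tau> * \<beta>)\<^sup>2"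
      proof -
        have "norm (x + \<tau> *\<^sub>R d - x0) \<le> norm (x - x0) + \<tau> * norm d"
          using norm_triangle_ineq[of "x - x0" "\<tau> *\<^sub>R d"] \<tau> by (simp add: algebra_simps)
        then have "r * norm (x + \<tau> *\<^sub>R d - x0) \<le> r * (norm (x - x0) + \<tau> * norm d)" using r by (rule mult_left_mono)
        moreover have "blinfun_apply f (x + \<tau> *\<^sub>R d - x0) = blinfun_apply f (x - x0) + \<tau> * blinfun_apply f d"
          by (simp add: blinfun.add_right blinfun.diff_right blinfun.scaleR_right)
        moreover have "A + \<tau> * \<beta> = r - (blinfun_apply f (x - x0) + \<tau> * blinfun_apply f d) + r * (norm (x - x0) + \<tau> * norm d)"
          by (simp add: A_def \<beta>_def algebra_simps)
        ultimately have "r - blinfun_apply f (x + \<tau> *\<^sub>R d - x0) + r * norm (x + \<tau> *\<^sub>R d - x0) \<le> A + \<tau> * \<beta>"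
          by linarith
        then have "?c (y + w) N \<le> max 0 (A + \<tau> * \<beta>)" by (simp add: penalty_term_def w x_def)
        then have "(?c (y + w) N)\<^sup>2 \<le> (max 0 (A + \<tau> * \<beta>))\<^sup>2" by (rule power_mono) (rule penalty_term_nonneg)
        then show ?thesis using max_zero_square_le[of A "\<tau> * \<beta>"] unfolding aA by linarith
      qed
      have "(penalty N r f x0 (y + w))\<^sup>2 - F\<^sup>2 \<le> 2 * a * (\<tau> * \<beta>) + (\<tau> * \<beta>)\<^sup>2"
        unfolding F2 penalty_square B2_def using cN by (simp add: ck)
      then have "((penalty N r f x0 (y + w))\<^sup>2 - F\<^sup>2) / (2 * F) \<le> (2 * a * (\<tau> * \<beta>) + (\<tau> * \<beta>)\<^sup>2) / (2 * F)"
        using F by (intro divide_right_mono) auto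
      also have "\<dots> = \<tau> * (l * \<beta> + \<tau> * \<beta>\<^sup>2 / (2 * F))"
        using F by (simp add: l_def power2_eq_square field_simps)
      finally have "- (\<tau> * D) - \<kappa> * norm w \<le> \<tau> * (l * \<beta> + \<tau> * \<beta>\<^sup>2 / (2 * F))" using key[of w] \<nu>w by simp
      moreover have "\<kappa> * norm w \<le> \<kappa> * (\<tau> * norm d)" using nw \<kappa> by (intro mult_left_mono) auto
      ultimately have "\<tau> * (- D - \<kappa> * norm d) \<le> \<tau> * (l * \<beta> + \<tau> * \<beta>\<^sup>2 / (2 * F))" by (simp add: algebra_simps)
      then have "- D - \<kappa> * norm d \<le> l * \<beta> + \<tau> * \<beta>\<^sup>2 / (2 * F)" using \<tau> by simp
      also have "\<tau> * \<beta>\<^sup>2 / (2 * F) = e * (\<beta>\<^sup>2 / (\<beta>\<^sup>2 + 1))" using F by (simp add: \<tau>_def)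
      also have "\<dots> \<le> e * 1" using e b1 by (intro mult_left_mono) auto
      finally show "- D - \<kappa> * norm d \<le> l * \<beta> + e" by simp
    qed
    moreover have "l * (r * norm d) \<le> 1 * (r * norm d)" using l r by (intro mult_right_mono) auto
    ultimately have "l * blinfun_apply f d - D \<le> (r + \<kappa>) * norm d" by (simp add: \<beta>_def algebra_simps)
    then show "blinfun_apply (l *\<^sub>R f - (\<Sum>k<N. ?\<nu> k)) d \<le> (r + \<kappa>) * norm d"
      by (simp add: D_def blinfun.diff_left blinfun.scaleR_left blinfun.sum_left)
  qed (use r \<kappa> in simp)
  moreover have "1/64 \<le> l\<^sup>2 + (\<Sum>k<N. (norm (?\<nu> k))\<^sup>2)"
  \<comment> \<open>If \<open>l\<^sup>2 < 1/2\<close>, moving all points to \<open>x\<close> lowers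
    the penalty by more than \<open>F / 4\<close>, while the error \<open>\<kappa> * norm w\<close>
    is at most \<open>F / 8\<close>. So the components have Euclidean norm at least
    \<open>1/8\<close>, which is the origin of \<open>1/64\<close>.\<close>
  proof (cases "1/2 \<le> l\<^sup>2")
    case True
    moreover have "0 \<le> (\<Sum>k<N. (norm (?\<nu> k))\<^sup>2)" by (simp add: sum_nonneg)
    ultimately show ?thesis by linarith
  next
    case False
    define n where "n = L2_set (\<lambda>k. norm (?\<nu> k)) {..<N}"
    define w where "w = fin_vec (Suc N) (\<lambda>k. x - apply_bcontfun y k)"
    have w: "apply_bcontfun w k = x - apply_bcontfun y k" if "k \<le> N" for k using that by (simp add: w_def)
    have b: "norm (x - apply_bcontfun y k) = ?c y k" if "k < N" for k
      using that by (simp add: penalty_term_def x_def norm_minus_commute)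
    have nw: "norm w \<le> F"
      unfolding w_def
    proof (rule norm_fin_space_le[OF fin_vec_in])
      fix k assume "k < Suc N"
      then consider "k < N" | "k = N" by linarith
      then show "norm (apply_bcontfun (fin_vec (Suc N) (\<lambda>k. x - apply_bcontfun y k)) k) \<le> F"
      proof cases
        case 1
        then show ?thesis using b[OF 1] member_le_L2_set[of "{..N}" k "?c y"] by (simp add: F_def penalty_def)
      qed (use F in \<open>simp add: x_def\<close>)
    qed (use F in simp)
    have "blinfun_apply \<nu> w \<le> n * F"
    proof -
      have "w \<in> fin_space (Suc N)" by (simp add: w_def)
      then have "blinfun_apply \<nu> w = (\<Sum>k<Suc N. blinfun_apply (?\<nu> k) (apply_bcontfun w k))" by (rule sum_components)
      also have "\<dots> = (\<Sum>k<N. blinfun_apply (?\<nu> k) (x - apply_bcontfun y k))" by (simp add: free w)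
      also have "\<dots> \<le> (\<Sum>k<N. \<bar>norm (?\<nu> k)\<bar> * \<bar>?c y k\<bar>)"
      proof (rule sum_mono)
        fix k assume "k \<in> {..<N}"
        then show "blinfun_apply (?\<nu> k) (x - apply_bcontfun y k) \<le> \<bar>norm (?\<nu> k)\<bar> * \<bar>?c y k\<bar>"
          using norm_blinfun[of "?\<nu> k" "x - apply_bcontfun y k"] b[of k] penalty_term_nonneg[of N r f x0 y k]
          by (simp add: abs_le_iff)
      qed
      also have "\<dots> \<le> n * L2_set (?c y) {..<N}" unfolding n_def by (rule L2_set_mult_ineq)
      also have "L2_set (?c y) {..<N} \<le> F"
      proof (rule power2_le_imp_le)
        show "(L2_set (?c y) {..<N})\<^sup>2 \<le> F\<^sup>2" unfolding F2 by (simp add: L2_set_def B2_def sum_nonneg)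
      qed (use F in simp)
      then have "n * L2_set (?c y) {..<N} \<le> n * F" by (rule mult_left_mono) (simp add: n_def)
      finally show ?thesis .
    qed
    moreover have "(penalty N r f x0 (y + w))\<^sup>2 = a\<^sup>2"
    proof -
      have "?c (y + w) k = 0" if "k < N" for k using that by (simp add: penalty_term_def w x_def)
      moreover have "?c (y + w) N = a" by (simp add: a_def penalty_term_def w x_def)
      ultimately show ?thesis by (simp add: penalty_square)
    qed
    moreover have "\<kappa> * norm w \<le> 1/8 * F" using nw \<kappa> F by (intro mult_mono) auto
    ultimately have "- (n * F) - 1/8 * F \<le> (a\<^sup>2 - F\<^sup>2) / (2 * F)" using key[of w] by simp
    also have "\<dots> = F * ((l\<^sup>2 - 1) / 2)" using F by (simp add: l_def power2_eq_square field_simps)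
    finally have "F * (- n - 1/8) \<le> F * ((l\<^sup>2 - 1) / 2)" by (simp add: algebra_simps)
    then have "- n - 1/8 \<le> (l\<^sup>2 - 1) / 2" using F by simp
    then have "1/8 \<le> n" using False by argo
    then have "(1/8)\<^sup>2 \<le> n\<^sup>2" by (intro power_mono) auto
    also have "n\<^sup>2 = (\<Sum>k<N. (norm (?\<nu> k))\<^sup>2)" by (simp add: n_def L2_set_def sum_nonneg)
    finally show ?thesis by (simp add: power2_eq_square add_increasing)
  qed
  ultimately show ?thesis using that[OF l(1)] \<nu>1 by blast
qed

text \<open>With the norm as gauge the perturbation of the variational principle need not be
  differentiable, but it is convex and 2-Lipschitz, so it can join the convex summand of the fuzzy
  sum rule.\<close>

lemma norm_series:
  fixes w :: "nat \<Rightarrow> 'a::real_normed_vector"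
  assumes z: "summable (\<lambda>k. (1/2)^k * norm (z - w k))"
  shows summable_norm_series: "summable (\<lambda>k. (1/2)^k * norm (v - w k))"
    and norm_series_lipschitz: "\<bar>(\<Sum>k. (1/2)^k * norm (u - w k)) - (\<Sum>k. (1/2)^k * norm (v - w k))\<bar> \<le> 2 * norm (u - v)"
    and convex_norm_series: "convex_on UNIV (\<lambda>v. \<Sum>k. (1/2)^k * norm (v - w k))"
proof -
  show s: "summable (\<lambda>k. (1/2)^k * norm (v - w k))" for v
  proof (rule summable_comparison_test')
    show "summable (\<lambda>k. (1/2)^k * norm (z - w k) + (1/2)^k * norm (v - z))"
      by (intro summable_add z summable_mult2 summable_geometric) simp
    fix k :: nat
    have "norm (v - w k) \<le> norm (z - w k) + norm (v - z)" using norm_triangle_ineq[of "z - w k" "v - z"] by simp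
    then have "(1/2)^k * norm (v - w k) \<le> (1/2)^k * (norm (z - w k) + norm (v - z))" by (rule mult_left_mono) simp
    then show "norm ((1/2)^k * norm (v - w k)) \<le> (1/2)^k * norm (z - w k) + (1/2)^k * norm (v - z)"
      by (simp add: distrib_left)
  qed
  have "\<bar>(1/2)^k * norm (u - w k) - (1/2)^k * norm (v - w k)\<bar> \<le> (1/2)^k * norm (u - v)" for k
  proof -
    have "\<bar>norm (u - w k) - norm (v - w k)\<bar> \<le> norm (u - v)" using norm_triangle_ineq3[of "u - w k" "v - w k"] by simp
    then show ?thesis by (simp add: right_diff_distrib[symmetric] abs_mult divide_right_mono)
  qed
  from abs_suminf_geometric_le[OF this]
  show "\<bar>(\<Sum>k. (1/2)^k * norm (u - w k)) - (\<Sum>k. (1/2)^k * norm (v - w k))\<bar> \<le> 2 * norm (u - v)"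
    by (simp add: suminf_diff s)
  show "convex_on UNIV (\<lambda>v. \<Sum>k. (1/2)^k * norm (v - w k))"
  proof (rule convex_onI)
    fix t :: real and u v assume t: "0 < t" "t < 1"
    have le: "(1/2)^k * norm ((1 - t) *\<^sub>R u + t *\<^sub>R v - w k)
      \<le> (1 - t) * ((1/2)^k * norm (u - w k)) + t * ((1/2)^k * norm (v - w k))" for k
    proof -
      have "(1 - t) *\<^sub>R u + t *\<^sub>R v - w k = (1 - t) *\<^sub>R (u - w k) + t *\<^sub>R (v - w k)" by (simp add: algebra_simps)
      then have "norm ((1 - t) *\<^sub>R u + t *\<^sub>R v - w k) \<le> (1 - t) * norm (u - w k) + t * norm (v - w k)"
        using norm_triangle_ineq[of "(1 - t) *\<^sub>R (u - w k)" "t *\<^sub>R (v - w k)"] t by simp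
      then have "(1/2)^k * norm ((1 - t) *\<^sub>R u + t *\<^sub>R v - w k) \<le> (1/2)^k * ((1 - t) * norm (u - w k) + t * norm (v - w k))"
        by (rule mult_left_mono) simp
      then show ?thesis by (simp add: distrib_left mult.left_commute)
    qed
    have "(\<Sum>k. (1/2)^k * norm ((1 - t) *\<^sub>R u + t *\<^sub>R v - w k))
      \<le> (\<Sum>k. (1 - t) * ((1/2)^k * norm (u - w k)) + t * ((1/2)^k * norm (v - w k)))"
      by (intro suminf_le le s summable_add summable_mult)
    also have "\<dots> = (1 - t) * (\<Sum>k. (1/2)^k * norm (u - w k)) + t * (\<Sum>k. (1/2)^k * norm (v - w k))"
      by (simp add: suminf_add[symmetric] suminf_mult s summable_mult del: power_divide)
    finally show "(\<Sum>k. (1/2)^k * norm ((1 - t) *\<^sub>R u + t *\<^sub>R v - w k))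
      \<le> (1 - t) * (\<Sum>k. (1/2)^k * norm (u - w k)) + t * (\<Sum>k. (1/2)^k * norm (v - w k))" .
  qed simp
qed

text \<open>At the constant tuple \<open>x0\<close> the penalty is \<open>r\<close>, so
  \<open>x0\<close> minimises it up to \<open>r\<close>. The variational principle moves to a nearby
  minimiser of the perturbed penalty, still inside the region where the rated inequality forces the
  penalty to be positive, as \<open>penalty_subgradient\<close> requires.\<close>

theorem rated_normal_approximation:
  fixes \<Omega> :: "'i \<Rightarrow> 'a::banach set" and f :: "'a \<Rightarrow>\<^sub>L real"
  assumes asplund: "asplund_space TYPE('a)"
    and \<rho>: "\<rho> > 0" and closed: "\<And>i. i \<in> T \<Longrightarrow> closed (\<Omega> i \<inter> cball xb \<rho>)" and xh: "norm (xh - xb) < \<rho> / 4"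
    and R: "rate_function R" and rated: "rated_normal R T \<Omega> xh f" and t: "t > 0"
  obtains I l x ys where "finite I" "I \<subseteq> T" "0 \<le> l" "\<And>i. i \<in> I \<Longrightarrow> norm (x i - xh) \<le> t"
    "\<And>i. i \<in> I \<Longrightarrow> ys i \<in> frechet_normals (x i) (\<Omega> i)" "\<And>i. i \<in> I \<Longrightarrow> norm (ys i) \<le> 1"
    "norm (l *\<^sub>R f - (\<Sum>i\<in>I. ys i)) \<le> t" "1/256 \<le> l\<^sup>2 + (\<Sum>i\<in>I. (norm (ys i))\<^sup>2)"
proof -
  \<comment> \<open>The bound \<open>\<rho> / 4\<close> keeps the points where the sets are closed,
    and \<open>1/16\<close> ensures \<open>\<kappa> \<le> 1/8\<close>.\<close>
  define t' where "t' = min (t / 2) (min (\<rho> / 4) (1/16))"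
  have t': "t' > 0" "t' \<le> t / 2" "t' \<le> \<rho> / 4" "t' \<le> 1/16" using t \<rho> by (auto simp: t'_def)
  obtain J where J: "\<forall>\<^sub>F r in at_right 0. finite (J r) \<and> J r \<subseteq> T \<and>
      (\<forall>x \<in> (\<Inter>i\<in>J r. \<Omega> i) \<inter> cball xh (r * R r). blinfun_apply f (x - xh) - r * norm (x - xh) < r)"
    and xh\<Omega>: "\<And>i. i \<in> T \<Longrightarrow> xh \<in> \<Omega> i"
    using rated unfolding rated_normal_def by blast
  have "\<forall>\<^sub>F r in at_right 0. 16 / t' \<le> R r"
    using R unfolding rate_function_def filterlim_at_top by blast
  moreover have "\<forall>\<^sub>F r in at_right 0. 0 < r \<and> r < min t' (t'\<^sup>2 / 8)"
    using t'(1) by (intro eventually_conj eventually_at_right_less eventually_at_right[THEN iffD2]) (auto intro!: exI[of _ "min t' (t'\<^sup>2 / 8)"])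
  ultimately have "\<forall>\<^sub>F r in at_right 0. (0 < r \<and> r < min t' (t'\<^sup>2 / 8)) \<and> 16 / t' \<le> R r \<and> finite (J r) \<and> J r \<subseteq> T \<and>
      (\<forall>x \<in> (\<Inter>i\<in>J r. \<Omega> i) \<inter> cball xh (r * R r). blinfun_apply f (x - xh) - r * norm (x - xh) < r)"
    using J by eventually_elim blast
  from eventually_happens'[OF trivial_limit_at_right_real this]
  obtain r where r: "0 < r" "r < t'" "r < t'\<^sup>2 / 8" and Rr: "16 / t' \<le> R r"
    and I: "finite (J r)" "J r \<subseteq> T"
    and rn: "\<And>x. (\<And>i. i \<in> J r \<Longrightarrow> x \<in> \<Omega> i) \<Longrightarrow> norm (x - xh) \<le> r * R r \<Longrightarrow> blinfun_apply f (x - xh) - r * norm (x - xh) < r"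
    by (auto simp: dist_norm norm_minus_commute)
  have Rpos: "R r > 0" using Rr t'(1) by (intro less_le_trans[OF _ Rr]) simp
  \<comment> \<open>Since \<open>s * norm (z - x0) \<le> r\<close>, the first summand confines the
    minimiser to the radius \<open>r * R r / 2\<close> and the second to \<open>t'\<close>. The
    conditions on \<open>r\<close> and \<open>R r\<close> make each summand at most
    \<open>t' / 8\<close>.\<close>
  define s where "s = 2 / R r + r / t'"
  have s: "s > 0" using Rpos r t' by (simp add: s_def add_pos_pos)
  have s_le: "s \<le> t' / 4"
  proof -
    have "16 \<le> R r * t'" using Rr t'(1) by (simp add: divide_le_eq)
    then have "2 / R r \<le> t' / 8" using Rpos by (simp add: divide_le_eq mult.commute)
    moreover have "r / t' \<le> t' / 8" using r(3) t'(1) by (simp add: divide_le_eq power2_eq_square)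
    ultimately show ?thesis unfolding s_def by linarith
  qed
  define N where "N = card (J r)"
  obtain e where e: "bij_betw e {..<N} (J r)"
    using ex_bij_betw_nat_finite[OF I(1)] by (auto simp: N_def atLeast0LessThan)
  have eT: "e k \<in> J r" "e k \<in> T" if "k < N" for k using e that I(2) by (auto simp: bij_betw_def)
  define S where "S = {z \<in> fin_space (Suc N). \<forall>k<N. apply_bcontfun z k \<in> \<Omega> (e k) \<inter> cball xb \<rho>}"
  have S: "closed S"
  proof -
    have "S = fin_space (Suc N) \<inter> (\<Inter>k\<in>{..<N}. (\<lambda>z. apply_bcontfun z k) -` (\<Omega> (e k) \<inter> cball xb \<rho>))"
      by (auto simp: S_def)
    also have "closed \<dots>"
      by (intro closed_Int closed_fin_space closed_INT ballI closed_vimage closed eT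
          linear_continuous_on bounded_linear_apply_bcontfun) simp
    finally show ?thesis .
  qed
  define x0 where "x0 = fin_vec (Suc N) (\<lambda>_. xh)"
  have x0k: "apply_bcontfun x0 k = xh" if "k \<le> N" for k using that by (simp add: x0_def)
  have x0: "x0 \<in> S"
    using xh xh\<Omega> eT \<rho> by (auto simp: S_def x0_def dist_norm norm_minus_commute)
  define pen where "pen = penalty N r f xh"
  have pen0: "pen x0 = r"
  proof -
    have "penalty_term N r f xh x0 k = 0" if "k < N" for k using that by (simp add: penalty_term_def x0k)
    moreover have "penalty_term N r f xh x0 N = r" using r by (simp add: penalty_term_def x0k blinfun.zero_right)
    ultimately have "(pen x0)\<^sup>2 = r\<^sup>2" by (simp add: pen_def penalty_square)
    then show ?thesis using r penalty_nonneg[of N r f xh x0] by (simp add: pen_def)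
  qed
  define L where "L = (2 + norm f + r) * (real N + 1)"
  have L: "L > 0" 
    unfolding L_def using r(1) by (intro mult_pos_pos add_nonneg_pos) (auto simp: add_pos_nonneg)
  have penL: "\<bar>pen v - pen w\<bar> \<le> L * norm (v - w)" for v w
    unfolding pen_def L_def using r by (intro penalty_lipschitz) simp
  have pen_cont: "continuous_on S pen"
    using penL L by (intro lipschitz_on_continuous_on[of L]) (auto simp: lipschitz_on_def dist_norm dist_real_def)
  have qL: "\<bar>norm (x - w) - norm (y - w)\<bar> \<le> 1 * norm (x - y)" for x y w :: "nat \<Rightarrow>\<^sub>C 'a"
    using norm_triangle_ineq3[of "x - w" "y - w"] by simp
  have qs: "\<exists>d>0. \<forall>x\<in>S. \<forall>y\<in>S. norm (x - y) < d \<longrightarrow> norm (x - y) < e" if "e > 0" for e using that by blast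
  have pen_nonneg: "0 \<le> pen x" for x by (simp add: pen_def penalty_nonneg)
  obtain z w where z: "z \<in> S" and near: "pen z + s * norm (z - x0) \<le> pen x0"
    and sm: "\<And>x. x \<in> S \<Longrightarrow> summable (\<lambda>k. (1/2)^k * norm (x - w k))"
    and opt: "\<And>x. x \<in> S \<Longrightarrow> pen z + s * (\<Sum>k. (1/2)^k * norm (z - w k)) \<le> pen x + s * (\<Sum>k. (1/2)^k * norm (x - w k))"
  proof (rule variational_principle[of S pen x0 0 s norm 1])
    show "\<bar>norm (x - w) - norm (y - w)\<bar> \<le> 1 * norm (x - y)" for x y w :: "nat \<Rightarrow>\<^sub>C 'a" by (rule qL)
    show "\<exists>d>0. \<forall>x\<in>S. \<forall>y\<in>S. norm (x - y) < d \<longrightarrow> norm (x - y) < e" if "e > 0" for e using that by (rule qs)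
  qed (use S pen_cont x0 pen_nonneg s in \<open>auto intro: that\<close>)
  have zr: "s * norm (z - x0) \<le> r" using near pen0 pen_nonneg[of z] by linarith
  have z_dist: "norm (z - x0) \<le> c" if "r \<le> s * c" for c
    using order_trans[OF zr that] s by simp
  have zt': "norm (z - x0) \<le> t'"
  proof (rule z_dist)
    have "r = r / t' * t'" using t'(1) by simp
    also have "\<dots> \<le> s * t'" using Rpos t'(1) by (intro mult_right_mono) (auto simp: s_def)
    finally show "r \<le> s * t'" .
  qed
  have zR: "norm (z - x0) \<le> r * R r / 2"
  proof (rule z_dist)
    have "r = 2 / R r * (r * R r / 2)" using Rpos by simp
    also have "\<dots> \<le> s * (r * R r / 2)" using Rpos r t'(1) by (intro mult_right_mono) (auto simp: s_def)
    finally show "r \<le> s * (r * R r / 2)" .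
  qed
  have pen_z: "pen z > 0"
  proof (rule ccontr)
    assume "\<not> ?thesis"
    then have "pen z = 0" using pen_nonneg[of z] by simp
    then have c0: "penalty_term N r f xh z k = 0" if "k \<le> N" for k
      using that unfolding pen_def penalty_def by (simp add: L2_set_eq_0_iff)
    define x where "x = apply_bcontfun z N"
    have zx: "apply_bcontfun z k = x" if "k < N" for k using c0[of k] that by (simp add: penalty_term_def x_def)
    have "x \<in> \<Omega> i" if "i \<in> J r" for i
    proof -
      have "i \<in> e ` {..<N}" using e that by (simp add: bij_betw_def)
      then obtain k where "k < N" "i = e k" by blast
      then show ?thesis using z zx by (auto simp: S_def)
    qed
    moreover have "norm (x - xh) \<le> r * R r"
    proof -
      have "norm (x - xh) \<le> norm (z - x0)" using norm_bounded[of "z - x0" N] by (simp add: x_def x0k)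
      also have "\<dots> \<le> r * R r / 2" by (rule zR)
      also have "\<dots> \<le> r * R r" using r Rpos by simp
      finally show ?thesis .
    qed
    ultimately have "blinfun_apply f (x - xh) - r * norm (x - xh) < r" by (rule rn)
    then show False using c0[of N] by (simp add: penalty_term_def x_def)
  qed
  define \<Delta> where "\<Delta> v = (\<Sum>k. (1/2)^k * norm (v - w k))" for v
  define g where "g v = pen v + s * \<Delta> v" for v
  have \<Delta>L: "\<bar>\<Delta> u - \<Delta> v\<bar> \<le> 2 * norm (u - v)" for u v unfolding \<Delta>_def by (rule norm_series_lipschitz[OF sm[OF z]])
  have s\<Delta>L: "\<bar>s * \<Delta> u - s * \<Delta> v\<bar> \<le> 2 * s * norm (u - v)" for u v
    using mult_left_mono[OF \<Delta>L[of u v], of s] s by (simp add: right_diff_distrib[symmetric] abs_mult)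
  have g: "convex_on UNIV g"
    unfolding g_def pen_def \<Delta>_def using s r
    by (intro convex_on_add convex_on_cmul convex_penalty convex_norm_series[OF sm[OF z]]) auto
  have gL: "\<bar>g u - g v\<bar> \<le> (L + 2 * s) * norm (u - v)" for u v
    using penL[of u v] s\<Delta>L[of u v] unfolding g_def distrib_right by linarith
  \<comment> \<open>The second bound keeps the penalty positive at \<open>y'\<close>, the point of
    its approximate subgradient.\<close>
  define \<eta> where "\<eta> = min (t' / 2) (pen z / (2 * L))"
  have \<eta>: "\<eta> > 0" "\<eta> \<le> t' / 2" using t' pen_z L by (auto simp: \<eta>_def)
  have "\<eta> \<le> pen z / (2 * L)" by (simp add: \<eta>_def)
  then have L\<eta>: "L * \<eta> < pen z" using L pen_z mult_left_mono[of \<eta> "pen z / (2 * L)" L] by simp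
  have gauge: "\<exists>p. smooth_gauge (closure C) p"
    if "countable C" "subspace (closure C)" "closure C \<subseteq> fin_space (Suc N)" for C :: "(nat \<Rightarrow>\<^sub>C 'a) set"
    using smooth_gauge_fin_space[OF asplund that] .
  have SV: "S \<subseteq> fin_space (Suc N)" by (auto simp: S_def)
  have min: "0 + g z \<le> 0 + g x" if "x \<in> S" for x using opt[OF that] by (simp add: g_def \<Delta>_def)
  obtain y y' \<nu> where y: "y \<in> S" "norm (y - z) < \<eta>" "norm (y' - z) < \<eta>"
    and sub: "subgradient_on S (\<lambda>_. 0) y (blinfun_apply \<nu>)"
    and conv: "\<And>v. g y' - blinfun_apply \<nu> (v - y') - \<eta> * norm (v - y') \<le> g v"
    by (rule fuzzy_sum_rule[where h = "\<lambda>_. 0", OF subspace_fin_space closed_fin_space SV gauge S continuous_on_const g gL z min \<eta>(1)];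
        (rule that; assumption)?)
  \<comment> \<open>The perturbation \<open>s * \<Delta>\<close> is absorbed into the error through
    its Lipschitz constant \<open>2 * s\<close>.\<close>
  define \<kappa> where "\<kappa> = \<eta> + 2 * s"
  have \<kappa>: "0 \<le> \<kappa>" "\<kappa> \<le> 1/8" "\<kappa> \<le> t'" using \<eta> s s_le t'(4) by (auto simp: \<kappa>_def)
  have pen_y': "pen y' > 0"
  proof -
    have "L * norm (z - y') \<le> L * \<eta>" using y(3) L by (intro mult_left_mono) (auto simp: norm_minus_commute)
    then show ?thesis using penL[of z y'] L\<eta> by (simp add: abs_le_iff)
  qed
  have psub: "pen y' - blinfun_apply \<nu> (v - y') - \<kappa> * norm (v - y') \<le> pen v" for v
    using conv[of v] s\<Delta>L[of v y'] unfolding g_def \<kappa>_def distrib_right by (simp add: abs_le_iff)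
  have move: "apply_bcontfun (y + fin_unit (Suc N) k u) j = (if j = k then apply_bcontfun y k + u else apply_bcontfun y j)"
    if "k \<le> N" for k j u using that by (simp add: apply_fin_unit)
  have yS: "apply_bcontfun y k \<in> \<Omega> (e k)" "apply_bcontfun y k \<in> cball xb \<rho>" if "k < N" for k
    using y(1) that by (auto simp: S_def)
  have y_unit: "y + fin_unit (Suc N) k u \<in> fin_space (Suc N)" for k u
    using y(1) by (intro subspace_add[OF subspace_fin_space]) (auto simp: S_def)
  \<comment> \<open>The last coordinate is unconstrained in \<open>S\<close>, so its component is
    normal to the whole space.\<close>
  have "component (Suc N) \<nu> N \<in> frechet_normals (apply_bcontfun y N) UNIV"
  proof (rule component_normal[OF sub UNIV_I zero_less_one])
    fix u
    show "y + fin_unit (Suc N) N (u - apply_bcontfun y N) \<in> S \<and> (0::real) = 0"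
      using y_unit yS move[of N] unfolding S_def by auto
  qed
  then have free: "component (Suc N) \<nu> N = 0" by (rule frechet_normal_interior_zero)
  have ydist: "norm (apply_bcontfun y k - xh) \<le> t' + \<eta>" if "k \<le> N" for k
  proof -
    have "norm (apply_bcontfun y k - xh) \<le> norm (y - x0)" using norm_bounded[of "y - x0" k] that by (simp add: x0k)
    also have "\<dots> \<le> norm (y - z) + norm (z - x0)" using norm_triangle_ineq[of "y - z" "z - x0"] by simp
    finally show ?thesis using y(2) zt' by simp
  qed
  have normal: "component (Suc N) \<nu> k \<in> frechet_normals (apply_bcontfun y k) (\<Omega> (e k))" if k: "k < N" for k
  \<comment> \<open>The radii add up to less than \<open>\<rho>\<close>: \<open>\<rho> / 4\<close>
    for \<open>u\<close>, at most \<open>\<rho> / 4 + \<rho> / 8\<close> from \<open>ydist\<close>,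
    and \<open>\<rho> / 4\<close> for \<open>xh\<close>. So the ball around \<open>xb\<close> does
    not restrict \<open>u\<close>.\<close>
  proof (rule component_normal[OF sub yS(1)[OF k], of "\<rho> / 4"])
    fix u assume u: "u \<in> \<Omega> (e k)" "norm (u - apply_bcontfun y k) < \<rho> / 4"
    have "norm (u - xb) \<le> norm (u - apply_bcontfun y k) + norm (apply_bcontfun y k - xh) + norm (xh - xb)"
      using norm_triangle_ineq[of "u - apply_bcontfun y k" "apply_bcontfun y k - xh"]
        norm_triangle_ineq[of "u - xh" "xh - xb"] by simp
    also have "\<dots> \<le> \<rho>" using u(2) ydist[of k] k \<eta>(2) t'(1,3) xh by simp
    finally have "u \<in> cball xb \<rho>" by (simp add: dist_norm norm_minus_commute)
    then show "y + fin_unit (Suc N) k (u - apply_bcontfun y k) \<in> S \<and> (0::real) = 0"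
      using y_unit yS move[of k] k u(1) unfolding S_def by auto
  qed (use \<rho> in simp)
  obtain l where l: "0 \<le> l" "norm (l *\<^sub>R f - (\<Sum>k<N. component (Suc N) \<nu> k)) \<le> r + \<kappa>"
    "\<And>k. k < N \<Longrightarrow> norm (component (Suc N) \<nu> k) \<le> 1 + \<kappa>"
    "1/64 \<le> l\<^sup>2 + (\<Sum>k<N. (norm (component (Suc N) \<nu> k))\<^sup>2)"
    using penalty_subgradient[OF less_imp_le[OF r(1)] \<kappa>(1,2) pen_y'[unfolded pen_def] psub[unfolded pen_def] free] by blast
  define c where "c = inv_into {..<N} e"
  have c: "c (e k) = k" if "k < N" for k using e that by (simp add: c_def bij_betw_def inv_into_f_f)
  have cI: "c i < N" "e (c i) = i" if "i \<in> J r" for i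
    using e that bij_betw_inv_into_right[OF e that] inv_into_into[of i e "{..<N}"] by (auto simp: c_def bij_betw_def)
  \<comment> \<open>The components have norm at most \<open>1 + \<kappa>\<close>; halving brings
    them into the unit ball prescribed by the qualification condition and lowers \<open>1/64\<close>
    to \<open>1/256\<close>.\<close>
  define ys where "ys i = (1/2) *\<^sub>R component (Suc N) \<nu> (c i)" for i
  have reindex: "(\<Sum>i\<in>J r. F (c i)) = (\<Sum>k<N. F k)" for F :: "nat \<Rightarrow> 'z::comm_monoid_add"
    using sum.reindex_bij_betw[OF e, of "\<lambda>i. F (c i)"] c by (metis (no_types, lifting) lessThan_iff sum.cong)
  show ?thesis
  proof (rule that[of "J r" "l / 2" "\<lambda>i. apply_bcontfun y (c i)" ys])
    show "norm (apply_bcontfun y (c i) - xh) \<le> t" if "i \<in> J r" for i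
      using ydist[of "c i"] cI[OF that] \<eta>(2) t'(1,2) by simp
    show "ys i \<in> frechet_normals (apply_bcontfun y (c i)) (\<Omega> i)" if "i \<in> J r" for i
      unfolding ys_def using normal[of "c i"] cI[OF that] by (intro frechet_normals_scaleR) auto
    show "norm (ys i) \<le> 1" if "i \<in> J r" for i
      unfolding ys_def using l(3)[of "c i"] cI[OF that] \<kappa>(2) by simp
    show "norm ((l / 2) *\<^sub>R f - (\<Sum>i\<in>J r. ys i)) \<le> t"
    proof -
      have "(l / 2) *\<^sub>R f - (\<Sum>i\<in>J r. ys i) = (1/2) *\<^sub>R (l *\<^sub>R f - (\<Sum>k<N. component (Suc N) \<nu> k))"
        unfolding ys_def scaleR_sum_right[symmetric] reindex by (simp add: scaleR_diff_right)
      then show ?thesis using l(2) r(2) \<kappa>(3) t'(1,2) by simp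
    qed
    have "(\<Sum>i\<in>J r. (norm (ys i))\<^sup>2) = (\<Sum>k<N. (norm ((1/2) *\<^sub>R component (Suc N) \<nu> k))\<^sup>2)"
      unfolding ys_def by (rule reindex)
    also have "\<dots> = (\<Sum>k<N. (norm (component (Suc N) \<nu> k))\<^sup>2) / 4"
      by (simp add: power_divide sum_divide_distrib)
    finally show "1/256 \<le> (l / 2)\<^sup>2 + (\<Sum>i\<in>J r. (norm (ys i))\<^sup>2)" using l(4) by (simp add: power_divide)
  qed (use I l(1) in auto)
qed

section \<open>Limiting rated normals and optimality\<close>

text \<open>It suffices that members of the set occur among the \<open>fk k\<close> beyond every
  index. The threshold for the multiplier is \<open>t j / \<epsilon>\<close>: after division by a
  larger \<open>l j\<close> the error is at most \<open>\<epsilon>\<close>, which would make the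
  functional a member.\<close>

theorem limiting_rated_normal_in_closure:
  fixes \<Omega> :: "'i \<Rightarrow> 'a::banach set"
  assumes asplund: "asplund_space TYPE('a)" and closed: "system_closed_around T \<Omega> xb"
    and aqc: "approximate_qualification T \<Omega> xb" and lim: "limiting_rated_normal T \<Omega> xb f" and \<epsilon>: "\<epsilon> > 0"
  shows "f \<in> weak_star_topology closure_of approximate_normal_sums T \<Omega> xb \<epsilon>"
proof -
  let ?A = "approximate_normal_sums T \<Omega> xb \<epsilon>"
  obtain \<rho> where \<rho>: "\<rho> > 0" "\<And>i. i \<in> T \<Longrightarrow> closed (\<Omega> i \<inter> cball xb \<rho>)"
    using closed unfolding system_closed_around_def by blast
  obtain x fk where x: "x \<longlonglongrightarrow> xb" and fk: "limitin weak_star_topology fk f sequentially"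
    and rated: "\<And>k. \<exists>R. rate_function R \<and> rated_normal R T \<Omega> (x k) (fk k)"
    using lim unfolding limiting_rated_normal_def by blast
  have freq: "\<exists>k\<ge>N. fk k \<in> ?A" for N
  proof (rule ccontr)
    assume "\<not> ?thesis"
    then have notA: "fk k \<notin> ?A" if "k \<ge> N" for k using that by blast
    define u where "u j = inverse (real (Suc j))" for j
    have u: "u j > 0" for j by (simp add: u_def)
    have "\<exists>k\<ge>N. norm (x k - xb) < min (\<rho> / 4) (min (\<epsilon> / 2) (u j / 2))" for j
    proof -
      have "min (\<rho> / 4) (min (\<epsilon> / 2) (u j / 2)) > 0" using \<rho>(1) \<epsilon> u by simp
      then obtain M where "\<And>k. k \<ge> M \<Longrightarrow> norm (x k - xb) < min (\<rho> / 4) (min (\<epsilon> / 2) (u j / 2))"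
        using x unfolding LIMSEQ_iff by blast
      then show ?thesis by (intro exI[of _ "max M N"]) simp
    qed
    then have "\<exists>\<kappa>. \<forall>j. \<kappa> j \<ge> N \<and> norm (x (\<kappa> j) - xb) < min (\<rho> / 4) (min (\<epsilon> / 2) (u j / 2))"
      by (intro choice) blast
    then obtain \<kappa> where \<kappa>: "\<And>j. \<kappa> j \<ge> N" "\<And>j. norm (x (\<kappa> j) - xb) < min (\<rho> / 4) (min (\<epsilon> / 2) (u j / 2))" by blast
    \<comment> \<open>The three bounds serve the distance to \<open>xb\<close>, the norm of the sum
      of the normals, and the product \<open>l j * norm (fk (\<kappa> j))\<close>, which has to be
      at most \<open>u j\<close> whatever the size of the norm.\<close>
    define t where "t j = min (\<epsilon> / 2) (min (u j / 2) (\<epsilon> * u j / (1 + norm (fk (\<kappa> j)))))" for j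
    have M: "1 + norm (fk (\<kappa> j)) > 0" for j by (simp add: add_pos_nonneg)
    have t: "t j > 0" "t j \<le> \<epsilon> / 2" "t j \<le> u j / 2" "t j \<le> \<epsilon> * u j / (1 + norm (fk (\<kappa> j)))" for j
    proof -
      show "t j > 0" using \<epsilon> u[of j] M[of j] by (simp add: t_def)
    qed (simp_all only: t_def min_le_iff_disj order_refl simp_thms)
    define approx where "approx j Z \<longleftrightarrow> (case Z of (I, l, y, ys) \<Rightarrow> finite I \<and> I \<subseteq> T \<and> 0 \<le> l \<and>
        (\<forall>i\<in>I. norm (y i - x (\<kappa> j)) \<le> t j \<and> ys i \<in> frechet_normals (y i) (\<Omega> i) \<and> norm (ys i) \<le> 1) \<and>
        norm (l *\<^sub>R fk (\<kappa> j) - (\<Sum>i\<in>I. ys i)) \<le> t j \<and> 1/256 \<le> l\<^sup>2 + (\<Sum>i\<in>I. (norm (ys i))\<^sup>2))"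
      for j and Z :: "'i set \<times> real \<times> ('i \<Rightarrow> 'a) \<times> ('i \<Rightarrow> 'a \<Rightarrow>\<^sub>L real)"
    have "\<exists>Z. approx j Z" for j
    proof -
      obtain R where R: "rate_function R" "rated_normal R T \<Omega> (x (\<kappa> j)) (fk (\<kappa> j))" using rated by blast
      have near: "norm (x (\<kappa> j) - xb) < \<rho> / 4" using \<kappa>(2)[of j] by simp
      obtain I l y ys where "finite I" "I \<subseteq> T" "0 \<le> l" "\<And>i. i \<in> I \<Longrightarrow> norm (y i - x (\<kappa> j)) \<le> t j"
        "\<And>i. i \<in> I \<Longrightarrow> ys i \<in> frechet_normals (y i) (\<Omega> i)" "\<And>i. i \<in> I \<Longrightarrow> norm (ys i) \<le> 1"
        "norm (l *\<^sub>R fk (\<kappa> j) - (\<Sum>i\<in>I. ys i)) \<le> t j" "1/256 \<le> l\<^sup>2 + (\<Sum>i\<in>I. (norm (ys i))\<^sup>2)"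
        by (rule rated_normal_approximation[OF asplund \<rho> near R t(1)]; (rule that; assumption)?)
      then have "approx j (I, l, y, ys)" by (simp add: approx_def)
      then show ?thesis by blast
    qed
    then have "\<exists>Z. \<forall>j. approx j (Z j)" by (intro choice) blast
    then obtain Z where Z: "\<And>j. approx j (Z j)" by blast
    define I l y ys where "I j = fst (Z j)" and "l j = fst (snd (Z j))" and "y j = fst (snd (snd (Z j)))"
      and "ys j = snd (snd (snd (Z j)))" for j
    have I: "finite (I j)" "I j \<subseteq> T" and l: "0 \<le> l j"
      and yb: "i \<in> I j \<Longrightarrow> norm (y j i - x (\<kappa> j)) \<le> t j"
      and ysN: "i \<in> I j \<Longrightarrow> ys j i \<in> frechet_normals (y j i) (\<Omega> i)" and ys1: "i \<in> I j \<Longrightarrow> norm (ys j i) \<le> 1"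
      and sum: "norm (l j *\<^sub>R fk (\<kappa> j) - (\<Sum>i\<in>I j. ys j i)) \<le> t j"
      and low: "1/256 \<le> (l j)\<^sup>2 + (\<Sum>i\<in>I j. (norm (ys j i))\<^sup>2)" for j i
      using Z[of j] unfolding approx_def I_def l_def y_def ys_def by (auto split: prod.splits)
    have yxb: "norm (y j i - xb) \<le> t j + norm (x (\<kappa> j) - xb)" if "i \<in> I j" for i j
      using yb[OF that] norm_triangle_ineq[of "y j i - x (\<kappa> j)" "x (\<kappa> j) - xb"] by simp
    have l_le: "l j \<le> t j / \<epsilon>" for j
    proof (rule ccontr)
      assume "\<not> ?thesis"
      then have l_gt: "t j / \<epsilon> < l j" by simp
      have lpos: "0 < l j" using l_gt t(1)[of j] \<epsilon> by (meson divide_pos_pos less_trans)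
      define b where "b = (1 / (\<epsilon> * l j)) *\<^sub>R (l j *\<^sub>R fk (\<kappa> j) - (\<Sum>i\<in>I j. ys j i))"
      have "norm b \<le> 1 / (\<epsilon> * l j) * t j" unfolding b_def using sum[of j] \<epsilon> lpos by (simp add: divide_right_mono)
      also have "\<dots> \<le> 1" using l_gt \<epsilon> lpos by (simp add: divide_le_eq divide_less_eq mult.commute)
      finally have b: "b \<in> cball 0 1" by simp
      have eq: "fk (\<kappa> j) = (\<Sum>i\<in>I j. (1 / l j) *\<^sub>R ys j i) + \<epsilon> *\<^sub>R b"
        unfolding b_def scaleR_sum_right[symmetric] using \<epsilon> lpos by (simp add: scaleR_diff_right)
      have "fk (\<kappa> j) \<in> ?A"
        unfolding approximate_normal_sums_def
      proof (intro CollectI exI conjI)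
        show "\<forall>i\<in>I j. (1 / l j) *\<^sub>R ys j i \<in> frechet_normals (y j i) (\<Omega> i) \<and> norm (y j i - xb) < \<epsilon>"
        proof (intro ballI conjI)
          fix i assume i: "i \<in> I j"
          show "(1 / l j) *\<^sub>R ys j i \<in> frechet_normals (y j i) (\<Omega> i)"
            using ysN[OF i] lpos by (intro frechet_normals_scaleR) auto
          show "norm (y j i - xb) < \<epsilon>" using yxb[OF i] t(2)[of j] \<kappa>(2)[of j] by simp
        qed
      qed (use eq b I in auto)
      then show False using notA[OF \<kappa>(1)] by blast
    qed
    have lf: "l j * (1 + norm (fk (\<kappa> j))) \<le> u j" for j
    proof -
      have "l j \<le> \<epsilon> * u j / (1 + norm (fk (\<kappa> j))) / \<epsilon>"
        using l_le[of j] divide_right_mono[OF t(4)[of j], of \<epsilon>] \<epsilon> by simp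
      also have "\<dots> = u j / (1 + norm (fk (\<kappa> j)))" using \<epsilon> by simp
      finally show ?thesis using M[of j] by (simp add: le_divide_eq)
    qed
    have l_u: "l j \<le> u j" and lf_u: "l j * norm (fk (\<kappa> j)) \<le> u j" for j
      using lf[of j] l[of j] mult_nonneg_nonneg[OF l[of j] norm_ge_zero[of "fk (\<kappa> j)"]]
      unfolding distrib_left mult_1_right by linarith+
    have u0: "u \<longlonglongrightarrow> 0" unfolding u_def by (rule LIMSEQ_inverse_real_of_nat)
    have "(\<lambda>j. norm (\<Sum>i\<in>I j. ys j i)) \<longlonglongrightarrow> 0"
    proof (rule Lim_null_comparison)
      show "(\<lambda>j. 2 * u j) \<longlonglongrightarrow> 0" using tendsto_mult_left[OF u0, of 2] by simp
      have "norm (\<Sum>i\<in>I j. ys j i) \<le> 2 * u j" for j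
      proof -
        have "norm (\<Sum>i\<in>I j. ys j i) \<le> norm (l j *\<^sub>R fk (\<kappa> j)) + norm (l j *\<^sub>R fk (\<kappa> j) - (\<Sum>i\<in>I j. ys j i))"
          using norm_triangle_ineq4[of "l j *\<^sub>R fk (\<kappa> j)" "l j *\<^sub>R fk (\<kappa> j) - (\<Sum>i\<in>I j. ys j i)"] by simp
        then show ?thesis using sum[of j] lf_u[of j] t(3)[of j] u[of j] l[of j] by simp
      qed
      then show "\<forall>\<^sub>F j in sequentially. norm (norm (\<Sum>i\<in>I j. ys j i)) \<le> 2 * u j" by simp
    qed
    moreover have "decreases_to_zero u"
      unfolding decreases_to_zero_def using u u0 by (auto simp: decseq_def u_def)
    moreover have "\<forall>j. \<forall>i\<in>I j. ys j i \<in> frechet_normals (y j i) (\<Omega> i) \<inter> cball 0 1 \<and> norm (y j i - xb) \<le> u j"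
    proof (intro allI ballI conjI)
      fix j i assume i: "i \<in> I j"
      show "ys j i \<in> frechet_normals (y j i) (\<Omega> i) \<inter> cball 0 1" using ysN[OF i] ys1[OF i] by simp
      show "norm (y j i - xb) \<le> u j" using yxb[OF i] t(3)[of j] \<kappa>(2)[of j] by simp
    qed
    ultimately have "(\<lambda>j. \<Sum>i\<in>I j. (norm (ys j i))\<^sup>2) \<longlonglongrightarrow> 0"
      using aqc[unfolded approximate_qualification_def, THEN spec[of _ u], THEN spec[of _ I], THEN spec[of _ y], THEN spec[of _ ys]]
        I by blast
    moreover have "l \<longlonglongrightarrow> 0"
      by (rule Lim_null_comparison[OF _ u0]) (use l l_u in \<open>auto intro!: always_eventually\<close>)
    ultimately have "(\<lambda>j. (l j)\<^sup>2 + (\<Sum>i\<in>I j. (norm (ys j i))\<^sup>2)) \<longlonglongrightarrow> 0\<^sup>2 + 0" by (intro tendsto_intros)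
    then have "1/256 \<le> (0::real)\<^sup>2 + 0" by (rule LIMSEQ_le_const) (use low in blast)
    then show False by simp
  qed
  show ?thesis
    unfolding in_closure_of
  proof (intro conjI allI impI)
    fix U assume U: "f \<in> U \<and> openin weak_star_topology U"
    then have "\<forall>\<^sub>F k in sequentially. fk k \<in> U" using limitinD[OF fk] by blast
    then obtain N where "\<And>k. k \<ge> N \<Longrightarrow> fk k \<in> U" unfolding eventually_sequentially by blast
    then show "\<exists>y. y \<in> ?A \<and> y \<in> U" using freq[of N] by blast
  qed (simp add: strong_operator_topology_topspace)
qed

section \<open>From optimal solutions to basic normals\<close>

lemma frechet_normals_subset_eps_normals:
  assumes "0 \<le> e" shows "frechet_normals x S \<subseteq> eps_normals e x S"
  using assms unfolding frechet_normals_def eps_normals_def by (auto intro: order_trans)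

lemma basic_normalI:
  assumes "x \<longlonglongrightarrow> xb" "limitin weak_star_topology f l sequentially" "\<And>k. f k \<in> frechet_normals (x k) S"
  shows "l \<in> basic_normals xb S"
proof -
  have "decreases_to_zero (\<lambda>k. inverse (real (Suc k)))"
    unfolding decreases_to_zero_def using LIMSEQ_inverse_real_of_nat by (auto simp: decseq_def)
  moreover have "f k \<in> eps_normals (inverse (real (Suc k))) (x k) S" for k
    using assms(3)[of k] frechet_normals_subset_eps_normals[of "inverse (real (Suc k))" "x k" S] by auto
  ultimately show ?thesis using assms(1,2) unfolding basic_normals_def by blast
qed

text \<open>On \<open>S\<close> near \<open>xb\<close> the difference
  \<open>\<phi> xb - \<phi> x\<close> is nonpositive, so the lower limit inequality for
  \<open>- \<phi>\<close> bounds \<open>f (x - xb)\<close> from above. Points with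
  \<open>\<phi> x = \<infinity>\<close> do not occur close to \<open>xb\<close>, since the quotient
  would be \<open>- \<infinity>\<close> there.\<close>

lemma upper_subgradient_normal:
  assumes f: "f \<in> frechet_subdifferential (\<lambda>x. - \<phi> x) xb" and opt: "local_optimal_solution \<phi> S xb"
  shows "f \<in> frechet_normals xb S"
proof -
  obtain \<delta> where xb: "xb \<in> S" and \<delta>: "\<delta> > 0" "\<And>x. x \<in> S \<Longrightarrow> x \<in> ball xb \<delta> \<Longrightarrow> \<phi> xb \<le> \<phi> x"
    using opt unfolding local_optimal_solution_def by blast
  have fin: "\<bar>\<phi> xb\<bar> \<noteq> \<infinity>" using f unfolding frechet_subdifferential_def by (auto split: if_splits)
  then obtain b where b: "\<phi> xb = ereal b" by auto
  have L: "0 \<le> Liminf (at xb) (\<lambda>x. (- \<phi> x - - \<phi> xb - ereal (blinfun_apply f (x - xb))) / ereal (norm (x - xb)))"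
    using f fin unfolding frechet_subdifferential_def by simp
  show ?thesis
    unfolding frechet_normals_iff[OF xb]
  proof (intro allI impI)
    fix e :: real assume e: "e > 0"
    then have "ereal (- e) < 0" by simp
    then have "\<forall>\<^sub>F x in at xb. ereal (- e) < (- \<phi> x - - \<phi> xb - ereal (blinfun_apply f (x - xb))) / ereal (norm (x - xb))"
      using L unfolding le_Liminf_iff by blast
    then obtain d where d: "d > 0" "\<And>x. x \<noteq> xb \<Longrightarrow> dist x xb < d \<Longrightarrow>
        ereal (- e) < (- \<phi> x - - \<phi> xb - ereal (blinfun_apply f (x - xb))) / ereal (norm (x - xb))"
      unfolding eventually_at by auto
    have "blinfun_apply f (u - xb) \<le> e * norm (u - xb)" if u: "u \<in> S" "norm (u - xb) < min d \<delta>" for u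
    proof (cases "u = xb")
      case False
      have lt: "ereal (- e) < (- \<phi> u - - \<phi> xb - ereal (blinfun_apply f (u - xb))) / ereal (norm (u - xb))"
        using d(2)[OF False] u(2) by (simp add: dist_norm)
      have le: "\<phi> xb \<le> \<phi> u" using \<delta>(2)[OF u(1)] u(2) by (simp add: dist_norm norm_minus_commute)
      show ?thesis
      proof (cases "\<phi> u")
        case (real a)
        have n: "norm (u - xb) > 0" using False by simp
        have "- e < (- a + b - blinfun_apply f (u - xb)) / norm (u - xb)" using lt n unfolding real b by simp
        then have "- e * norm (u - xb) < - a + b - blinfun_apply f (u - xb)" using n by (simp only: pos_less_divide_eq)
        then show ?thesis using le unfolding real b by simp
      next
        case PInf
        then show ?thesis using lt False unfolding b by simp
      next
        case MInf
        then show ?thesis using le unfolding b by simp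
      qed
    qed (simp add: blinfun.zero_right)
    then show "\<exists>d>0. \<forall>u\<in>S. norm (u - xb) < d \<longrightarrow> blinfun_apply f (u - xb) \<le> e * norm (u - xb)"
      using d(1) \<delta>(1) by (intro exI[of _ "min d \<delta>"]) auto
  qed
qed

lemma frechet_subdifferentialI:
  assumes r: "r > 0" and fin: "\<And>x. norm (x - y) < r \<Longrightarrow> \<bar>\<phi> x\<bar> \<noteq> \<infinity>"
    and sub: "\<And>e. e > 0 \<Longrightarrow> \<exists>d>0. \<forall>x. norm (x - y) < d \<longrightarrow>
      real_of_ereal (\<phi> y) + blinfun_apply f (x - y) - e * norm (x - y) \<le> real_of_ereal (\<phi> x)"
  shows "f \<in> frechet_subdifferential \<phi> y"
proof -
  have y: "\<bar>\<phi> y\<bar> \<noteq> \<infinity>" using fin[of y] r by simp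
  have "0 \<le> Liminf (at y) (\<lambda>x. (\<phi> x - \<phi> y - ereal (blinfun_apply f (x - y))) / ereal (norm (x - y)))"
    unfolding le_Liminf_iff
  proof (intro allI impI)
    fix c :: ereal assume "c < 0"
    then obtain s where s: "c < ereal s" "s < 0" using ereal_dense2[of c 0] by auto
    then obtain d where d: "d > 0" "\<And>x. norm (x - y) < d \<Longrightarrow>
        real_of_ereal (\<phi> y) + blinfun_apply f (x - y) - (- s) * norm (x - y) \<le> real_of_ereal (\<phi> x)"
      using sub[of "- s"] by auto
    show "\<forall>\<^sub>F x in at y. c < (\<phi> x - \<phi> y - ereal (blinfun_apply f (x - y))) / ereal (norm (x - y))"
      unfolding eventually_at
    proof (intro exI[of _ "min d r"] conjI ballI impI)
      fix x assume x: "x \<noteq> y \<and> dist x y < min d r"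
      then have n: "norm (x - y) > 0" "norm (x - y) < d" "norm (x - y) < r" by (auto simp: dist_norm)
      obtain a b where ab: "\<phi> x = ereal a" "\<phi> y = ereal b" using fin[OF n(3)] y by auto
      have "s * norm (x - y) \<le> a - b - blinfun_apply f (x - y)" using d(2)[OF n(2)] unfolding ab by simp
      then have "s \<le> (a - b - blinfun_apply f (x - y)) / norm (x - y)" using n(1) by (simp only: pos_le_divide_eq)
      moreover have "(\<phi> x - \<phi> y - ereal (blinfun_apply f (x - y))) / ereal (norm (x - y))
          = ereal ((a - b - blinfun_apply f (x - y)) / norm (x - y))" using n(1) unfolding ab by simp
      ultimately show "c < (\<phi> x - \<phi> y - ereal (blinfun_apply f (x - y))) / ereal (norm (x - y))"
        using less_le_trans[OF s(1)] by simp
    qed (use d(1) r in auto)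
  qed
  then show ?thesis using y unfolding frechet_subdifferential_def by simp
qed

text \<open>Exact penalisation: for \<open>y\<close> in the set,
  \<open>\<phi> x + L * norm (x - y) \<ge> \<phi> y \<ge> \<phi> xb\<close> near \<open>xb\<close>,
  so the pair of two copies of \<open>xb\<close> is a minimiser without the constraint
  \<open>x = y\<close>. The coupling term is invariant under common translations, which makes
  \<open>a + b\<close> small, and \<open>L\<close>-Lipschitz in the first point, which bounds
  \<open>a\<close>.\<close>

lemma fuzzy_optimality:
  fixes \<phi> :: "'a::banach \<Rightarrow> ereal"
  assumes asplund: "asplund_space TYPE('a)" and \<delta>: "\<delta> > 0"
    and fin: "\<And>x. x \<in> cball xb \<delta> \<Longrightarrow> \<bar>\<phi> x\<bar> \<noteq> \<infinity>"
    and lip: "L-lipschitz_on (cball xb \<delta>) (\<lambda>x. real_of_ereal (\<phi> x))"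
    and \<Omega>: "closed (\<Omega> \<inter> cball xb \<delta>)" and xb: "xb \<in> \<Omega>"
    and opt: "\<And>x. x \<in> \<Omega> \<Longrightarrow> x \<in> cball xb \<delta> \<Longrightarrow> \<phi> xb \<le> \<phi> x"
    and \<eta>: "0 < \<eta>" "\<eta> \<le> \<delta> / 2"
  obtains x y a b where "norm (x - xb) < \<eta>" "norm (y - xb) < \<eta>" "a \<in> frechet_subdifferential \<phi> x"
    "b \<in> frechet_normals y \<Omega>" "norm (a + b) \<le> \<eta>" "norm a \<le> L + \<eta>"
proof -
  define h where "h z = real_of_ereal (\<phi> (apply_bcontfun z 0))" for z :: "nat \<Rightarrow>\<^sub>C 'a"
  define g where "g z = L * norm (apply_bcontfun z 0 - apply_bcontfun z 1)" for z :: "nat \<Rightarrow>\<^sub>C 'a"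
  define S where "S = {z \<in> fin_space 2. apply_bcontfun z 0 \<in> cball xb \<delta> \<and> apply_bcontfun z 1 \<in> \<Omega> \<inter> cball xb \<delta>}"
  have L: "0 \<le> L" using lip by (rule lipschitz_on_nonneg)
  have lip': "\<bar>real_of_ereal (\<phi> x) - real_of_ereal (\<phi> y)\<bar> \<le> L * norm (x - y)" if "x \<in> cball xb \<delta>" "y \<in> cball xb \<delta>" for x y
    using lipschitz_onD[OF lip that] by (simp add: dist_norm dist_real_def)
  have S: "closed S"
  proof -
    have "S = fin_space 2 \<inter> ((\<lambda>z. apply_bcontfun z 0) -` cball xb \<delta> \<inter> (\<lambda>z. apply_bcontfun z 1) -` (\<Omega> \<inter> cball xb \<delta>))"
      by (auto simp: S_def)
    also have "closed \<dots>"
      by (intro closed_Int[of "fin_space 2"] closed_fin_space closed_Int[of "(\<lambda>z. apply_bcontfun z 0) -` cball xb \<delta>"]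
          closed_vimage closed_cball \<Omega> linear_continuous_on bounded_linear_apply_bcontfun)
    finally show ?thesis .
  qed
  have ev: "continuous_on S (\<lambda>z. apply_bcontfun z 0)" by (intro linear_continuous_on bounded_linear_apply_bcontfun)
  have h: "continuous_on S h"
    unfolding h_def
    by (rule continuous_on_compose2[OF lipschitz_on_continuous_on[OF lip] ev]) (auto simp: S_def)
  have g: "convex_on UNIV g"
  proof (rule convex_onI)
    fix t :: real and v w :: "nat \<Rightarrow>\<^sub>C 'a" assume t: "0 < t" "t < 1"
    let ?d = "\<lambda>z. apply_bcontfun z 0 - apply_bcontfun z 1"
    have "?d ((1 - t) *\<^sub>R v + t *\<^sub>R w) = (1 - t) *\<^sub>R ?d v + t *\<^sub>R ?d w" by (simp add: algebra_simps)
    then have "norm (?d ((1 - t) *\<^sub>R v + t *\<^sub>R w)) \<le> (1 - t) * norm (?d v) + t * norm (?d w)"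
      using norm_triangle_ineq[of "(1 - t) *\<^sub>R ?d v" "t *\<^sub>R ?d w"] t by simp
    from mult_left_mono[OF this L] show "g ((1 - t) *\<^sub>R v + t *\<^sub>R w) \<le> (1 - t) * g v + t * g w"
      unfolding g_def by (simp add: distrib_left mult.left_commute)
  qed simp
  have gL: "\<bar>g v - g w\<bar> \<le> (2 * L) * norm (v - w)" for v w
  proof -
    let ?d = "\<lambda>z :: nat \<Rightarrow>\<^sub>C 'a. apply_bcontfun z 0 - apply_bcontfun z 1"
    have "\<bar>norm (?d v) - norm (?d w)\<bar> \<le> norm (?d v - ?d w)" by (rule norm_triangle_ineq3)
    also have "?d v - ?d w = apply_bcontfun (v - w) 0 - apply_bcontfun (v - w) 1" by simp
    also have "norm \<dots> \<le> norm (apply_bcontfun (v - w) 0) + norm (apply_bcontfun (v - w) 1)" by (rule norm_triangle_ineq4)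
    also have "\<dots> \<le> 2 * norm (v - w)" using norm_bounded[of "v - w" 0] norm_bounded[of "v - w" 1] by linarith
    finally have "L * \<bar>norm (?d v) - norm (?d w)\<bar> \<le> L * (2 * norm (v - w))" using L by (rule mult_left_mono)
    then show ?thesis unfolding g_def using L by (simp add: right_diff_distrib[symmetric] abs_mult)
  qed
  define zb where "zb = fin_vec 2 (\<lambda>_. xb)"
  have zb: "zb \<in> S" "h zb + g zb = real_of_ereal (\<phi> xb)" using xb \<delta> by (auto simp: zb_def S_def h_def g_def)
  have min: "h zb + g zb \<le> h z + g z" if "z \<in> S" for z
  proof -
    have z: "apply_bcontfun z 0 \<in> cball xb \<delta>" "apply_bcontfun z 1 \<in> \<Omega>" "apply_bcontfun z 1 \<in> cball xb \<delta>"
      using that by (auto simp: S_def)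
    have "real_of_ereal (\<phi> xb) \<le> real_of_ereal (\<phi> (apply_bcontfun z 1))"
    proof -
      have "\<bar>\<phi> xb\<bar> \<noteq> \<infinity>" using fin[of xb] \<delta> by simp
      then show ?thesis
        using opt[OF z(2,3)] fin[OF z(3)] by (cases "\<phi> xb"; cases "\<phi> (apply_bcontfun z 1)") auto
    qed
    then show ?thesis unfolding zb(2) using lip'[OF z(1,3)] by (simp add: h_def g_def abs_le_iff)
  qed
  have gauge: "\<exists>p. smooth_gauge (closure C) p"
    if "countable C" "subspace (closure C)" "closure C \<subseteq> fin_space 2" for C :: "(nat \<Rightarrow>\<^sub>C 'a) set"
    using smooth_gauge_fin_space[OF asplund that] .
  have SV: "S \<subseteq> fin_space 2" by (auto simp: S_def)
  obtain y y' \<nu> where y: "y \<in> S" "norm (y - zb) < \<eta>"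
    and sub: "subgradient_on S h y (blinfun_apply \<nu>)"
    and conv: "\<And>v. g y' - blinfun_apply \<nu> (v - y') - \<eta> * norm (v - y') \<le> g v"
    by (rule fuzzy_sum_rule[OF subspace_fin_space closed_fin_space SV gauge S h g gL zb(1) min \<eta>(1)];
        (rule that; assumption)?)
  have yk: "norm (apply_bcontfun y k - xb) < \<eta>" if "k < 2" for k
  proof -
    have "norm (apply_bcontfun y k - xb) \<le> norm (y - zb)" using norm_bounded[of "y - zb" k] that by (simp add: zb_def)
    then show ?thesis using y(2) by simp
  qed
  have near: "u \<in> cball xb \<delta>" if "norm (u - apply_bcontfun y k) < \<delta> / 2" "k < 2" for u k
    using norm_triangle_ineq[of "u - apply_bcontfun y k" "apply_bcontfun y k - xb"] that yk[of k] \<eta>(2)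
    by (simp add: dist_norm norm_minus_commute)
  have yS: "y \<in> fin_space 2" "apply_bcontfun y 0 \<in> cball xb \<delta>" "apply_bcontfun y 1 \<in> \<Omega>" "apply_bcontfun y 1 \<in> cball xb \<delta>"
    using y(1) by (auto simp: S_def)
  have y_unit: "y + fin_unit 2 k u \<in> fin_space 2" for k u
    using yS(1) by (intro subspace_add[OF subspace_fin_space]) auto
  let ?a = "component 2 \<nu> 0" and ?b = "component 2 \<nu> 1"
  show ?thesis
  proof (rule that[of "apply_bcontfun y 0" "apply_bcontfun y 1" ?a ?b])
    show "norm (apply_bcontfun y 0 - xb) < \<eta>" "norm (apply_bcontfun y 1 - xb) < \<eta>" using yk by auto
    show "?a \<in> frechet_subdifferential \<phi> (apply_bcontfun y 0)"
    proof (rule frechet_subdifferentialI[of "\<delta> / 2"])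
      show "\<bar>\<phi> u\<bar> \<noteq> \<infinity>" if "norm (u - apply_bcontfun y 0) < \<delta> / 2" for u using fin near[OF that] by simp
      fix e :: real assume e: "e > 0"
      then obtain d where d: "d > 0" "\<And>v. v \<in> S \<Longrightarrow> norm (v - y) < d \<Longrightarrow> h y + blinfun_apply \<nu> (v - y) - e * norm (v - y) \<le> h v"
        using sub unfolding subgradient_on_def by blast
      have "real_of_ereal (\<phi> (apply_bcontfun y 0)) + blinfun_apply ?a (u - apply_bcontfun y 0) - e * norm (u - apply_bcontfun y 0)
          \<le> real_of_ereal (\<phi> u)" if u: "norm (u - apply_bcontfun y 0) < min d (\<delta> / 2)" for u
      proof -
        let ?w = "fin_unit 2 0 (u - apply_bcontfun y 0)"
        have w: "norm ?w \<le> norm (u - apply_bcontfun y 0)" by (rule norm_fin_unit)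
        have "y + ?w \<in> S" using y_unit yS near[of u 0] u unfolding S_def by (simp add: apply_fin_unit)
        then have "h y + blinfun_apply \<nu> ?w - e * norm ?w \<le> h (y + ?w)" using d(2)[of "y + ?w"] w u by simp
        moreover have "h (y + ?w) = real_of_ereal (\<phi> u)" by (simp add: h_def apply_fin_unit)
        moreover have "e * norm ?w \<le> e * norm (u - apply_bcontfun y 0)" using w e by simp
        ultimately show ?thesis by (simp add: h_def apply_component)
      qed
      then show "\<exists>d>0. \<forall>u. norm (u - apply_bcontfun y 0) < d \<longrightarrow>
          real_of_ereal (\<phi> (apply_bcontfun y 0)) + blinfun_apply ?a (u - apply_bcontfun y 0) - e * norm (u - apply_bcontfun y 0)
          \<le> real_of_ereal (\<phi> u)"
        using d(1) \<delta> by (intro exI[of _ "min d (\<delta> / 2)"]) auto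
    qed (use \<delta> in simp)
    show "?b \<in> frechet_normals (apply_bcontfun y 1) \<Omega>"
    proof (rule component_normal[OF sub yS(3), of "\<delta> / 2"])
      fix u assume u: "u \<in> \<Omega>" "norm (u - apply_bcontfun y 1) < \<delta> / 2"
      then show "y + fin_unit 2 1 (u - apply_bcontfun y 1) \<in> S \<and> h (y + fin_unit 2 1 (u - apply_bcontfun y 1)) = h y"
        using y_unit yS near[of u 1] unfolding S_def h_def by (simp add: apply_fin_unit)
    qed (use \<delta> in simp)
    show "norm (?a + ?b) \<le> \<eta>"
    proof (rule norm_blinfun_bound_above)
      fix d :: 'a
      let ?w = "fin_vec 2 (\<lambda>_. - d)"
      have "norm ?w \<le> norm d" by (rule norm_fin_space_le[OF fin_vec_in]) auto
      then have "\<eta> * norm ?w \<le> \<eta> * norm d" using \<eta>(1) by simp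
      moreover have "g (y' + ?w) = g y'" by (simp add: g_def)
      moreover have "blinfun_apply \<nu> ?w = - blinfun_apply (?a + ?b) d"
        unfolding sum_components[OF fin_vec_in] by (simp add: numeral_2_eq_2 blinfun.minus_right blinfun.add_left)
      ultimately show "blinfun_apply (?a + ?b) d \<le> \<eta> * norm d" using conv[of "y' + ?w"] by simp
    qed (use \<eta> in simp)
    show "norm ?a \<le> L + \<eta>"
    proof (rule norm_blinfun_bound_above)
      fix d :: 'a
      let ?w = "fin_unit 2 0 (- d)"
      have "norm ?w \<le> norm d" using norm_fin_unit[of 2 0 "- d"] by simp
      then have "\<eta> * norm ?w \<le> \<eta> * norm d" using \<eta>(1) by simp
      moreover have "g (y' + ?w) \<le> g y' + L * norm d"
      proof -
        have "norm (apply_bcontfun y' 0 - d - apply_bcontfun y' 1) \<le> norm (apply_bcontfun y' 0 - apply_bcontfun y' 1) + norm d"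
          using norm_triangle_ineq4[of "apply_bcontfun y' 0 - apply_bcontfun y' 1" d] by (simp add: algebra_simps)
        from mult_left_mono[OF this L] show ?thesis by (simp add: g_def apply_fin_unit distrib_left)
      qed
      moreover have "blinfun_apply \<nu> ?w = - blinfun_apply ?a d"
        unfolding apply_component[symmetric] by (rule blinfun.minus_right)
      ultimately show "blinfun_apply ?a d \<le> (L + \<eta>) * norm d" using conv[of "y' + ?w"] by (simp add: distrib_right)
    qed (use \<eta> L in simp)
  qed
qed

theorem basic_subgradient_optimality:
  fixes \<phi> :: "'a::banach \<Rightarrow> ereal"
  assumes asplund: "asplund_space TYPE('a)" and \<rho>: "\<rho> > 0" and \<Omega>: "closed (\<Omega> \<inter> cball xb \<rho>)"
    and opt: "local_optimal_solution \<phi> \<Omega> xb" and lip: "locally_lipschitz_around \<phi> xb"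
  obtains v where "v \<in> basic_subdifferential \<phi> xb" "- v \<in> basic_normals xb \<Omega>"
proof -
  obtain \<rho>' L where \<rho>': "\<rho>' > 0" and fin: "\<forall>x\<in>ball xb \<rho>'. \<bar>\<phi> x\<bar> \<noteq> \<infinity>"
    and L: "L-lipschitz_on (ball xb \<rho>') (\<lambda>x. real_of_ereal (\<phi> x))"
    using lip unfolding locally_lipschitz_around_def by blast
  obtain \<delta>' where xb: "xb \<in> \<Omega>" and \<delta>': "\<delta>' > 0" "\<And>x. x \<in> \<Omega> \<Longrightarrow> x \<in> ball xb \<delta>' \<Longrightarrow> \<phi> xb \<le> \<phi> x"
    using opt unfolding local_optimal_solution_def by blast
  \<comment> \<open>The halves turn the open balls of radius \<open>\<rho>'\<close> and
    \<open>\<delta>'\<close> into neighbourhoods of one closed ball.\<close>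
  define \<delta> where "\<delta> = min \<rho> (min (\<rho>' / 2) (\<delta>' / 2))"
  have \<delta>: "\<delta> > 0" "\<delta> \<le> \<rho>" "\<delta> < \<rho>'" "\<delta> < \<delta>'" using \<rho> \<rho>' \<delta>'(1) by (auto simp: \<delta>_def)
  have sub: "cball xb \<delta> \<subseteq> ball xb \<rho>'" "cball xb \<delta> \<subseteq> ball xb \<delta>'" using \<delta> by auto
  have "\<Omega> \<inter> cball xb \<delta> = (\<Omega> \<inter> cball xb \<rho>) \<inter> cball xb \<delta>" using \<delta>(2) by auto
  then have \<Omega>\<delta>: "closed (\<Omega> \<inter> cball xb \<delta>)" using \<Omega> by (simp add: closed_Int)
  define \<eta> where "\<eta> k = min (\<delta> / 2) (inverse (real (Suc k)))" for k
  have \<eta>: "0 < \<eta> k" "\<eta> k \<le> \<delta> / 2" "\<eta> k \<le> inverse (real (Suc k))" for k using \<delta>(1) by (auto simp: \<eta>_def)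
  have "\<exists>Z. norm (fst Z - xb) < \<eta> k \<and> norm (fst (snd Z) - xb) < \<eta> k \<and> fst (snd (snd Z)) \<in> frechet_subdifferential \<phi> (fst Z) \<and>
      snd (snd (snd Z)) \<in> frechet_normals (fst (snd Z)) \<Omega> \<and> norm (fst (snd (snd Z)) + snd (snd (snd Z))) \<le> \<eta> k \<and>
      norm (fst (snd (snd Z))) \<le> L + \<eta> k" for k
  proof -
    have fin\<delta>: "\<bar>\<phi> x\<bar> \<noteq> \<infinity>" if "x \<in> cball xb \<delta>" for x by (rule bspec[OF fin subsetD[OF sub(1) that]])
    have opt\<delta>: "\<phi> xb \<le> \<phi> x" if "x \<in> \<Omega>" "x \<in> cball xb \<delta>" for x using \<delta>'(2) that sub(2) by blast
    obtain x y a b where "norm (x - xb) < \<eta> k" "norm (y - xb) < \<eta> k" "a \<in> frechet_subdifferential \<phi> x"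
      "b \<in> frechet_normals y \<Omega>" "norm (a + b) \<le> \<eta> k" "norm a \<le> L + \<eta> k"
      by (rule fuzzy_optimality[OF asplund \<delta>(1) fin\<delta> lipschitz_on_subset[OF L sub(1)] \<Omega>\<delta> xb opt\<delta> \<eta>(1,2)];
          (rule that; assumption)?)
    then show ?thesis by (intro exI[of _ "(x, y, a, b)"]) simp
  qed
  then have "\<exists>Z. \<forall>k. norm (fst (Z k) - xb) < \<eta> k \<and> norm (fst (snd (Z k)) - xb) < \<eta> k \<and>
      fst (snd (snd (Z k))) \<in> frechet_subdifferential \<phi> (fst (Z k)) \<and>
      snd (snd (snd (Z k))) \<in> frechet_normals (fst (snd (Z k))) \<Omega> \<and> norm (fst (snd (snd (Z k))) + snd (snd (snd (Z k)))) \<le> \<eta> k \<and>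
      norm (fst (snd (snd (Z k)))) \<le> L + \<eta> k" by (intro choice allI)
  then obtain Z where Z: "\<And>k. norm (fst (Z k) - xb) < \<eta> k \<and> norm (fst (snd (Z k)) - xb) < \<eta> k \<and>
      fst (snd (snd (Z k))) \<in> frechet_subdifferential \<phi> (fst (Z k)) \<and>
      snd (snd (snd (Z k))) \<in> frechet_normals (fst (snd (Z k))) \<Omega> \<and> norm (fst (snd (snd (Z k))) + snd (snd (snd (Z k)))) \<le> \<eta> k \<and>
      norm (fst (snd (snd (Z k)))) \<le> L + \<eta> k" by blast
  define x y a b where "x k = fst (Z k)" and "y k = fst (snd (Z k))" and "a k = fst (snd (snd (Z k)))"
    and "b k = snd (snd (snd (Z k)))" for k
  have x: "norm (x k - xb) < \<eta> k" and y: "norm (y k - xb) < \<eta> k" and a: "a k \<in> frechet_subdifferential \<phi> (x k)"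
    and b: "b k \<in> frechet_normals (y k) \<Omega>" and ab: "norm (a k + b k) \<le> \<eta> k" and aL: "norm (a k) \<le> L + \<delta> / 2" for k
    using Z[of k] \<eta>(2)[of k] by (auto simp: x_def y_def a_def b_def)
  have \<eta>0: "\<eta> \<longlonglongrightarrow> 0"
    by (rule Lim_null_comparison[OF _ LIMSEQ_inverse_real_of_nat]) (use \<eta>(3) less_imp_le[OF \<eta>(1)] in \<open>simp add: always_eventually\<close>)
  have to_xb: "w \<longlonglongrightarrow> xb" if "\<And>k. norm (w k - xb) < \<eta> k" for w
  proof -
    have "(\<lambda>k. w k - xb) \<longlonglongrightarrow> 0"
      by (rule Lim_null_comparison[OF always_eventually \<eta>0]) (use that less_imp_le in blast)
    then show ?thesis by (simp add: LIM_zero_iff)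
  qed
  note x0 = to_xb[OF x] and y0 = to_xb[OF y]
  obtain r v where r: "strict_mono r" and v: "limitin weak_star_topology (a \<circ> r) v sequentially"
    by (rule asplund_weak_star_sequentially_compact[where f = a, OF asplund aL]; (rule that; assumption)?)
  have "v \<in> basic_subdifferential \<phi> xb"
    unfolding basic_subdifferential_def
    using LIMSEQ_subseq_LIMSEQ[OF x0 r] v a
    by (intro CollectI exI[of _ "x \<circ> r"] exI[of _ "a \<circ> r"]) simp
  moreover have "limitin weak_star_topology (b \<circ> r) (- v) sequentially"
    unfolding limitin_weak_star_iff
  proof
    fix u
    \<comment> \<open>The normals inherit weak-star convergence from the subgradients, as
      \<open>a k + b k\<close> tends to 0 in norm.\<close>
    have "(\<lambda>k. blinfun_apply (a (r k) + b (r k)) u) \<longlonglongrightarrow> 0"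
    proof (rule Lim_null_comparison)
      show "(\<lambda>k. \<eta> (r k) * norm u) \<longlonglongrightarrow> 0"
        using tendsto_mult_right[OF LIMSEQ_subseq_LIMSEQ[OF \<eta>0 r], of "norm u"] by (simp add: o_def)
      have "norm (blinfun_apply (a (r k) + b (r k)) u) \<le> \<eta> (r k) * norm u" for k
        using norm_blinfun[of "a (r k) + b (r k)" u] mult_right_mono[OF ab[of "r k"] norm_ge_zero[of u]] by linarith
      then show "\<forall>\<^sub>F k in sequentially. norm (blinfun_apply (a (r k) + b (r k)) u) \<le> \<eta> (r k) * norm u" by simp
    qed
    moreover have "(\<lambda>k. blinfun_apply (a (r k)) u) \<longlonglongrightarrow> blinfun_apply v u"
      using v unfolding limitin_weak_star_iff by simp
    ultimately have "(\<lambda>k. blinfun_apply (a (r k) + b (r k)) u - blinfun_apply (a (r k)) u) \<longlonglongrightarrow> 0 - blinfun_apply v u"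
      by (rule tendsto_diff)
    then show "(\<lambda>k. blinfun_apply ((b \<circ> r) k) u) \<longlonglongrightarrow> blinfun_apply (- v) u"
      by (simp add: blinfun.add_left blinfun.minus_left)
  qed
  then have "- v \<in> basic_normals xb \<Omega>"
    using LIMSEQ_subseq_LIMSEQ[OF y0 r] b by (intro basic_normalI[of "y \<circ> r" _ "b \<circ> r"]) auto
  ultimately show ?thesis using that by blast
qed

theorem theorem5p15:
  fixes \<phi> :: "'a::banach \<Rightarrow> ereal"
    and T :: "'i set"
    and \<Omega> :: "'i \<Rightarrow> 'a set"
    and xbar :: 'a
  assumes asplund: "asplund_space TYPE('a)"
    and proper: "\<And>x. \<phi> x \<noteq> -\<infinity>"
    and closed: "system_closed_around T \<Omega> xbar"
    and optimal: "local_optimal_solution \<phi> (\<Inter>i\<in>T. \<Omega> i) xbar"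
    and normals: "\<And>xs. xs \<in> basic_normals xbar (\<Inter>i\<in>T. \<Omega> i) \<Longrightarrow> limiting_rated_normal T \<Omega> xbar xs"
    and aqc: "approximate_qualification T \<Omega> xbar"
  shows "(\<bar>\<phi> xbar\<bar> \<noteq> \<infinity> \<longrightarrow>
            (\<lambda>xs. - xs) ` frechet_upper_subdifferential \<phi> xbar
              \<subseteq> (\<Inter>\<epsilon>\<in>{0<..}. weak_star_topology closure_of approximate_normal_sums T \<Omega> xbar \<epsilon>)) \<and>
         (locally_lipschitz_around \<phi> xbar \<longrightarrow>
            0 \<in> basic_subdifferential \<phi> xbar
               + (\<Inter>\<epsilon>\<in>{0<..}. weak_star_topology closure_of approximate_normal_sums T \<Omega> xbar \<epsilon>))"
proof -
  let ?\<Omega> = "\<Inter>i\<in>T. \<Omega> i"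
  let ?C = "\<Inter>\<epsilon>\<in>{0<..}. weak_star_topology closure_of approximate_normal_sums T \<Omega> xbar \<epsilon>"
  have C: "f \<in> ?C" if "f \<in> basic_normals xbar ?\<Omega>" for f
    using limiting_rated_normal_in_closure[OF asplund closed aqc normals[OF that]] by simp
  have upper: "(\<lambda>xs. - xs) ` frechet_upper_subdifferential \<phi> xbar \<subseteq> ?C"
  proof
    fix f assume "f \<in> (\<lambda>xs. - xs) ` frechet_upper_subdifferential \<phi> xbar"
    then have "f \<in> frechet_subdifferential (\<lambda>x. - \<phi> x) xbar" unfolding frechet_upper_subdifferential_def by auto
    then have "f \<in> frechet_normals xbar ?\<Omega>" using optimal by (rule upper_subgradient_normal)
    then have "f \<in> basic_normals xbar ?\<Omega>"
      by (intro basic_normalI[of "\<lambda>_. xbar" _ "\<lambda>_. f"]) (simp_all add: strong_operator_topology_topspace)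
    then show "f \<in> ?C" by (rule C)
  qed
  have "0 \<in> basic_subdifferential \<phi> xbar + ?C" if lip: "locally_lipschitz_around \<phi> xbar"
  proof -
    obtain \<rho> where \<rho>: "\<rho> > 0" "\<And>i. i \<in> T \<Longrightarrow> closed (\<Omega> i \<inter> cball xbar \<rho>)"
      using closed unfolding system_closed_around_def by blast
    have "?\<Omega> \<inter> cball xbar \<rho> = (\<Inter>i\<in>T. \<Omega> i \<inter> cball xbar \<rho>) \<inter> cball xbar \<rho>" by auto
    also have "closed \<dots>" using \<rho>(2) by (intro closed_Int[OF closed_INT closed_cball] ballI)
    finally obtain v where v: "v \<in> basic_subdifferential \<phi> xbar" "- v \<in> basic_normals xbar ?\<Omega>"
      using basic_subgradient_optimality[OF asplund \<rho>(1) _ optimal lip] by blast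
    have "v + - v \<in> basic_subdifferential \<phi> xbar + ?C" by (rule set_plus_intro[OF v(1) C[OF v(2)]])
    then show ?thesis by simp
  qed
  then show ?thesis using upper by blast
qed

end
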